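(* Let $\mathcal{A}$ be a unital $C^*$-algebra with finite dimensional bounded trace space. Suppose that $\partial_e\mathrm{T}(\mathcal{A})^+_1$ has $n$ elements, $\partial_e\mathrm{T}(\mathcal{A})^+_1=\{\varphi_i\}_{i=1}^n$. Then for any $B\in\mathrm{F}(\mathcal{A})$ there exist an invertible diagonal matrix $D\in M_n(\mathbb{R}^+)$ and $\sigma\in S_n$ such that $B=DU(\sigma)$ and $D_{ii}\,\varphi_i^*(K_0(\mathcal{A}))=\varphi_{\sigma(i)}^*(K_0(\mathcal{A}))$ for every $i$.
   Context: $\mathrm{T}(\mathcal{A})$ denotes the space of bounded traces on $\mathcal{A}$ (bounded linear functionals $\varphi$ with $\varphi(ab)=\varphi(ba)$), $\mathrm{T}(\mathcal{A})^+_1$ the set of positive traces of norm one, and $\partial_e\mathrm{T}(\mathcal{A})^+_1$ its set of extreme points, which is a basis of $\mathrm{T}(\mathcal{A})$ when it is finite and nonempty. A self-similar pair $(p,\Phi)$ of $\mathcal{A}$ consists of a projection $p\in M_k(\mathcal{A})$, for some $k$, such that the linear span of $\{a^*pb : a,b\in\mathcal{A}^k\}$ is dense in $\mathcal{A}$ (elements of $\mathcal{A}^k$ regarded as columns), and a $*$-isomorphism $\Phi:\mathcal{A}\to pM_k(\mathcal{A})p$. It defines a linear map $T_{(p,\Phi)}$ on $\mathrm{T}(\mathcal{A})$ by $T_{(p,\Phi)}(\varphi)=(\mathrm{Tr}_k\otimes\varphi)\circ\Phi$, with $\mathrm{Tr}_k$ the unnormalized trace on $M_k(\mathbb{C})$.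 The fundamental group $\mathrm{F}(\mathcal{A})$ is the group of matrices of all the maps $T_{(p,\Phi)}$ with respect to the basis $\varphi_1,\dots,\varphi_n$, where $T$ has matrix $B$ if $T\varphi_j=\sum_i B_{ij}\varphi_i$. $M_n(\mathbb{R}^+)$ is the set of $n\times n$ matrices with nonnegative real entries. For $\sigma\in S_n$, $U(\sigma)_{ij}=1$ if $j=\sigma(i)$ and $U(\sigma)_{ij}=0$ otherwise. For a bounded positive trace $\varphi$, $\varphi^*:K_0(\mathcal{A})\to\mathbb{R}$ is the induced homomorphism, $\varphi^*([p]_0)=(\mathrm{Tr}_k\otimes\varphi)(p)$ for projections $p\in M_k(\mathcal{A})$. *)

theory Defs
  imports
    "HOL-Analysis.Bounded_Linear_Function"
    "HOL-Analysis.Polytope"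
    "HOL-Library.Nonpos_Ints"
    "HOL-Combinatorics.Permutations"
    "Jordan_Normal_Form.Matrix"
begin

text \<open>
  The parent class \<^class>\<open>real_normed_algebra_1\<close> contains \<open>0 \<noteq> 1\<close> and \<open>norm 1 = 1\<close>; the latter
  holds in every nonzero unital C*-algebra, so only the zero algebra (which has no traces of
  norm one) is left out.
\<close>

class unital_cstar_algebra = real_normed_algebra_1 + banach +
  fixes scaleC :: "complex \<Rightarrow> 'a \<Rightarrow> 'a" (infixr \<open>*\<^sub>C\<close> 75)
    and star :: "'a \<Rightarrow> 'a"
  assumes scaleC_add_right: "c *\<^sub>C (x + y) = c *\<^sub>C x + c *\<^sub>C y"
    and scaleC_add_left: "(c + d) *\<^sub>C x = c *\<^sub>C x + d *\<^sub>C x"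
    and scaleC_scaleC: "c *\<^sub>C d *\<^sub>C x = (c * d) *\<^sub>C x"
    and scaleC_of_real: "complex_of_real r *\<^sub>C x = r *\<^sub>R x"
    and mult_scaleC_left: "(c *\<^sub>C x) * y = c *\<^sub>C (x * y)"
    and mult_scaleC_right: "x * (c *\<^sub>C y) = c *\<^sub>C (x * y)"
    and norm_scaleC: "norm (c *\<^sub>C x) = cmod c * norm x"
    and star_star: "star (star x) = x"
    and star_add: "star (x + y) = star x + star y"
    and star_mult: "star (x * y) = star y * star x"
    and star_scaleC: "star (c *\<^sub>C x) = cnj c *\<^sub>C star x"
    and cstar_identity: "norm (star x * x) = (norm x)\<^sup>2"
begin

lemma star_zero [simp]: "star 0 = 0"
  using star_add [of 0 0] by simp

lemma star_sum: "star (\<Sum>i\<in>I. f i) = (\<Sum>i\<in>I. star (f i))"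
  by (induction I rule: infinite_finite_induct) (auto simp: star_add)

end

global_interpretation complex_vector:
  vector_space "scaleC :: complex \<Rightarrow> 'a \<Rightarrow> 'a::unital_cstar_algebra"
  using scaleC_of_real [of 1]
  by unfold_locales (auto simp: scaleC_add_right scaleC_add_left scaleC_scaleC)

definition bounded_traces :: "('a::unital_cstar_algebra \<Rightarrow>\<^sub>L complex) set" where
  "bounded_traces = {\<phi>. (\<forall>c a. blinfun_apply \<phi> (c *\<^sub>C a) = c * blinfun_apply \<phi> a) \<and>
                        (\<forall>a b. blinfun_apply \<phi> (a * b) = blinfun_apply \<phi> (b * a))}"

definition positive_functional :: "('a::unital_cstar_algebra \<Rightarrow>\<^sub>L complex) \<Rightarrow> bool" where
  "positive_functional \<phi> \<longleftrightarrow> (\<forall>a. blinfun_apply \<phi> (star a * a) \<in> \<real>\<^sub>\<ge>\<^sub>0)"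

definition tracial_states :: "('a::unital_cstar_algebra \<Rightarrow>\<^sub>L complex) set" where
  "tracial_states = {\<phi> \<in> bounded_traces. positive_functional \<phi> \<and> norm \<phi> = 1}"

definition extreme_traces :: "('a::unital_cstar_algebra \<Rightarrow>\<^sub>L complex) set" where
  "extreme_traces = {\<phi>. \<phi> extreme_point_of tracial_states}"

text \<open>Finite dimensionality over the complex numbers, for spaces of functionals.\<close>

definition finite_dim_functionals :: "('a::unital_cstar_algebra \<Rightarrow>\<^sub>L complex) set \<Rightarrow> bool" where
  "finite_dim_functionals V \<longleftrightarrow>
     (\<exists>S. finite S \<and> S \<subseteq> V \<and>
       (\<forall>\<phi>\<in>V. \<exists>c. \<forall>a. blinfun_apply \<phi> a = (\<Sum>\<psi>\<in>S. c \<psi> * blinfun_apply \<psi> a)))"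

definition mat_star :: "'a::unital_cstar_algebra mat \<Rightarrow> 'a mat" where
  "mat_star x = mat (dim_col x) (dim_row x) (\<lambda>(i, j). star (x $$ (j, i)))"

definition projections :: "'a::unital_cstar_algebra mat set" where
  "projections = {p. square_mat p \<and> p * p = p \<and> mat_star p = p}"

text \<open>\<open>(Tr\<^sub>k \<otimes> \<phi>)(x)\<close> with the unnormalized trace, where \<open>k\<close> is the number of rows of \<open>x\<close>.\<close>

definition trace_ext :: "('a::unital_cstar_algebra \<Rightarrow>\<^sub>L complex) \<Rightarrow> 'a mat \<Rightarrow> complex" where
  "trace_ext \<phi> x = (\<Sum>i<dim_row x. blinfun_apply \<phi> (x $$ (i, i)))"

definition corner :: "nat \<Rightarrow> 'a::unital_cstar_algebra mat \<Rightarrow> 'a mat set" where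
  "corner k p = (\<lambda>x. p * x * p) ` carrier_mat k k"

text \<open>Columns \<open>a, b\<close> over the algebra are \<open>k \<times> 1\<close> matrices, so \<open>a\<^sup>* p b\<close> is a \<open>1 \<times> 1\<close> matrix.\<close>

definition full_projection :: "nat \<Rightarrow> 'a::unital_cstar_algebra mat \<Rightarrow> bool" where
  "full_projection k p \<longleftrightarrow> p \<in> carrier_mat k k \<and> p \<in> projections \<and>
     closure (complex_vector.span
       {(mat_star a * p * b) $$ (0, 0) | a b. a \<in> carrier_mat k 1 \<and> b \<in> carrier_mat k 1}) = UNIV"

definition star_isomorphism_onto_corner ::
    "nat \<Rightarrow> 'a::unital_cstar_algebra mat \<Rightarrow> ('a \<Rightarrow> 'a mat) \<Rightarrow> bool" where
  "star_isomorphism_onto_corner k p \<Phi> \<longleftrightarrow>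
     bij_betw \<Phi> UNIV (corner k p) \<and>
     (\<forall>a b. \<Phi> (a + b) = \<Phi> a + \<Phi> b) \<and>
     (\<forall>c a. \<Phi> (c *\<^sub>C a) = map_mat (scaleC c) (\<Phi> a)) \<and>
     (\<forall>a b. \<Phi> (a * b) = \<Phi> a * \<Phi> b) \<and>
     (\<forall>a. \<Phi> (star a) = mat_star (\<Phi> a))"

definition self_similar_pair ::
    "nat \<Rightarrow> 'a::unital_cstar_algebra mat \<Rightarrow> ('a \<Rightarrow> 'a mat) \<Rightarrow> bool" where
  "self_similar_pair k p \<Phi> \<longleftrightarrow> full_projection k p \<and> star_isomorphism_onto_corner k p \<Phi>"

text \<open>
  The values are given as plain functions; that they are again bounded traces follows from the
  automatic continuity of *-homomorphisms between C*-algebras.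
\<close>

definition self_similar_map ::
    "('a::unital_cstar_algebra \<Rightarrow> 'a mat) \<Rightarrow> ('a \<Rightarrow>\<^sub>L complex) \<Rightarrow> 'a \<Rightarrow> complex" where
  "self_similar_map \<Phi> \<phi> = trace_ext \<phi> \<circ> \<Phi>"

definition fundamental_group ::
    "nat \<Rightarrow> (nat \<Rightarrow> 'a::unital_cstar_algebra \<Rightarrow>\<^sub>L complex) \<Rightarrow> complex mat set" where
  "fundamental_group n \<phi> = {B \<in> carrier_mat n n. \<exists>k p \<Phi>. self_similar_pair k p \<Phi> \<and>
     (\<forall>j<n. \<forall>a. self_similar_map \<Phi> (\<phi> j) a = (\<Sum>i<n. B $$ (i, j) * blinfun_apply (\<phi> i) a))}"

definition dsum :: "'a::unital_cstar_algebra mat \<Rightarrow> 'a mat \<Rightarrow> 'a mat" where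
  "dsum p q = four_block_mat p (0\<^sub>m (dim_row p) (dim_col q)) (0\<^sub>m (dim_row q) (dim_col p)) q"

text \<open>Murray--von Neumann equivalence of projections over matrix algebras of possibly different size.\<close>

definition mvn_equiv :: "'a::unital_cstar_algebra mat \<Rightarrow> 'a mat \<Rightarrow> bool" where
  "mvn_equiv p q \<longleftrightarrow> p \<in> projections \<and> q \<in> projections \<and>
     (\<exists>v \<in> carrier_mat (dim_row q) (dim_row p). mat_star v * v = p \<and> v * mat_star v = q)"

lemma dim_mat_star [simp]: "dim_row (mat_star x) = dim_col x" "dim_col (mat_star x) = dim_row x"
  by (simp_all add: mat_star_def)

lemma index_mat_star [simp]:
  "i < dim_col x \<Longrightarrow> j < dim_row x \<Longrightarrow> mat_star x $$ (i, j) = star (x $$ (j, i))"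
  by (simp add: mat_star_def)

lemma mat_star_carrier [simp]: "x \<in> carrier_mat m n \<Longrightarrow> mat_star x \<in> carrier_mat n m"
  by auto

lemma mat_star_mat_star [simp]: "mat_star (mat_star x) = x"
  by (intro eq_matI) (auto simp: star_star)

lemma mat_star_mult:
  "x \<in> carrier_mat m n \<Longrightarrow> y \<in> carrier_mat n r \<Longrightarrow> mat_star (x * y) = mat_star y * mat_star x"
  by (intro eq_matI) (auto simp: scalar_prod_def star_sum star_mult intro!: sum.cong)

lemma mat_star_zero [simp]: "mat_star (0\<^sub>m m n) = 0\<^sub>m n m"
  by (intro eq_matI) auto

lemma mat_star_four_block:
  "a \<in> carrier_mat m r \<Longrightarrow> b \<in> carrier_mat m s \<Longrightarrow> c \<in> carrier_mat n r \<Longrightarrow> d \<in> carrier_mat n s \<Longrightarrow>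
   mat_star (four_block_mat a b c d) =
   four_block_mat (mat_star a) (mat_star c) (mat_star b) (mat_star d)"
  by (intro eq_matI) auto

lemma projectionsD:
  "p \<in> projections \<Longrightarrow> p \<in> carrier_mat (dim_row p) (dim_row p)"
  "p \<in> projections \<Longrightarrow> p * p = p"
  "p \<in> projections \<Longrightarrow> mat_star p = p"
  by (auto simp: projections_def)

lemma zero_projection: "0\<^sub>m 0 0 \<in> projections"
  by (auto simp: projections_def)

lemma dsum_carrier:
  "p \<in> carrier_mat m m \<Longrightarrow> q \<in> carrier_mat n n \<Longrightarrow> dsum p q \<in> carrier_mat (m + n) (m + n)"
  by (auto simp: dsum_def)

lemma dsum_mult:
  assumes "a \<in> carrier_mat m r" "b \<in> carrier_mat n s" "c \<in> carrier_mat r m'" "d \<in> carrier_mat s n'"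
  shows "dsum a b * dsum c d = dsum (a * c) (b * d)"
proof -
  have "dsum a b * dsum c d = four_block_mat a (0\<^sub>m m s) (0\<^sub>m n r) b * four_block_mat c (0\<^sub>m r n') (0\<^sub>m s m') d"
    using assms by (simp add: dsum_def)
  also have "\<dots> = dsum (a * c) (b * d)"
    by (subst mult_four_block_mat[of _ m r _ s _ n _ _ m' _ n'])
      (use assms in \<open>auto simp: dsum_def\<close>)
  finally show ?thesis .
qed

lemma mat_star_dsum: "mat_star (dsum a b) = dsum (mat_star a) (mat_star b)"
  unfolding dsum_def
  by (subst mat_star_four_block[of _ "dim_row a" "dim_col a" _ "dim_col b" _ "dim_row b"]) auto

lemma dsum_projection:
  assumes "p \<in> projections" "q \<in> projections"
  shows "dsum p q \<in> projections"
proof -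
  note P = projectionsD[OF assms(1)] and Q = projectionsD[OF assms(2)]
  have "dsum p q * dsum p q = dsum p q"
    using dsum_mult[OF P(1) Q(1) P(1) Q(1)] P Q by simp
  moreover have "mat_star (dsum p q) = dsum p q" using P Q by (simp add: mat_star_dsum)
  moreover have "square_mat (dsum p q)" using dsum_carrier[OF P(1) Q(1)] by auto
  ultimately show ?thesis by (simp add: projections_def)
qed

lemma dsum_zero [simp]: "dsum (0\<^sub>m 0 0) p = p" "dsum p (0\<^sub>m 0 0) = p"
  unfolding dsum_def by (auto intro!: eq_matI)

lemma dsum_assoc: "dsum (dsum p q) r = dsum p (dsum q r)"
  unfolding dsum_def by (rule assoc_four_block_mat[symmetric])

lemma mvn_equiv_refl: "p \<in> projections \<Longrightarrow> mvn_equiv p p"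
  unfolding mvn_equiv_def by (metis projectionsD)

lemma mvn_equiv_sym: "mvn_equiv p q \<Longrightarrow> mvn_equiv q p"
  unfolding mvn_equiv_def by (metis mat_star_carrier mat_star_mat_star)

lemma mvn_equiv_trans:
  assumes "mvn_equiv p q" "mvn_equiv q r"
  shows "mvn_equiv p r"
proof -
  define l m n where "l = dim_row p" and "m = dim_row q" and "n = dim_row r"
  note defs = l_def [symmetric] m_def [symmetric] n_def [symmetric]
  from assms have proj: "p \<in> projections" "q \<in> projections" "r \<in> projections"
    by (auto simp: mvn_equiv_def)
  from assms obtain v w where
    v: "v \<in> carrier_mat m l" "mat_star v * v = p" "v * mat_star v = q" and
    w: "w \<in> carrier_mat n m" "mat_star w * w = q" "w * mat_star w = r"
    unfolding mvn_equiv_def defs by metis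
  note vs = mat_star_carrier[OF v(1)] and ws = mat_star_carrier[OF w(1)]
  have star: "mat_star (w * v) = mat_star v * mat_star w"
    by (rule mat_star_mult[OF w(1) v(1)])
  have "mat_star (w * v) * (w * v) = mat_star v * ((mat_star w * w) * v)"
    unfolding star using assoc_mult_mat[OF vs ws mult_carrier_mat[OF w(1) v(1)]]
      assoc_mult_mat[OF ws w(1) v(1)] by simp
  also have "\<dots> = (mat_star v * v) * (mat_star v * v)"
    unfolding w(2) v(3)[symmetric] using assoc_mult_mat[OF v(1) vs v(1)]
      assoc_mult_mat[OF vs v(1) mult_carrier_mat[OF vs v(1)]] by simp
  also have "\<dots> = p" using v(2) projectionsD(2)[OF proj(1)] by simp
  finally have 1: "mat_star (w * v) * (w * v) = p" .
  have "(w * v) * mat_star (w * v) = w * ((v * mat_star v) * mat_star w)"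
    unfolding star using assoc_mult_mat[OF w(1) v(1) mult_carrier_mat[OF vs ws]]
      assoc_mult_mat[OF v(1) vs ws] by simp
  also have "\<dots> = (w * mat_star w) * (w * mat_star w)"
    unfolding v(3) w(2)[symmetric] using assoc_mult_mat[OF ws w(1) ws]
      assoc_mult_mat[OF w(1) ws mult_carrier_mat[OF w(1) ws]] by simp
  also have "\<dots> = r" using w(3) projectionsD(2)[OF proj(3)] by simp
  finally have 2: "(w * v) * mat_star (w * v) = r" .
  have "w * v \<in> carrier_mat n l" using v w by simp
  with 1 2 proj show ?thesis unfolding mvn_equiv_def defs by metis
qed

lemma mvn_equiv_dsum:
  assumes "mvn_equiv p p'" "mvn_equiv q q'"
  shows "mvn_equiv (dsum p q) (dsum p' q')"
proof -
  from assms have proj: "p \<in> projections" "p' \<in> projections" "q \<in> projections" "q' \<in> projections"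
    by (auto simp: mvn_equiv_def)
  from assms obtain v w where
    v: "v \<in> carrier_mat (dim_row p') (dim_row p)" "mat_star v * v = p" "v * mat_star v = p'" and
    w: "w \<in> carrier_mat (dim_row q') (dim_row q)" "mat_star w * w = q" "w * mat_star w = q'"
    unfolding mvn_equiv_def by metis
  note vs = mat_star_carrier[OF v(1)] and ws = mat_star_carrier[OF w(1)]
  have "mat_star (dsum v w) * dsum v w = dsum p q"
    using dsum_mult[OF vs ws v(1) w(1)] v w by (simp add: mat_star_dsum)
  moreover have "dsum v w * mat_star (dsum v w) = dsum p' q'"
    using dsum_mult[OF v(1) w(1) vs ws] v w by (simp add: mat_star_dsum)
  moreover have "dsum v w \<in> carrier_mat (dim_row (dsum p' q')) (dim_row (dsum p q))"
    using v w by (auto simp: dsum_def)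
  ultimately show ?thesis
    unfolding mvn_equiv_def using dsum_projection proj by blast
qed

lemma mvn_equiv_dsum_commute:
  assumes "p \<in> projections" "q \<in> projections"
  shows "mvn_equiv (dsum p q) (dsum q p)"
proof -
  define m n where "m = dim_row p" and "n = dim_row q"
  note P = projectionsD[OF assms(1), folded m_def] and Q = projectionsD[OF assms(2), folded n_def]
  define v where "v = four_block_mat (0\<^sub>m n m) q p (0\<^sub>m m n)"
  have vs: "mat_star v = four_block_mat (0\<^sub>m m n) p q (0\<^sub>m n m)"
    unfolding v_def using P Q by (subst mat_star_four_block[of _ n m _ n _ m]) auto
  have "mat_star v * v = dsum p q"
    unfolding vs unfolding v_def using P Q
    by (subst mult_four_block_mat[of _ m n _ m _ n _ _ m _ n])
      (auto simp: dsum_def)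
  moreover have "v * mat_star v = dsum q p"
    unfolding vs unfolding v_def using P Q
    by (subst mult_four_block_mat[of _ n m _ n _ m _ _ n _ m])
      (auto simp: dsum_def)
  moreover have "v \<in> carrier_mat (dim_row (dsum q p)) (dim_row (dsum p q))"
    unfolding v_def dsum_def using P Q by auto
  ultimately show ?thesis
    unfolding mvn_equiv_def using dsum_projection assms by blast
qed

quotient_type (overloaded) 'a mvn_class = "'a::unital_cstar_algebra mat" / partial: mvn_equiv
proof (rule part_equivpI)
  show "\<exists>p::'a mat. mvn_equiv p p" using mvn_equiv_refl zero_projection by blast
  show "symp mvn_equiv" by (rule sympI) (rule mvn_equiv_sym)
  show "transp mvn_equiv" by (rule transpI) (rule mvn_equiv_trans)
qed

instantiation mvn_class :: (unital_cstar_algebra) comm_monoid_add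
begin

lift_definition zero_mvn_class :: "'a mvn_class" is "0\<^sub>m 0 0"
  by (rule mvn_equiv_refl[OF zero_projection])

lift_definition plus_mvn_class :: "'a mvn_class \<Rightarrow> 'a mvn_class \<Rightarrow> 'a mvn_class" is dsum
  by (rule mvn_equiv_dsum)

instance
proof
  fix a b c :: "'a mvn_class"
  show "a + b + c = a + (b + c)"
    by transfer (metis dsum_assoc mvn_equiv_dsum)
  show "a + b = b + a"
    by transfer (meson mvn_equiv_def mvn_equiv_dsum_commute)
  show "0 + a = a"
    by transfer simp
qed

end

text \<open>\<open>K\<^sub>0\<close> of the algebra \<open>'a\<close> is the Grothendieck group of the monoid of equivalence classes.\<close>

quotient_type (overloaded) 'a K0 =
  "'a::unital_cstar_algebra mvn_class \<times> 'a mvn_class" /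
  "\<lambda>(a, b) (c, d). \<exists>e. a + d + e = c + b + e"
proof (rule equivpI)
  show "reflp (\<lambda>(a, b) (c, d). \<exists>e. a + d + e = c + b + (e :: 'a mvn_class))"
    by (auto intro!: reflpI)
  show "symp (\<lambda>(a, b) (c, d). \<exists>e. a + d + e = c + b + (e :: 'a mvn_class))"
    by (auto intro!: sympI) metis
  show "transp (\<lambda>(a, b) (c, d). \<exists>e. a + d + e = c + b + (e :: 'a mvn_class))"
  proof (rule transpI, clarsimp)
    fix a b c d e f g h :: "'a mvn_class"
    assume 1: "a + d + g = c + b + g" and 2: "c + f + h = e + d + h"
    have "a + f + (d + g + c + h) = (a + d + g) + (c + f + h)" by (simp add: ac_simps)
    also have "\<dots> = e + b + (d + g + c + h)" unfolding 1 2 by (simp add: ac_simps)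
    finally show "\<exists>x. a + f + x = e + b + x" by blast
  qed
qed

instantiation K0 :: (unital_cstar_algebra) ab_group_add
begin

lift_definition zero_K0 :: "'a K0" is "(0, 0)" .

lift_definition plus_K0 :: "'a K0 \<Rightarrow> 'a K0 \<Rightarrow> 'a K0" is "\<lambda>(a, b) (c, d). (a + c, b + d)"
proof clarsimp
  fix a b c d a' b' c' d' g h :: "'a mvn_class"
  assume 1: "a + d + g = c + b + g" and 2: "a' + d' + h = c' + b' + h"
  have "a + a' + (d + d') + (g + h) = (a + d + g) + (a' + d' + h)" by (simp add: ac_simps)
  also have "\<dots> = c + c' + (b + b') + (g + h)" unfolding 1 2 by (simp add: ac_simps)
  finally show "\<exists>x. a + a' + (d + d') + x = c + c' + (b + b') + x" by blast
qed

lift_definition uminus_K0 :: "'a K0 \<Rightarrow> 'a K0" is "\<lambda>(a, b). (b, a)"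
  by clarsimp (metis add.commute)

definition minus_K0 :: "'a K0 \<Rightarrow> 'a K0 \<Rightarrow> 'a K0" where "minus_K0 x y = x + - y"

instance
proof
  fix a b c :: "'a K0"
  show "a + b + c = a + (b + c)" by transfer (auto simp: ac_simps)
  show "a + b = b + a" by transfer (auto simp: ac_simps)
  show "0 + a = a" by transfer auto
  show "- a + a = 0" by transfer (auto simp: ac_simps)
  show "a - b = a + - b" by (simp add: minus_K0_def)
qed

end

text \<open>The class \<open>[p]\<^sub>0\<close>, meaningful for \<^term>\<open>p \<in> projections\<close>.\<close>

definition K0_class :: "'a::unital_cstar_algebra mat \<Rightarrow> 'a K0" where
  "K0_class p = abs_K0 (abs_mvn_class p, 0)"

definition K0_hom :: "('a::unital_cstar_algebra \<Rightarrow>\<^sub>L complex) \<Rightarrow> 'a K0 \<Rightarrow> real" where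
  "K0_hom \<phi> = (THE h. (\<forall>x y. h (x + y) = h x + h y) \<and>
     (\<forall>p\<in>projections. complex_of_real (h (K0_class p)) = trace_ext \<phi> p))"

lemma trace_ext_mult_commute:
  assumes "\<phi> \<in> bounded_traces" "x \<in> carrier_mat m n" "y \<in> carrier_mat n m"
  shows "trace_ext \<phi> (x * y) = trace_ext \<phi> (y * x)"
proof -
  have tr: "blinfun_apply \<phi> (a * b) = blinfun_apply \<phi> (b * a)" for a b
    using assms(1) by (simp add: bounded_traces_def)
  have "trace_ext \<phi> (x * y) = (\<Sum>i<m. \<Sum>j<n. blinfun_apply \<phi> (x $$ (i, j) * y $$ (j, i)))"
    using assms(2,3)
    by (auto simp: trace_ext_def scalar_prod_def blinfun.sum_right atLeast0LessThan intro!: sum.cong)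
  also have "\<dots> = (\<Sum>j<n. \<Sum>i<m. blinfun_apply \<phi> (y $$ (j, i) * x $$ (i, j)))"
    by (subst sum.swap) (simp add: tr)
  also have "\<dots> = trace_ext \<phi> (y * x)"
    using assms(2,3)
    by (auto simp: trace_ext_def scalar_prod_def blinfun.sum_right atLeast0LessThan intro!: sum.cong)
  finally show ?thesis .
qed

lemma trace_ext_mvn_equiv:
  assumes "\<phi> \<in> bounded_traces" "mvn_equiv p q"
  shows "trace_ext \<phi> p = trace_ext \<phi> q"
  using assms unfolding mvn_equiv_def by (metis mat_star_carrier trace_ext_mult_commute)

lemma trace_ext_dsum:
  assumes "p \<in> projections" "q \<in> projections"
  shows "trace_ext \<phi> (dsum p q) = trace_ext \<phi> p + trace_ext \<phi> q"
proof -
  have dim: "dim_col p = dim_row p" "dim_col q = dim_row q"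
    using assms by (simp_all add: projections_def)
  have split: "(\<Sum>i<m + n. f i) = (\<Sum>i<m. f i) + (\<Sum>i<n. f (m + i))"
    for m n :: nat and f :: "nat \<Rightarrow> complex"
    by (induction n) (auto simp: add.assoc)
  have "dim_row (dsum p q) = dim_row p + dim_row q" by (simp add: dsum_def)
  moreover have "dsum p q $$ (i, i) = p $$ (i, i)" if "i < dim_row p" for i
    using that by (simp add: dsum_def dim)
  moreover have "dsum p q $$ (dim_row p + i, dim_row p + i) = q $$ (i, i)" if "i < dim_row q" for i
    using that by (simp add: dsum_def dim)
  ultimately show ?thesis by (simp add: trace_ext_def split)
qed

lemma trace_ext_projection_real:
  assumes "positive_functional \<phi>" "p \<in> projections"
  shows "complex_of_real (Re (trace_ext \<phi> p)) = trace_ext \<phi> p"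
proof -
  have dim: "dim_col p = dim_row p" and P: "p * p = p" "mat_star p = p"
    using assms by (simp_all add: projections_def)
  have "p $$ (i, i) = (\<Sum>j<dim_row p. star (p $$ (j, i)) * p $$ (j, i))" if "i < dim_row p" for i
  proof -
    have "p $$ (i, i) = (mat_star p * p) $$ (i, i)" using P by simp
    also have "\<dots> = (\<Sum>j<dim_row p. star (p $$ (j, i)) * p $$ (j, i))"
      using that by (simp add: scalar_prod_def atLeast0LessThan dim)
    finally show ?thesis .
  qed
  then have "trace_ext \<phi> p =
      (\<Sum>i<dim_row p. \<Sum>j<dim_row p. blinfun_apply \<phi> (star (p $$ (j, i)) * p $$ (j, i)))"
    unfolding trace_ext_def by (intro sum.cong refl) (metis lessThan_iff blinfun.sum_right)
  also have "\<dots> \<in> \<real>"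
    using assms(1) unfolding positive_functional_def
    by (intro sum_in_Reals) (meson nonneg_Reals_subset_Reals subsetD)
  finally show ?thesis by simp
qed

lemma rep_mvn_class:
  "rep_mvn_class a \<in> projections"
  "p \<in> projections \<Longrightarrow> mvn_equiv p (rep_mvn_class (abs_mvn_class p))"
proof -
  show "rep_mvn_class a \<in> projections"
    using Quotient_rep_reflp[OF Quotient_mvn_class] by (auto simp: mvn_equiv_def)
  show "mvn_equiv p (rep_mvn_class (abs_mvn_class p))" if "p \<in> projections"
    by (rule mvn_equiv_sym, rule Quotient_rep_abs[OF Quotient_mvn_class mvn_equiv_refl[OF that]])
qed

lemma abs_mvn_class_add:
  "p \<in> projections \<Longrightarrow> q \<in> projections \<Longrightarrow>
   abs_mvn_class p + abs_mvn_class q = abs_mvn_class (dsum p q)"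
  by (intro plus_mvn_class.abs_eq mvn_equiv_refl)

lemma abs_mvn_class_surj: obtains p where "p \<in> projections" "a = abs_mvn_class p"
  using rep_mvn_class(1) Quotient_abs_rep[OF Quotient_mvn_class] by metis

lemma K0_class_add:
  "p \<in> projections \<Longrightarrow> q \<in> projections \<Longrightarrow> K0_class p + K0_class q = K0_class (dsum p q)"
  by (simp add: K0_class_def plus_K0.abs_eq abs_mvn_class_add)

lemma K0_cases:
  obtains p q where "p \<in> projections" "q \<in> projections" "x = K0_class p - K0_class q"
proof -
  obtain a b where "x = abs_K0 (a, b)"
    by (metis Quotient3_abs_rep[OF Quotient3_K0] surj_pair)
  moreover obtain p q where pq: "p \<in> projections" "q \<in> projections"
    "a = abs_mvn_class p" "b = abs_mvn_class q"
    by (metis abs_mvn_class_surj)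
  ultimately have "x = K0_class p - K0_class q"
    unfolding pq(3,4) K0_class_def minus_K0_def by (simp add: plus_K0.abs_eq uminus_K0.abs_eq)
  with pq that show thesis by blast
qed

text \<open>Hence \<^const>\<open>K0_hom\<close> is well defined for positive bounded traces.\<close>

lemma K0_hom_ex1:
  assumes "\<phi> \<in> bounded_traces" "positive_functional \<phi>"
  shows "\<exists>!h. (\<forall>x y. h (x + y) = h x + h y) \<and>
     (\<forall>p\<in>projections. complex_of_real (h (K0_class p)) = trace_ext \<phi> p)"
proof (rule ex_ex1I)
  define t where "t a = Re (trace_ext \<phi> (rep_mvn_class a))" for a
  have t_abs: "t (abs_mvn_class p) = Re (trace_ext \<phi> p)" if "p \<in> projections" for p
    unfolding t_def using trace_ext_mvn_equiv[OF assms(1) rep_mvn_class(2)[OF that]] by simp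
  have t_add: "t (a + b) = t a + t b" for a b
  proof -
    obtain p q where "p \<in> projections" "a = abs_mvn_class p"
      "q \<in> projections" "b = abs_mvn_class q"
      by (metis abs_mvn_class_surj)
    then show ?thesis
      by (simp add: abs_mvn_class_add t_abs dsum_projection trace_ext_dsum)
  qed
  have t_zero: "t 0 = 0" using t_add[of 0 0] by simp
  define h where "h x = t (fst (rep_K0 x)) - t (snd (rep_K0 x))" for x
  have h_abs: "h (abs_K0 (a, b)) = t a - t b" for a b
  proof -
    obtain c d where cd: "rep_K0 (abs_K0 (a, b)) = (c, d)" by fastforce
    then have "abs_K0 (c, d) = abs_K0 (a, b)"
      using Quotient3_abs_rep[OF Quotient3_K0, of "abs_K0 (a, b)"] by simp
    then obtain e where "c + b + e = a + d + e"
      by (auto simp: K0.abs_eq_iff)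
    then have "t c + t b + t e = t a + t d + t e" by (metis t_add)
    then show ?thesis by (simp add: h_def cd)
  qed
  have "h (x + y) = h x + h y" for x y
  proof -
    obtain a b c d where "x = abs_K0 (a, b)" "y = abs_K0 (c, d)"
      by (metis Quotient3_abs_rep[OF Quotient3_K0] surj_pair)
    then show ?thesis by (simp add: plus_K0.abs_eq h_abs t_add)
  qed
  moreover have "complex_of_real (h (K0_class p)) = trace_ext \<phi> p" if "p \<in> projections" for p
    using that by (simp add: K0_class_def h_abs t_abs t_zero trace_ext_projection_real[OF assms(2)])
  ultimately show "\<exists>h. (\<forall>x y. h (x + y) = h x + h y) \<and>
     (\<forall>p\<in>projections. complex_of_real (h (K0_class p)) = trace_ext \<phi> p)" by blast
next
  fix g h :: "'a K0 \<Rightarrow> real"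
  assume g: "(\<forall>x y. g (x + y) = g x + g y) \<and>
     (\<forall>p\<in>projections. complex_of_real (g (K0_class p)) = trace_ext \<phi> p)"
    and h: "(\<forall>x y. h (x + y) = h x + h y) \<and>
     (\<forall>p\<in>projections. complex_of_real (h (K0_class p)) = trace_ext \<phi> p)"
  show "g = h"
  proof
    fix x :: "'a K0"
    obtain p q where pq: "p \<in> projections" "q \<in> projections" "x = K0_class p - K0_class q"
      by (rule K0_cases)
    have "x + K0_class q = K0_class p" by (simp add: pq(3))
    then have "g x + g (K0_class q) = g (K0_class p)" "h x + h (K0_class q) = h (K0_class p)"
      using g h by metis+
    moreover have "g (K0_class r) = h (K0_class r)" if "r \<in> projections" for r
      using g h that by (metis of_real_eq_iff)
    ultimately show "g x = h x" using pq by simp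
  qed
qed

lemma
  assumes "\<phi> \<in> bounded_traces" "positive_functional \<phi>"
  shows K0_hom_add: "K0_hom \<phi> (x + y) = K0_hom \<phi> x + K0_hom \<phi> y"
    and K0_hom_class: "p \<in> projections \<Longrightarrow> complex_of_real (K0_hom \<phi> (K0_class p)) = trace_ext \<phi> p"
  using theI'[OF K0_hom_ex1[OF assms], folded K0_hom_def] by blast+

definition perm_matrix :: "nat \<Rightarrow> (nat \<Rightarrow> nat) \<Rightarrow> 'b::zero_neq_one mat" where
  "perm_matrix n \<sigma> = mat n n (\<lambda>(i, j). if j = \<sigma> i then 1 else 0)"

end

theory Submission
  imports Defs "HOL-Analysis.Complex_Analysis_Basics"
begin

text \<open>
  The trace map \<open>T = (Tr\<^sub>k \<otimes> \<cdot>) \<circ> \<Phi>\<close> of a self-similar pair is an automorphism of the cone of positive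
  traces, so it permutes the extreme rays, and its matrix is monomial as soon as the extreme
  tracial states are linearly independent.

  Fullness of \<open>p\<close> gives columns \<open>V\<^sub>b = p V\<^sub>b\<close> with \<open>\<Sum>\<^sub>b V\<^sub>b\<^sup>* V\<^sub>b = 1\<close>: an approximation of \<open>1\<close> by elements
  \<open>a\<^sup>* p b\<close> is dominated by an invertible sum of squares, which is divided by its square root. Then
  \<open>\<Psi>(a) = (\<Phi>\<^sup>-\<^sup>1(V\<^sub>b a V\<^sub>c\<^sup>*))\<^bsub>b,c\<^esub>\<close> is a *-homomorphism into matrices over the algebra whose trace map is
  inverse to \<open>T\<close>. Applying \<open>\<Phi>\<close> and \<open>\<Psi>\<close> entrywise to projections gives both inclusions between the
  images of \<open>K\<^sub>0\<close>.

  Independence follows from the Riesz decomposition property of positive traces: if \<open>\<theta> \<le> \<tau>\<close>, a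
  Radon--Nikodym derivative of \<open>\<theta>\<close>, approximated in the \<open>2\<close>-norm of \<open>\<tau>\<close> by algebra elements \<open>h\<^sub>k\<close>,
  splits \<open>\<theta>\<close> along every decomposition of \<open>\<tau>\<close> by \<open>\<psi> \<mapsto> lim \<psi>(h\<^sub>k \<cdot>)\<close>.
\<close>

subsection \<open>Square roots and positive elements\<close>

text \<open>Positivity is handled without spectra: a positive element is a square of a self-adjoint
  one, and the norm test \<open>norm (r *\<^sub>R 1 - h) \<le> r\<close> replaces nonnegativity of
  the spectrum. All roots and inverse roots come from one iteration, and each is delivered with the
  fact that it commutes with whatever commutes with the original element; this plays the part of
  functional calculus. In the Riesz decomposition the obstacle is that the derivative of \<theta> is
  in general not an element of the algebra. It is replaced by near-minimizers of a quadratic energy.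
  Convexity makes any two of them close, so one may switch freely between positive ones, ones of the
  form \<open>1 - u\<close> with \<open>u\<close> positive, and unitary conjugates. These three
  choices give, for the limit functional, positivity, domination by \<psi> and the trace property.
  Independence is what ties the given \<open>B\<close> to the trace map: membership in the
  fundamental group only says that the columns of \<open>B\<close> express the images of the extreme
  traces, and uniqueness of coefficients identifies them with the monomial ones.\<close>

lemma star_one [simp]: "star (1::'a::unital_cstar_algebra) = 1"
  by (metis mult.left_neutral mult.right_neutral star_mult star_star)

lemma star_scaleR: "star (r *\<^sub>R x) = r *\<^sub>R star (x::'a::unital_cstar_algebra)"
  by (metis scaleC_of_real star_scaleC complex_cnj_complex_of_real)

lemma star_minus: "star (- x) = - star (x::'a::unital_cstar_algebra)"
  using star_scaleR[of "-1" x] by simp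

lemma star_diff: "star (x - y) = star x - star (y::'a::unital_cstar_algebra)"
  using star_add[of x "- y"] by (simp add: star_minus)

lemma norm_star: "norm (star x) = norm (x::'a::unital_cstar_algebra)"
proof -
  have le: "norm y \<le> norm (star y)" for y :: 'a
  proof (cases "y = 0")
    case False
    have "norm y * norm y \<le> norm (star y) * norm y"
      using cstar_identity[of y] norm_mult_ineq[of "star y" y] by (simp add: power2_eq_square)
    then show ?thesis using False by simp
  qed simp
  show ?thesis using le[of x] le[of "star x"] by (simp add: star_star)
qed

lemma bounded_linear_star: "bounded_linear (star :: 'a::unital_cstar_algebra \<Rightarrow> 'a)"
  by (rule bounded_linear_intro[where K = 1]) (auto simp: star_add star_scaleR norm_star)

lemmas tendsto_star = bounded_linear.tendsto[OF bounded_linear_star]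

lemma norm_square_self_adjoint:
  "star s = s \<Longrightarrow> norm (s * s) = (norm (s::'a::unital_cstar_algebra))\<^sup>2"
  using cstar_identity[of s] by simp

text \<open>The iteration \<open>y \<mapsto> (x + y\<^sup>2) / 2\<close> for \<open>1 - sqrt (1 - x)\<close> is dominated by the
  scalar iteration at \<open>1\<close>, so it converges even for \<open>\<parallel>x\<parallel> = 1\<close>.\<close>

primrec sqrt_iter :: "'a::real_normed_algebra_1 \<Rightarrow> nat \<Rightarrow> 'a" where
  "sqrt_iter x 0 = 0"
| "sqrt_iter x (Suc n) = (1/2) *\<^sub>R (x + sqrt_iter x n * sqrt_iter x n)"

lemma sqrt_iter_commute:
  assumes "z * x = x * z" shows "z * sqrt_iter x n = sqrt_iter x n * z"
proof (induction n)
  case (Suc n)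
  have "z * (sqrt_iter x n * sqrt_iter x n) = (sqrt_iter x n * sqrt_iter x n) * z"
    by (metis Suc mult.assoc)
  then show ?case using assms by (simp add: algebra_simps)
qed simp

lemma sqrt_iter_one:
  "0 \<le> sqrt_iter (1::real) n" "sqrt_iter (1::real) n \<le> 1"
  "sqrt_iter (1::real) n \<le> sqrt_iter 1 (Suc n)"
proof -
  have *: "0 \<le> sqrt_iter (1::real) n \<and> sqrt_iter (1::real) n \<le> 1" for n
  proof (induction n)
    case (Suc n)
    then have "sqrt_iter (1::real) n * sqrt_iter 1 n \<le> 1 * 1" by (intro mult_mono) auto
    with Suc show ?case by simp
  qed simp
  show "0 \<le> sqrt_iter (1::real) n" "sqrt_iter (1::real) n \<le> 1" using * by blast+
  show "sqrt_iter (1::real) n \<le> sqrt_iter 1 (Suc n)"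
    using sum_squares_bound[of "sqrt_iter (1::real) n" 1]  by (simp add: power2_eq_square)
qed

text \<open>Consecutive iterates commute, being built from \<open>x\<close> alone, so a difference
  of their squares factors as \<open>(a - b) * (a + b)\<close>; each factor is then compared with
  its counterpart in the scalar iteration at \<open>1\<close>.\<close>

lemma sqrt_iter_bounds:
  assumes "norm x \<le> 1"
  shows "norm (sqrt_iter x n) \<le> sqrt_iter 1 n"
    and "norm (sqrt_iter x (Suc n) - sqrt_iter x n) \<le> sqrt_iter 1 (Suc n) - sqrt_iter 1 n"
proof -
  show 1: "norm (sqrt_iter x n) \<le> sqrt_iter 1 n" for n
  proof (induction n)
    case (Suc n)
    have "norm (x + sqrt_iter x n * sqrt_iter x n)
        \<le> 1 + norm (sqrt_iter x n) * norm (sqrt_iter x n)"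
      using norm_triangle_ineq norm_mult_ineq assms by (smt (verit))
    also have "\<dots> \<le> 1 + sqrt_iter 1 n * sqrt_iter 1 n"
      using Suc by (intro add_left_mono mult_mono) (auto simp: sqrt_iter_one)
    finally show ?case by simp
  qed simp
  show "norm (sqrt_iter x (Suc n) - sqrt_iter x n) \<le> sqrt_iter 1 (Suc n) - sqrt_iter 1 n"
  proof (induction n)
    case 0
    then show ?case using assms by simp
  next
    case (Suc n)
    define a b where "a = sqrt_iter x (Suc n)" and "b = sqrt_iter x n"
    define s t where "s = sqrt_iter (1::real) (Suc n)" and "t = sqrt_iter (1::real) n"
    have "a * b = b * a" unfolding a_def b_def by (metis sqrt_iter_commute)
    moreover have "a = (1/2) *\<^sub>R (x + b * b)"
      "sqrt_iter x (Suc (Suc n)) = (1/2) *\<^sub>R (x + a * a)"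
      by (simp_all add: a_def b_def)
    moreover have "(1/2) *\<^sub>R (x + a * a) - (1/2) *\<^sub>R (x + b * b) = (1/2) *\<^sub>R (a * a - b * b)"
      by (simp add: scaleR_add_right scaleR_diff_right)
    moreover have "a * a - b * b = (a - b) * (a + b)"
      using \<open>a * b = b * a\<close> by (simp add: algebra_simps)
    ultimately have "sqrt_iter x (Suc (Suc n)) - a = (1/2) *\<^sub>R ((a - b) * (a + b))"
      by metis
    then have "norm (sqrt_iter x (Suc (Suc n)) - sqrt_iter x (Suc n))
        = norm ((1/2) *\<^sub>R ((a - b) * (a + b)))" by (simp only: a_def)
    also have " \<dots> \<le> (1/2) * (norm (a - b) * norm (a + b))"
      using norm_mult_ineq[of "a - b" "a + b"] by simp
    also have "\<dots> \<le> (1/2) * ((s - t) * (s + t))"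
    proof -
      have "norm (a + b) \<le> s + t"
        using 1[of n] 1[of "Suc n"] norm_triangle_ineq[of a b] unfolding a_def b_def s_def t_def
        by linarith
      then show ?thesis
        using Suc sqrt_iter_one(3)[of n] unfolding a_def b_def s_def t_def
        by (intro mult_left_mono mult_mono) auto
    qed
    also have "\<dots> = sqrt_iter 1 (Suc (Suc n)) - sqrt_iter 1 (Suc n)"
      by (simp only: sqrt_iter.simps(2)[of "1::real" "Suc n"] s_def[symmetric])
        (simp add: s_def t_def[symmetric] algebra_simps)
    finally show ?case .
  qed
qed

text \<open>The increments are dominated by those of a bounded increasing real sequence, which
  telescope, so the iterates converge; commutation and self-adjointness pass to the limit.\<close>

lemma sqrt_one_minus:
  fixes x :: "'a::unital_cstar_algebra"
  assumes "norm x \<le> 1"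
  obtains y where "(1 - y) * (1 - y) = 1 - x" "norm y \<le> 1"
    "\<And>z. z * x = x * z \<Longrightarrow> z * y = y * z" "star x = x \<Longrightarrow> star y = y"
proof -
  have "convergent (sqrt_iter (1::real))"
    by (intro Bseq_monoseq_convergent BseqI'[of _ 1])
      (auto simp: monoseq_Suc sqrt_iter_one simp del: sqrt_iter.simps)
  then obtain t where "(sqrt_iter (1::real)) \<longlonglongrightarrow> t" by (auto simp: convergent_def)
  then have "summable (\<lambda>n. sqrt_iter (1::real) (Suc n) - sqrt_iter 1 n)"
    by (rule telescope_summable)
  then have "summable (\<lambda>n. norm (sqrt_iter x (Suc n) - sqrt_iter x n))"
    by (rule summable_comparison_test'[of _ 0])
      (use sqrt_iter_bounds(2)[OF assms] in \<open>auto simp del: sqrt_iter.simps\<close>)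
  then have "summable (\<lambda>n. sqrt_iter x (Suc n) - sqrt_iter x n)" by (rule summable_norm_cancel)
  then have "convergent (\<lambda>n. \<Sum>i<n. sqrt_iter x (Suc i) - sqrt_iter x i)"
    by (simp add: summable_iff_convergent)
  then obtain y where y: "sqrt_iter x \<longlonglongrightarrow> y"
    by (auto simp: sum_lessThan_telescope convergent_def simp del: sqrt_iter.simps(2))
  have "(\<lambda>n. sqrt_iter x (Suc n)) \<longlonglongrightarrow> (1/2) *\<^sub>R (x + y * y)"
    by (simp, intro tendsto_intros y)
  with LIMSEQ_Suc[OF y] have eq: "y = (1/2) *\<^sub>R (x + y * y)" using LIMSEQ_unique by blast
  have "y + y = x + y * y" using arg_cong[OF eq, of "\<lambda>v. 2 *\<^sub>R v"] by (simp add: scaleR_2)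
  then have "(1 - y) * (1 - y) = 1 - x" by (simp add: algebra_simps)
  moreover have "norm y \<le> 1"
    by (rule LIMSEQ_le_const2[OF tendsto_norm[OF y]])
      (use sqrt_iter_bounds(1)[OF assms] sqrt_iter_one(2) order_trans in blast)
  moreover have "z * y = y * z" if "z * x = x * z" for z
  proof -
    have "(\<lambda>n. z * sqrt_iter x n) \<longlonglongrightarrow> y * z"
      unfolding sqrt_iter_commute[OF that] by (intro tendsto_intros y)
    moreover have "(\<lambda>n. z * sqrt_iter x n) \<longlonglongrightarrow> z * y" by (intro tendsto_intros y)
    ultimately show ?thesis using LIMSEQ_unique by blast
  qed
  moreover have "star y = y" if "star x = x"
  proof -
    have "star (sqrt_iter x n) = sqrt_iter x n" for n
      by (induction n) (auto simp: star_scaleR star_add star_mult that)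
    with tendsto_star[OF y] have "sqrt_iter x \<longlonglongrightarrow> star y" by simp
    then show ?thesis using y LIMSEQ_unique by blast
  qed
  ultimately show thesis using that by blast
qed

text \<open>Squares of self-adjoint elements are directly accessible to the root iteration. That
  \<open>star z * z\<close> also has this form is the substantial result
  \<open>pos_star_mult_self\<close>.\<close>

definition pos :: "'a::unital_cstar_algebra \<Rightarrow> bool" where
  "pos h \<longleftrightarrow> (\<exists>s. star s = s \<and> h = s * s)"

lemma pos_self_adjoint: "pos h \<Longrightarrow> star h = h"
  by (auto simp: pos_def star_mult)

lemma pos_square: "star s = s \<Longrightarrow> pos (s * s)"
  by (auto simp: pos_def)

text \<open>Rescaling turns \<open>h\<close> into \<open>r *\<^sub>R (1 - x)\<close> with
  \<open>norm x \<le> 1\<close>. The root passes the same norm test with \<open>sqrt r\<close>,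
  which later shows that it is itself positive.\<close>

lemma sqrt_self_adjoint:
  fixes h :: "'a::unital_cstar_algebra"
  assumes "star h = h" "norm (r *\<^sub>R 1 - h) \<le> r"
  obtains s where "star s = s" "s * s = h" "norm (sqrt r *\<^sub>R 1 - s) \<le> sqrt r"
    "\<And>z. z * h = h * z \<Longrightarrow> z * s = s * z"
proof (cases "r = 0")
  case True
  with assms have "h = 0" by simp
  then show ?thesis using that[of 0] True by simp
next
  case False
  then have r: "r > 0" using assms(2) norm_ge_zero[of "r *\<^sub>R 1 - h"] by linarith
  define x where "x = 1 - (1/r) *\<^sub>R h"
  have x: "x = (1/r) *\<^sub>R (r *\<^sub>R 1 - h)" using r by (simp add: x_def algebra_simps)
  have "norm x \<le> 1" unfolding x using assms(2) r by simp
  then obtain y where y: "(1 - y) * (1 - y) = 1 - x" "norm y \<le> 1"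
    "\<And>z. z * x = x * z \<Longrightarrow> z * y = y * z" "star x = x \<Longrightarrow> star y = y"
    using sqrt_one_minus by metis
  have "star x = x" using assms by (simp add: x_def star_diff star_scaleR)
  then have "star (sqrt r *\<^sub>R (1 - y)) = sqrt r *\<^sub>R (1 - y)"
    using y by (simp add: star_diff star_scaleR)
  moreover have "(sqrt r *\<^sub>R (1 - y)) * (sqrt r *\<^sub>R (1 - y)) = h"
    using r y(1) by (simp add: x_def)
  moreover have "norm (sqrt r *\<^sub>R 1 - sqrt r *\<^sub>R (1 - y)) \<le> sqrt r"
    using y(2) r by (simp add: scaleR_right_diff_distrib mult_left_le)
  moreover have "z * (sqrt r *\<^sub>R (1 - y)) = sqrt r *\<^sub>R (1 - y) * z" if "z * h = h * z" for z
    using y(3)[of z] that by (simp add: x_def algebra_simps)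
  ultimately show ?thesis using that by blast
qed

lemma norm_le_posI:
  "star h = h \<Longrightarrow> norm (r *\<^sub>R 1 - h) \<le> r \<Longrightarrow> pos (h::'a::unital_cstar_algebra)"
  using sqrt_self_adjoint pos_square by metis

section \<open>Real and imaginary parts, unitaries, and norm estimates for positive elements\<close>

definition unitary :: "'a::unital_cstar_algebra \<Rightarrow> bool" where
  "unitary u \<longleftrightarrow> star u * u = 1 \<and> u * star u = 1"

lemma scaleC_minus: "(- c) *\<^sub>C x = - (c *\<^sub>C (x::'a::unital_cstar_algebra))"
  by (rule complex_vector.scale_minus_left)

lemma cartesian_parts:
  fixes u :: "'a::unital_cstar_algebra"
  defines "x \<equiv> (1/2) *\<^sub>R (u + star u)" and "y \<equiv> (- \<i> / 2) *\<^sub>C (u - star u)"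
  shows "star x = x" "star y = y" "u = x + \<i> *\<^sub>C y" "norm x \<le> norm u" "norm y \<le> norm u"
    "star u = x - \<i> *\<^sub>C y"
proof -
  show "star x = x" by (simp add: x_def star_scaleR star_add star_star add.commute)
  show "star y = y"
    by (simp add: y_def star_scaleC star_diff star_star complex_vector.scale_right_diff_distrib scaleC_minus)
  have iy: "\<i> *\<^sub>C y = (1/2) *\<^sub>R (u - star u)"
    using scaleC_of_real[of "1/2" "u - star u"] by (simp add: y_def)
  have half: "(1/2) *\<^sub>R u + (1/2) *\<^sub>R u = u" for u :: 'a
    by (simp flip: scaleR_left_distrib)
  show "u = x + \<i> *\<^sub>C y" "star u = x - \<i> *\<^sub>C y"
    unfolding iy x_def by (simp_all add: scaleR_add_right scaleR_diff_right half)
  show "norm x \<le> norm u" using norm_triangle_ineq[of u "star u"] by (simp add: x_def norm_star)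
  show "norm y \<le> norm u"
    using norm_triangle_ineq4[of u "star u"] by (simp add: y_def norm_star norm_scaleC norm_divide)
qed

lemma cartesian_mult:
  fixes x y :: "'a::unital_cstar_algebra"
  shows "(x - \<i> *\<^sub>C y) * (x + \<i> *\<^sub>C y) = x * x + y * y + \<i> *\<^sub>C (x * y - y * x)"
    and "(x + \<i> *\<^sub>C y) * (x - \<i> *\<^sub>C y) = x * x + y * y - \<i> *\<^sub>C (x * y - y * x)"
  by (simp_all add: algebra_simps mult_scaleC_left mult_scaleC_right scaleC_minus
      complex_vector.scale_right_diff_distrib del: complex_vector.scale_minus_left)

text \<open>For commuting \<open>s\<close>, \<open>t\<close> and
  \<open>u = s + \<i> *\<^sub>C t\<close>, the product \<open>star u * u\<close> is the sum of
  squares, and \<open>s\<close>, \<open>t\<close> are the real and imaginary parts of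
  \<open>u\<close>, each of norm at most \<open>norm u\<close>.\<close>

lemma norm_commuting_squares:
  fixes s t :: "'a::unital_cstar_algebra"
  assumes "star s = s" "star t = t" "s * t = t * s"
  shows "(norm s)\<^sup>2 \<le> norm (s * s + t * t)" "(norm t)\<^sup>2 \<le> norm (s * s + t * t)"
proof -
  define u where "u = s + \<i> *\<^sub>C t"
  have u: "star u = s - \<i> *\<^sub>C t"
    using assms by (simp add: u_def star_add star_scaleC scaleC_minus)
  have n: "(norm u)\<^sup>2 = norm (s * s + t * t)"
    unfolding cstar_identity[symmetric] unfolding u unfolding u_def cartesian_mult
    using assms by simp
  have x: "(1/2) *\<^sub>R (u + star u) = s"
    unfolding u unfolding u_def by (simp flip: scaleR_2)
  have y: "(- \<i> / 2) *\<^sub>C (u - star u) = t"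
  proof -
    have "u - star u = 2 *\<^sub>R (\<i> *\<^sub>C t)" unfolding u unfolding u_def by (simp add: scaleR_2)
    also have "\<dots> = (2 * \<i>) *\<^sub>C t" using scaleC_of_real[of 2 "\<i> *\<^sub>C t"] by simp
    finally show ?thesis by simp
  qed
  have "norm s \<le> norm u" "norm t \<le> norm u"
    using cartesian_parts(4,5)[of u] unfolding x y by auto
  then show "(norm s)\<^sup>2 \<le> norm (s * s + t * t)" "(norm t)\<^sup>2 \<le> norm (s * s + t * t)"
    unfolding n[symmetric] by (auto intro: power_mono)
qed

text \<open>\<open>t\<close> is the root of \<open>1 - s * s\<close>, related to \<open>s\<close> as
  sine to cosine. It serves both to build unitaries and to bound \<open>1 - s * s\<close>.\<close>

lemma self_adjoint_completion:
  fixes s :: "'a::unital_cstar_algebra"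
  assumes "star s = s" "norm s \<le> 1"
  obtains t where "star t = t" "s * t = t * s" "s * s + t * t = 1"
proof -
  have "norm (s * s) \<le> 1"
    unfolding norm_square_self_adjoint[OF assms(1)] using assms(2) by (simp add: power_le_one)
  then obtain y where y: "(1 - y) * (1 - y) = 1 - s * s"
    "\<And>z. z * (s * s) = (s * s) * z \<Longrightarrow> z * y = y * z" "star (s * s) = s * s \<Longrightarrow> star y = y"
    using sqrt_one_minus by metis
  show thesis
  proof
    show "star (1 - y) = 1 - y" using y(3) assms by (simp add: star_diff star_mult)
    show "s * (1 - y) = (1 - y) * s" using y(2)[of s] by (simp add: algebra_simps)
    show "s * s + (1 - y) * (1 - y) = 1" using y(1) by simp
  qed
qed

text \<open>\<open>h\<close> is the real part of \<open>h + \<i> *\<^sub>C t\<close>, where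
  \<open>t\<close> completes \<open>h\<close>. Hence identities known for unitaries extend linearly
  to the whole algebra.\<close>

lemma self_adjoint_unitary:
  fixes h :: "'a::unital_cstar_algebra"
  assumes "star h = h" "norm h \<le> 1"
  obtains u where "unitary u" "h = (1/2) *\<^sub>R (u + star u)"
proof -
  obtain t where t: "star t = t" "h * t = t * h" "h * h + t * t = 1"
    using self_adjoint_completion[OF assms] by metis
  define u where "u = h + \<i> *\<^sub>C t"
  have u: "star u = h - \<i> *\<^sub>C t"
    using assms t by (simp add: u_def star_add star_scaleC scaleC_minus)
  show thesis
  proof
    show "unitary u" unfolding unitary_def u unfolding u_def cartesian_mult using t by simp
    show "h = (1/2) *\<^sub>R (u + star u)" unfolding u unfolding u_def by (simp flip: scaleR_2)
  qed
qed

lemma norm_one_minus_square: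
  fixes s :: "'a::unital_cstar_algebra"
  assumes "star s = s" "norm s \<le> 1"
  shows "norm (1 - s * s) \<le> 1"
proof -
  obtain t where t: "star t = t" "s * t = t * s" "s * s + t * t = 1"
    using self_adjoint_completion[OF assms] by metis
  have "1 - s * s = t * t" using t(3) by (simp add: algebra_simps)
  then show ?thesis
    using norm_commuting_squares(2)[OF assms(1) t(1,2)] norm_square_self_adjoint[OF t(1)] t(3) by simp
qed

text \<open>Converse of \<open>norm_le_posI\<close>: after scaling to norm at most \<open>1\<close>,
  this is \<open>norm_one_minus_square\<close> for the root of \<open>h\<close>.\<close>

lemma pos_norm:
  assumes "pos h" "norm h \<le> r"
  shows "norm (r *\<^sub>R 1 - h) \<le> r"
proof (cases "r = 0")
  case False
  then have r: "r > 0" using assms(2) norm_ge_zero[of h] by linarith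
  obtain s where s: "star s = s" "h = s * s" using assms(1) by (auto simp: pos_def)
  define s' where "s' = (1 / sqrt r) *\<^sub>R s"
  have s': "star s' = s'" "s' * s' = (1/r) *\<^sub>R h" using r by (simp_all add: s'_def star_scaleR s)
  have "(norm s')\<^sup>2 \<le> 1"
    using norm_square_self_adjoint[OF s'(1)] assms(2) r by (simp add: s'(2)) (metis divide_le_eq_1_pos)
  then have "norm s' \<le> 1" by (simp add: abs_square_le_1)
  then have "norm (1 - (1/r) *\<^sub>R h) \<le> 1" using norm_one_minus_square[OF s'(1)] s'(2) by simp
  moreover have "r *\<^sub>R 1 - h = r *\<^sub>R (1 - (1/r) *\<^sub>R h)" using r by (simp add: scaleR_diff_right)
  ultimately show ?thesis using r by simp
qed (use assms in auto)

text \<open>A sum of two squares is not visibly a square, but the norm test with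
  \<open>r = norm g + norm h\<close> follows from the triangle inequality.\<close>

lemma pos_add: "pos g \<Longrightarrow> pos h \<Longrightarrow> pos (g + h)"
proof (rule norm_le_posI)
  assume g: "pos g" and h: "pos h"
  show "star (g + h) = g + h" using g h by (simp add: star_add pos_self_adjoint)
  show "norm ((norm g + norm h) *\<^sub>R 1 - (g + h)) \<le> norm g + norm h"
    using norm_triangle_ineq[of "norm g *\<^sub>R 1 - g" "norm h *\<^sub>R 1 - h"] pos_norm[OF g order_refl]
      pos_norm[OF h order_refl] by (simp add: algebra_simps)
qed

lemma pos_scaleR: "pos h \<Longrightarrow> 0 \<le> r \<Longrightarrow> pos (r *\<^sub>R h)"
proof -
  assume "pos h" "0 \<le> r"
  then obtain s where "star s = s" "h = s * s" by (auto simp: pos_def)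
  with \<open>0 \<le> r\<close> have "r *\<^sub>R h = (sqrt r *\<^sub>R s) * (sqrt r *\<^sub>R s)" "star (sqrt r *\<^sub>R s) = sqrt r *\<^sub>R s"
    by (simp_all add: star_scaleR)
  then show ?thesis unfolding pos_def by metis
qed

lemma pos_zero [simp]: "pos 0" and pos_one [simp]: "pos 1"
  using pos_square[of 0] pos_square[of 1] by simp_all

lemma pos_sum: "(\<And>i. i \<in> I \<Longrightarrow> pos (f i)) \<Longrightarrow> pos (\<Sum>i\<in>I. f i)"
  by (induction I rule: infinite_finite_induct) (auto intro: pos_add)

lemma pos_bound_minus: "star h = h \<Longrightarrow> norm h \<le> r \<Longrightarrow> pos (r *\<^sub>R 1 - h)"
  by (rule norm_le_posI[of _ r]) (auto simp: star_diff star_scaleR)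

lemma pos_sqrt:
  assumes "pos h"
  obtains k where "pos k" "k * k = h" "\<And>z. z * h = h * z \<Longrightarrow> z * k = k * z"
  using sqrt_self_adjoint[OF pos_self_adjoint[OF assms] pos_norm[OF assms order_refl]] norm_le_posI
  by metis

text \<open>The roots of \<open>p\<close> and of \<open>c *\<^sub>R 1 - p\<close> commute and their
  squares add up to \<open>c *\<^sub>R 1\<close>, so \<open>norm_commuting_squares\<close>
  applies.\<close>

lemma norm_le_if_pos_minus:
  assumes "pos p" "pos (c *\<^sub>R 1 - p)" "0 \<le> c"
  shows "norm p \<le> c"
proof -
  obtain a where a: "pos a" "a * a = p" "\<And>z. z * p = p * z \<Longrightarrow> z * a = a * z"
    using pos_sqrt[OF assms(1)] by metis
  obtain b where b: "pos b" "b * b = c *\<^sub>R 1 - p"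
    "\<And>z. z * (c *\<^sub>R 1 - p) = (c *\<^sub>R 1 - p) * z \<Longrightarrow> z * b = b * z"
    using pos_sqrt[OF assms(2)] by metis
  have "a * p = p * a" unfolding a(2)[symmetric] by (simp add: mult.assoc)
  then have "a * b = b * a" by (intro b) (simp add: algebra_simps)
  from norm_commuting_squares(1)[OF pos_self_adjoint[OF a(1)] pos_self_adjoint[OF b(1)] this]
  show ?thesis using norm_square_self_adjoint[OF pos_self_adjoint[OF a(1)]] assms(3) by (simp add: a(2) b(2))
qed

lemma neumann_inverse:
  fixes x :: "'a::{real_normed_algebra_1,banach}"
  assumes "norm x < 1"
  obtains y where "y * (1 - x) = 1" "(1 - x) * y = 1"
proof -
  have s: "summable (\<lambda>n. x ^ n)"
    by (rule complete_algebra_summable_geometric[OF assms])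
  define y where "y = (\<Sum>n. x ^ n)"
  have *: "(\<Sum>n. x ^ Suc n) = y - 1"
    using suminf_split_head[OF s] by (simp add: y_def)
  have "x * y = y - 1" "y * x = y - 1"
    unfolding *[symmetric] unfolding y_def
    by (simp_all add: suminf_mult suminf_mult2 s power_commutes)
  then show thesis by (intro that[of y]) (simp_all add: algebra_simps)
qed

text \<open>Dividing by \<open>d = c + norm q\<close> leaves \<open>1 - x\<close> with
  \<open>norm x \<le> norm q / d < 1\<close>. A Neumann series gives its inverse \<open>v\<close>,
  the iteration gives its root \<open>s\<close>, and \<open>s * v\<close> is the inverse root up to
  the scale \<open>1 / sqrt d\<close>.\<close>

lemma inverse_sqrt:
  assumes "pos q" "0 < c"
  obtains k where "star k = k" "k * (c *\<^sub>R 1 + q) * k = 1" "k * k * (c *\<^sub>R 1 + q) = 1"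
    "\<And>z. z * q = q * z \<Longrightarrow> z * k = k * z"
proof -
  define d x where "d = c + norm q" and "x = 1 - (1/d) *\<^sub>R (c *\<^sub>R 1 + q)"
  have d: "d > 0" using assms(2) by (simp add: d_def add_pos_nonneg)
  have x: "x = (1/d) *\<^sub>R (norm q *\<^sub>R 1 - q)"
  proof -
    have "x = (1/d) *\<^sub>R (d *\<^sub>R 1 - (c *\<^sub>R 1 + q))"
      using d by (simp add: x_def scaleR_diff_right)
    then show ?thesis by (simp add: d_def algebra_simps)
  qed
  have "norm x \<le> norm q / d"
    unfolding x using pos_norm[OF assms(1) order_refl] d by (simp add: divide_right_mono)
  also have "\<dots> < 1" using d assms(2) by (simp add: d_def)
  finally have nx: "norm x < 1" .
  have sx: "star x = x"
    using pos_self_adjoint[OF assms(1)] by (simp add: x_def star_diff star_scaleR star_add)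
  obtain y where y: "(1 - y) * (1 - y) = 1 - x"
    "\<And>z. z * x = x * z \<Longrightarrow> z * y = y * z" "star x = x \<Longrightarrow> star y = y"
    using sqrt_one_minus[of x] nx by (metis less_imp_le)
  obtain v where v: "v * (1 - x) = 1" "(1 - x) * v = 1"
    using neumann_inverse[OF nx] by metis
  have sv: "star v = v"
  proof -
    have "star v * (1 - x) = 1" using arg_cong[OF v(2), of star] sx by (simp add: star_mult star_diff)
    then show ?thesis using v(2) by (metis mult.assoc mult.left_neutral mult.right_neutral)
  qed
  have vcomm: "z * v = v * z" if "z * x = x * z" for z
  proof -
    have "z * (1 - x) = (1 - x) * z" using that by (simp add: algebra_simps)
    then have "v * (z * (1 - x)) * v = v * ((1 - x) * z) * v" by simp
    then show ?thesis using v by (metis mult.assoc mult.left_neutral mult.right_neutral)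
  qed
  define s where "s = 1 - y"
  have sv_comm: "s * v = v * s"
    using vcomm[of s] y(2)[of x] by (simp add: s_def algebra_simps)
  have ss: "s * s = 1 - x" using y(1) by (simp add: s_def)
  have star_s: "star s = s" using y(3)[OF sx] by (simp add: s_def star_diff)
  define k where "k = (1 / sqrt d) *\<^sub>R (s * v)"
  have R: "c *\<^sub>R 1 + q = d *\<^sub>R (1 - x)" using d by (simp add: x_def)
  have kk: "k * k = (1/d) *\<^sub>R v"
  proof -
    have "k * k = (1/d) *\<^sub>R (s * v * (s * v))" using d by (simp add: k_def)
    also have "s * v * (s * v) = s * s * v * v" by (metis sv_comm mult.assoc)
    also have "\<dots> = v" using v by (simp add: ss)
    finally show ?thesis .
  qed
  show thesis
  proof
    show "star k = k" by (simp add: k_def star_scaleR star_mult sv star_s sv_comm)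
    show "k * k * (c *\<^sub>R 1 + q) = 1" unfolding kk R using d v by simp
    have "k * (1 - x) = (1 - x) * k"
      unfolding k_def ss[symmetric] by (simp add: mult.assoc) (metis sv_comm mult.assoc)
    then have "k * (c *\<^sub>R 1 + q) * k = d *\<^sub>R ((1 - x) * (k * k))" by (simp add: R mult.assoc)
    also have "\<dots> = 1" unfolding kk using d v by simp
    finally show "k * (c *\<^sub>R 1 + q) * k = 1" .
    show "z * k = k * z" if "z * q = q * z" for z
    proof -
      have zx: "z * x = x * z" using that by (simp add: x_def algebra_simps)
      have "z * s = s * z" using y(2)[OF zx] by (simp add: s_def algebra_simps)
      then show ?thesis using vcomm[OF zx] unfolding k_def
        by (simp, metis mult.assoc)
    qed
  qed
qed

subsection \<open>Positivity of \<open>z\<^sup>* z\<close>\<close>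

text \<open>In terms of the real and imaginary parts, \<open>w * star w + star w * w\<close> is
  twice \<open>x * x + y * y\<close>. Moving the negative summand to the other side leaves a sum of
  squares.\<close>

lemma pos_mult_star_self_if_neg:
  fixes w b :: "'a::unital_cstar_algebra"
  assumes "star b = b" "star w * w = - (b * b)"
  shows "pos (w * star w)"
proof -
  define x where "x = (1/2) *\<^sub>R (w + star w)"
  define y where "y = (- \<i> / 2) *\<^sub>C (w - star w)"
  have w: "star x = x" "star y = y" "w = x + \<i> *\<^sub>C y" "star w = x - \<i> *\<^sub>C y"
    using cartesian_parts[of w] unfolding x_def y_def by auto
  have "w * star w + star w * w = 2 *\<^sub>R (x * x + y * y)"
  proof -
    have "w * star w + star w * w = (x + \<i> *\<^sub>C y) * (x - \<i> *\<^sub>C y) + (x - \<i> *\<^sub>C y) * (x + \<i> *\<^sub>C y)"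
      using w(3,4) by metis
    then show ?thesis unfolding cartesian_mult by (simp add: scaleR_2 algebra_simps)
  qed
  then have "w * star w = 2 *\<^sub>R (x * x + y * y) + b * b"
    by (simp add: assms(2) algebra_simps)
  moreover have "pos \<dots>" using w assms(1) by (intro pos_add pos_scaleR pos_square) auto
  ultimately show ?thesis by simp
qed

text \<open>Classically, \<open>w * star w\<close> and \<open>star w * w\<close> have the same
  nonzero spectrum, so both signs at once force zero. Here \<open>p\<close> is
  \<open>- (star w * w)\<close> scaled to norm \<open>1\<close>; positivity of
  \<open>w * star w\<close> makes \<open>1 - p\<close> invertible, and an invertible positive
  \<open>1 - p\<close> forces \<open>norm p < 1\<close>.\<close>

lemma neg_star_mult_self_eq_zero:
  fixes w b :: "'a::unital_cstar_algebra"
  assumes b: "star b = b" "star w * w = - (b * b)"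
  shows "w = 0"
proof (rule ccontr)
  assume "w \<noteq> 0"
  define r where "r = norm (b * b)"
  have r: "r > 0"
  proof -
    have "norm (b * b) = (norm w)\<^sup>2" by (metis assms(2) cstar_identity norm_minus_cancel)
    then show ?thesis using \<open>w \<noteq> 0\<close> by (simp add: r_def)
  qed
  define p where "p = (1/r) *\<^sub>R (b * b)"
  have p: "pos p" "norm p = 1"
    using r b(1) by (auto simp: p_def r_def intro!: pos_scaleR pos_square)
  have wp: "star w * w = - (r *\<^sub>R p)" using b(2) r by (simp add: p_def)
  obtain k where k: "k * k * (r *\<^sub>R 1 + w * star w) = 1"
    using inverse_sqrt[OF pos_mult_star_self_if_neg[OF b] r] by metis
  define v where "v = k * k"
  have v: "v * (w * star w) = 1 - r *\<^sub>R v" using k by (simp add: v_def distrib_left eq_diff_eq add.commute)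
  text \<open>\<open>1 - w\<^sup>* v w\<close> is the inverse of \<open>1 - p = 1 + w\<^sup>* w / r\<close>, by the identity that relates
    the inverses of \<open>1 + x y\<close> and \<open>1 + y x\<close>.\<close>
  define g where "g = 1 - star w * v * w"
  have gp: "g * (1 - p) = 1"
  proof -
    have "star w * v * w * p = - ((1/r) *\<^sub>R (star w * v * w * (star w * w)))"
      using r by (simp add: wp)
    also have "star w * v * w * (star w * w) = star w * (v * (w * star w)) * w"
      by (simp add: mult.assoc)
    also have "\<dots> = star w * w - r *\<^sub>R (star w * v * w)"
      by (simp add: v algebra_simps)
    finally have "star w * v * w * p = p + star w * v * w"
      using r by (simp add: wp scaleR_diff_right)
    then show ?thesis by (simp add: g_def algebra_simps)
  qed
  have p1: "pos (1 - p)" using pos_bound_minus[of p 1] p pos_self_adjoint[OF p(1)] by simp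
  obtain s where s: "pos s" "s * s = 1 - p" "\<And>z. z * (1 - p) = (1 - p) * z \<Longrightarrow> z * s = s * z"
    using pos_sqrt[OF p1] by metis
  have star_g: "(1 - p) * star g = 1"
    using arg_cong[OF gp, of star] pos_self_adjoint[OF p1] by (simp add: star_mult)
  have "star g = g" using gp star_g by (metis mult.assoc mult.left_neutral mult.right_neutral)
  have gp': "(1 - p) * g = 1" using star_g \<open>star g = g\<close> by simp
  have sg: "s * g = g * s" using s(3)[of g] gp gp' by simp
  have "pos g"
  proof -
    have "g = (s * g) * (s * g)"
    proof -
      have "(s * g) * (s * g) = g * (s * s) * g" by (simp add: sg mult.assoc)
      then show ?thesis by (simp add: s(2) gp)
    qed
    moreover have "star (s * g) = s * g"
      using pos_self_adjoint[OF s(1)] \<open>star g = g\<close> by (simp add: star_mult sg)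
    ultimately show ?thesis unfolding pos_def by metis
  qed
  define n where "n = norm g"
  have n1: "1 \<le> n"
  proof -
    have "1 \<le> n * norm (1 - p)" using norm_mult_ineq[of g "1 - p"] by (simp add: gp n_def)
    also have "\<dots> \<le> n * 1" using pos_norm[OF p(1), of 1] p(2) by (intro mult_left_mono) (auto simp: n_def)
    finally show ?thesis by simp
  qed
  \<comment> \<open>Multiplying the positive \<open>n *\<^sub>R 1 - g\<close> by the commuting
    positive \<open>1 - p\<close>, whose inverse is \<open>g\<close>, gives that
    \<open>n *\<^sub>R (1 - p) - 1\<close> is positive, so \<open>p\<close> is at most
    \<open>1 - 1/n\<close>. The roots \<open>c\<close> and \<open>s\<close> display the product as a
    square.\<close>
  have "pos (n *\<^sub>R 1 - g)" using pos_bound_minus[OF \<open>star g = g\<close>] by (simp add: n_def)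
  then obtain c where c: "pos c" "c * c = n *\<^sub>R 1 - g"
    "\<And>z. z * (n *\<^sub>R 1 - g) = (n *\<^sub>R 1 - g) * z \<Longrightarrow> z * c = c * z"
    using pos_sqrt by metis
  have sc: "s * c = c * s" using c(3)[of s] sg by (simp add: algebra_simps)
  have "(c * s) * (c * s) = c * (s * c) * s" by (simp add: mult.assoc)
  also have "\<dots> = (c * c) * (s * s)" by (simp add: mult.assoc sc)
  also have "\<dots> = n *\<^sub>R (1 - p) - 1" by (simp add: c(2) s(2) left_diff_distrib gp)
  finally have "(c * s) * (c * s) = n *\<^sub>R (1 - p) - 1" .
  moreover have "star (c * s) = c * s"
    using pos_self_adjoint[OF s(1)] pos_self_adjoint[OF c(1)] by (simp add: star_mult sc)
  ultimately have "pos (n *\<^sub>R (1 - p) - 1)" by (metis pos_square)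
  from pos_scaleR[OF this, of "1/n"] have "pos ((1 - 1/n) *\<^sub>R 1 - p)"
    using n1 by (simp add: algebra_simps)
  then have "norm p \<le> 1 - 1/n" by (rule norm_le_if_pos_minus[OF p(1)]) (use n1 in simp)
  then show False using p(2) n1 by simp
qed

text \<open>With \<open>k\<close> the absolute value of \<open>h\<close> and
  \<open>m = k - h\<close>, the element \<open>z * m\<close> satisfies the hypothesis of
  \<open>neg_star_mult_self_eq_zero\<close>. It therefore vanishes, which forces
  \<open>m = 0\<close> and \<open>h = k\<close>.\<close>

theorem pos_star_mult_self: "pos (star z * (z::'a::unital_cstar_algebra))"
proof -
  define h where "h = star z * z"
  have h: "star h = h" by (simp add: h_def star_mult star_star)
  obtain k where k: "pos k" "k * k = h * h" "\<And>z. z * (h * h) = (h * h) * z \<Longrightarrow> z * k = k * z"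
    using pos_sqrt[OF pos_square[OF h]] by metis
  have hk: "h * k = k * h" by (rule k(3)) (simp add: mult.assoc)
  \<comment> \<open>Twice the negative part of \<open>h\<close>.\<close>
  define m where "m = k - h"
  have m: "star m = m" "m * k = k * m" "h * m = - (k * m)"
    using pos_self_adjoint[OF k(1)] by (simp_all add: m_def star_diff h hk algebra_simps k(2))
  obtain l where l: "pos l" "l * l = k" "\<And>z. z * k = k * z \<Longrightarrow> z * l = l * z"
    using pos_sqrt[OF k(1)] by metis
  have ml: "m * l = l * m" using l(3) m(2) by metis
  have sml: "star (m * l) = m * l" using m(1) pos_self_adjoint[OF l(1)] by (simp add: star_mult ml)
  have mlml: "(m * l) * (m * l) = m * k * m"
    by (subst (2) ml) (simp add: mult.assoc flip: l(2))
  have "star (z * m) * (z * m) = m * (h * m)" by (simp add: star_mult m(1) h_def mult.assoc)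
  also have "\<dots> = - ((m * l) * (m * l))" unfolding mlml by (simp add: m(3) mult.assoc)
  finally have "z * m = 0" by (rule neg_star_mult_self_eq_zero[OF sml])
  then have "h * m = 0" by (simp add: h_def mult.assoc)
  then have "k * m = 0" using m(3) by simp
  have "m * m = k * m - h * m" by (simp add: m_def left_diff_distrib)
  then have "m * m = 0" using \<open>h * m = 0\<close> \<open>k * m = 0\<close> by simp
  then have "m = 0" using norm_square_self_adjoint[OF m(1)] by simp
  then show ?thesis using k(1) by (simp add: m_def h_def)
qed

text \<open>\<open>k\<close> is the absolute value of \<open>h\<close> smoothed by \<open>e\<close>,
  which makes it invertible. For \<open>q = k + h\<close> one has
  \<open>q * q + e *\<^sub>R 1 = 2 *\<^sub>R (k * q)\<close>, and dividing by \<open>k\<close>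
  writes \<open>2 *\<^sub>R q\<close> as a sum of two positive terms.\<close>

lemma pos_add_abs:
  fixes h k :: "'a::unital_cstar_algebra"
  assumes h: "star h = h" and k: "pos k" "k * k = e *\<^sub>R 1 + h * h" and hk: "h * k = k * h" and e: "0 < e"
  shows "pos (k + h)"
proof -
  obtain l where l: "pos l" "l * l = k" "\<And>z. z * k = k * z \<Longrightarrow> z * l = l * z"
    using pos_sqrt[OF k(1)] by metis
  obtain g where g: "star g = g" "g * g * (e *\<^sub>R 1 + h * h) = 1"
    "\<And>z. z * (h * h) = (h * h) * z \<Longrightarrow> z * g = g * z"
    using inverse_sqrt[OF pos_square[OF h] e] by metis
  have hl: "h * l = l * h" by (rule l(3)[OF hk])
  have "h * g = g * h" by (rule g(3)) (simp add: mult.assoc)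
  have "l * (h * h) = h * h * l" using hl by (metis mult.assoc)
  then have lg: "l * g = g * l" by (rule g(3))
  have sk: "star k = k" and sl: "star l = l" using k(1) l(1) pos_self_adjoint by blast+
  have comm: "h * l = l * h" "h * (l * x) = l * (h * x)" "h * g = g * h" "h * (g * x) = g * (h * x)"
    "l * g = g * l" "l * (g * x) = g * (l * x)" for x
    using hl lg \<open>h * g = g * h\<close> by (simp_all flip: mult.assoc)
  text \<open>\<open>j\<close> is the inverse of \<open>l = sqrt k\<close>.\<close>
  define j where "j = g * g * (l * (l * l))"
  have sj: "star j = j" by (simp add: j_def star_mult g(1) sl mult.assoc comm)
  have jlj: "j * l = 1"
  proof -
    have "j * l = g * g * (k * k)" by (simp add: j_def mult.assoc flip: l(2))
    then show ?thesis using g(2) by (simp add: k(2))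
  qed
  have jh: "h * j = j * h" by (simp add: j_def mult.assoc comm)
  have "j * j * k = j * (j * l) * l" by (simp add: mult.assoc flip: l(2))
  then have jk: "j * j * k = 1" by (simp add: jlj)
  have jk': "k * j = j * k" by (simp add: j_def mult.assoc comm flip: l(2))
  define q where "q = k + h"
  have sq: "star q = q" and jq: "j * q = q * j"
    unfolding q_def using h sk jh jk' by (simp_all add: star_add algebra_simps)
  have "q * q + e *\<^sub>R 1 = 2 *\<^sub>R (k * q)"
  proof -
    have "q * q + e *\<^sub>R 1 = k * k + 2 *\<^sub>R (k * h) + (e *\<^sub>R 1 + h * h)"
      by (simp add: q_def algebra_simps hk scaleR_2)
    also have "\<dots> = 2 *\<^sub>R (k * q)" unfolding k(2)[symmetric] by (simp add: q_def algebra_simps scaleR_2)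
    finally show ?thesis .
  qed
  then have "j * j * (q * q + e *\<^sub>R 1) = 2 *\<^sub>R (j * j * k * q)" by (simp add: mult.assoc)
  then have "2 *\<^sub>R q = (j * q) * (j * q) + e *\<^sub>R (j * j)"
  proof -
    have "(j * q) * (j * q) = j * (q * j) * q" by (simp add: mult.assoc)
    then have "(j * q) * (j * q) = j * j * (q * q)" by (simp add: mult.assoc flip: jq)
    then show ?thesis using \<open>j * j * (q * q + e *\<^sub>R 1) = 2 *\<^sub>R (j * j * k * q)\<close>
      by (simp add: distrib_left jk)
  qed
  moreover have "star (j * q) = j * q" using sj sq jq by (simp add: star_mult)
  ultimately have "pos (2 *\<^sub>R q)" using sj e by (auto intro!: pos_add pos_scaleR pos_square)
  from pos_scaleR[OF this, of "1/2"] show ?thesis by (simp add: q_def)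
qed

text \<open>\<open>u\<close> and \<open>v\<close> are the halves of \<open>k + h\<close> and
  \<open>k - h\<close>, where \<open>k * k = (4 * e) *\<^sub>R 1 + h * h\<close>, so their product
  is a quarter of \<open>k * k - h * h\<close>. Relaxing orthogonality to
  \<open>e *\<^sub>R 1\<close> keeps \<open>k\<close> invertible.\<close>

lemma approx_jordan_decomposition:
  fixes h :: "'a::unital_cstar_algebra"
  assumes h: "star h = h" and e: "0 < e"
  obtains u v where "pos u" "pos v" "h = u - v" "u * v = e *\<^sub>R 1" "v * u = e *\<^sub>R 1"
proof -
  have "pos ((4 * e) *\<^sub>R 1 + h * h)" using h e by (intro pos_add pos_scaleR pos_square pos_one) auto
  then obtain k where k: "pos k" "k * k = (4 * e) *\<^sub>R 1 + h * h"
    "\<And>z. z * ((4 * e) *\<^sub>R 1 + h * h) = ((4 * e) *\<^sub>R 1 + h * h) * z \<Longrightarrow> z * k = k * z"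
    using pos_sqrt by metis
  have hk: "h * k = k * h" by (rule k(3)) (simp add: algebra_simps)
  have 1: "pos (k + h)" using pos_add_abs[OF h k(1,2) hk] e by simp
  have 2: "pos (k + (- h))" by (rule pos_add_abs[of _ _ "4 * e"]) (use h hk k(1,2) e in \<open>auto simp: star_minus\<close>)
  show thesis
  proof (rule that[of "(1/2) *\<^sub>R (k + h)" "(1/2) *\<^sub>R (k + (- h))"])
    show "pos ((1/2) *\<^sub>R (k + h))" "pos ((1/2) *\<^sub>R (k + (- h)))" using 1 2 by (auto intro: pos_scaleR)
    show "h = (1/2) *\<^sub>R (k + h) - (1/2) *\<^sub>R (k + (- h))"
      using scaleR_half_double[of h] by (simp add: scaleR_add_right scaleR_diff_right)
    show "(1/2) *\<^sub>R (k + h) * (1/2) *\<^sub>R (k + (- h)) = e *\<^sub>R 1"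
      "(1/2) *\<^sub>R (k + (- h)) * (1/2) *\<^sub>R (k + h) = e *\<^sub>R 1"
      using k(2) hk by (simp_all add: algebra_simps)
  qed
qed

subsection \<open>Positive traces\<close>

text \<open>Plain functions, so that pointwise limits and differences can be treated before
  continuity is known; \<open>pos_functional_bound\<close> supplies it afterwards.\<close>

definition pos_functional :: "('a::unital_cstar_algebra \<Rightarrow> complex) \<Rightarrow> bool" where
  "pos_functional f \<longleftrightarrow> (\<forall>a b. f (a + b) = f a + f b) \<and> (\<forall>c a. f (c *\<^sub>C a) = c * f a) \<and>
     (\<forall>a. f (star a * a) \<in> \<real>\<^sub>\<ge>\<^sub>0)"

lemma
  assumes "pos_functional f"
  shows pos_functional_add: "f (a + b) = f a + f b"
    and pos_functional_scaleC: "f (c *\<^sub>C a) = c * f a"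
    and pos_functional_scaleR: "f (r *\<^sub>R a) = r * f a"
    and pos_functional_minus: "f (- a) = - f a"
    and pos_functional_diff: "f (a - b) = f a - f b"
    and pos_functional_zero: "f 0 = 0"
    and pos_functional_sum: "f (\<Sum>i\<in>I. g i) = (\<Sum>i\<in>I. f (g i))"
    and pos_functional_nonneg: "f (star a * a) \<in> \<real>\<^sub>\<ge>\<^sub>0"
proof -
  show add: "f (a + b) = f a + f b" and c: "f (c *\<^sub>C a) = c * f a" for a b c
    using assms by (auto simp: pos_functional_def)
  show r: "f (r *\<^sub>R a) = r * f a" for a r using c[of "of_real r" a] by (simp add: scaleC_of_real)
  show m: "f (- a) = - f a" for a using r[of "-1" a] by simp
  show "f (a - b) = f a - f b" using add[of a "- b"] by (simp add: m)
  show z: "f 0 = 0" using r[of 0 0] by simp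
  show "f (\<Sum>i\<in>I. g i) = (\<Sum>i\<in>I. f (g i))"
    by (induction I rule: infinite_finite_induct) (auto simp: add z)
  show "f (star a * a) \<in> \<real>\<^sub>\<ge>\<^sub>0" using assms by (auto simp: pos_functional_def)
qed

lemmas pos_functional_linear = pos_functional_add pos_functional_scaleC pos_functional_scaleR
  pos_functional_minus pos_functional_diff pos_functional_zero

lemma pos_functional_pos: "pos_functional f \<Longrightarrow> pos h \<Longrightarrow> f h \<in> \<real>\<^sub>\<ge>\<^sub>0"
proof -
  assume f: "pos_functional f" and "pos h"
  then obtain s where "star s = s" "h = s * s" by (auto simp: pos_def)
  then show ?thesis using pos_functional_nonneg[OF f, of s] by simp
qed

lemma pos_functional_self_adjoint:
  assumes f: "pos_functional f" and h: "star h = h"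
  shows "f h = of_real (Re (f h))"
proof -
  have "(h + 1) * (h + 1) - (h - 1) * (h - 1) = 4 *\<^sub>R h"
    using scaleR_left_distrib[of 2 2 h] by (simp add: algebra_simps scaleR_2)
  then have "4 * f h = f ((h + 1) * (h + 1)) - f ((h - 1) * (h - 1))"
    by (metis pos_functional_diff pos_functional_scaleR f of_real_numeral)
  moreover have "f ((h + 1) * (h + 1)) \<in> \<real>\<^sub>\<ge>\<^sub>0" "f ((h - 1) * (h - 1)) \<in> \<real>\<^sub>\<ge>\<^sub>0"
    using pos_functional_pos[OF f pos_square] h by (auto simp: star_add star_diff)
  ultimately have "Im (4 * f h) = 0" by (simp add: complex_nonneg_Reals_iff)
  then show ?thesis by (simp add: complex_eq_iff)
qed

lemma pos_functional_star:
  assumes f: "pos_functional f" shows "f (star a) = cnj (f a)"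
proof -
  obtain x y where "star x = x" "star y = y" and a: "a = x + \<i> *\<^sub>C y" "star a = x - \<i> *\<^sub>C y"
    using cartesian_parts(1-3,6) by blast
  then have "f x = of_real (Re (f x))" "f y = of_real (Re (f y))"
    using pos_functional_self_adjoint[OF f] by blast+
  then have "cnj (f x) = f x" "cnj (f y) = f y" by (metis complex_cnj_complex_of_real)+
  then show ?thesis unfolding a(2) unfolding a(1) by (simp add: pos_functional_linear[OF f])
qed

lemma pos_functional_cauchy_schwarz:
  assumes f: "pos_functional f"
  shows "(cmod (f (star a * b)))\<^sup>2 \<le> Re (f (star a * a)) * Re (f (star b * b))"
proof -
  define z where "z = f (star a * b)"
  define A where "A = Re (f (star a * a))"
  define B where "B = Re (f (star b * b))"
  have AB: "f (star a * a) = A" "f (star b * b) = B" "0 \<le> A" "0 \<le> B"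
    using pos_functional_nonneg[OF f, of a] pos_functional_nonneg[OF f, of b]
    by (auto simp: A_def B_def complex_nonneg_Reals_iff complex_eq_iff)
  have z': "f (star b * a) = cnj z"
    using pos_functional_star[OF f, of "star a * b"] by (simp add: z_def star_mult star_star)
  have q: "0 \<le> A - 2 * s * (cmod z)\<^sup>2 + s\<^sup>2 * (cmod z)\<^sup>2 * B" for s :: real
  proof -
    define c where "c = - of_real s * cnj z"
    define v where "v = a + c *\<^sub>C b"
    have "f (star v * v) = A + c * z + cnj c * cnj z + cnj c * c * B"
      unfolding v_def star_add star_scaleC
      by (simp add: distrib_left distrib_right mult_scaleC_left mult_scaleC_right
          pos_functional_linear[OF f] AB z' z_def[symmetric] del: complex_vector.scale_minus_left)
    also have "\<dots> = of_real (A - 2 * s * (cmod z)\<^sup>2 + s\<^sup>2 * (cmod z)\<^sup>2 * B)"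
    proof -
      have "of_real ((cmod z)\<^sup>2) = z * cnj z" by (rule complex_norm_square)
      then show ?thesis
        by (simp only: c_def of_real_diff of_real_add of_real_mult of_real_power)
          (simp add: algebra_simps power2_eq_square)
    qed
    finally show ?thesis using pos_functional_nonneg[OF f, of v] by (simp add: complex_nonneg_Reals_iff)
  qed
  have "(cmod z)\<^sup>2 \<le> A * B"
  proof (cases "B = 0")
    case True
    have "z = 0"
    proof (rule ccontr)
      assume "z \<noteq> 0"
      \<comment> \<open>With \<open>B = 0\<close> this \<open>s\<close> gives the quadratic the
        value \<open>A - (A + 1) = -1\<close>.\<close>
      then show False using q[of "(A + 1) / (2 * (cmod z)\<^sup>2)"] True by simp
    qed
    then show ?thesis using AB by simp
  next
    case False
    then have "B > 0" using AB by simp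
    then show ?thesis using q[of "1 / B"] by (simp add: field_simps power2_eq_square)
  qed
  then show ?thesis by (simp add: z_def A_def B_def)
qed

lemma pos_functional_one: assumes "pos_functional f"
  shows "f 1 = of_real (Re (f 1))" "0 \<le> Re (f 1)" "Im (f 1) = 0"
proof -
  have "f 1 \<in> \<real>\<^sub>\<ge>\<^sub>0" using pos_functional_nonneg[OF assms, of 1] by simp
  then obtain r where "f 1 = of_real r" "0 \<le> r" by (rule nonneg_Reals_cases)
  then show "f 1 = of_real (Re (f 1))" "0 \<le> Re (f 1)" "Im (f 1) = 0" by simp_all
qed

text \<open>Automatic continuity: Cauchy-Schwarz against \<open>1\<close>, with
  \<open>star a * a\<close> at most \<open>(norm a)\<^sup>2\<close> times the unit.\<close>

lemma pos_functional_bound: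
  assumes f: "pos_functional f"
  shows "cmod (f a) \<le> Re (f 1) * norm a"
proof -
  have "pos ((norm a)\<^sup>2 *\<^sub>R 1 - star a * a)"
    by (rule pos_bound_minus) (auto simp: star_mult star_star cstar_identity)
  from pos_functional_pos[OF f this]
  have *: "Re (f (star a * a)) \<le> (norm a)\<^sup>2 * Re (f 1)"
    by (simp add: pos_functional_linear[OF f] complex_nonneg_Reals_iff)
  have "(cmod (f a))\<^sup>2 \<le> Re (f 1) * Re (f (star a * a))"
    using pos_functional_cauchy_schwarz[OF f, of 1 a] by simp
  also have "\<dots> \<le> (Re (f 1) * norm a)\<^sup>2"
    using mult_left_mono[OF * pos_functional_one(2)[OF f]] by (simp add: power2_eq_square algebra_simps)
  finally show ?thesis by (rule power2_le_imp_le) (simp add: pos_functional_one(2)[OF f])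
qed

section \<open>Positive traces and the extreme rays of their cone\<close>

definition pos_trace :: "('a::unital_cstar_algebra \<Rightarrow> complex) \<Rightarrow> bool" where
  "pos_trace f \<longleftrightarrow> pos_functional f \<and> (\<forall>a b. f (a * b) = f (b * a))"

lemma pos_trace_functional: "pos_trace f \<Longrightarrow> pos_functional f"
  and pos_trace_commute: "pos_trace f \<Longrightarrow> f (a * b) = f (b * a)"
  by (auto simp: pos_trace_def)

lemma pos_trace_zero: "pos_trace (\<lambda>_. 0)"
  by (simp add: pos_trace_def pos_functional_def)

lemma pos_trace_add: "pos_trace f \<Longrightarrow> pos_trace g \<Longrightarrow> pos_trace (\<lambda>a. f a + g a)"
  by (auto simp: pos_trace_def pos_functional_def distrib_left)

lemma pos_trace_scale: "pos_trace f \<Longrightarrow> 0 \<le> r \<Longrightarrow> pos_trace (\<lambda>a. of_real r * f a)"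
  by (auto simp: pos_trace_def pos_functional_def distrib_left)

lemma pos_trace_sum: "(\<And>i. i \<in> I \<Longrightarrow> pos_trace (f i)) \<Longrightarrow> pos_trace (\<lambda>a. \<Sum>i\<in>I. f i a)"
  by (induction I rule: infinite_finite_induct) (auto intro: pos_trace_add pos_trace_zero)

lemma pos_trace_eq_zero: "pos_trace f \<Longrightarrow> f 1 = 0 \<Longrightarrow> f a = 0"
  using pos_functional_bound[of f a] pos_trace_functional by fastforce

lemma pos_trace_blinfun_apply:
  "pos_trace (blinfun_apply \<phi>) \<longleftrightarrow> \<phi> \<in> bounded_traces \<and> positive_functional \<phi>"
  by (auto simp: pos_trace_def pos_functional_def bounded_traces_def positive_functional_def blinfun.add_right)

lemma pos_functional_Blinfun:
  assumes "pos_functional f" shows "blinfun_apply (Blinfun f) = f"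
proof -
  have "bounded_linear f"
  proof (rule bounded_linear_intro[where K = "Re (f 1)"])
    show "norm (f a) \<le> norm a * Re (f 1)" for a
      using pos_functional_bound[OF assms, of a] by (simp add: mult.commute)
    show "f (r *\<^sub>R a) = r *\<^sub>R f a" for r a
      by (simp add: pos_functional_scaleR[OF assms] scaleR_conv_of_real[of r "f a"])
  qed (simp add: pos_functional_add[OF assms])
  then show ?thesis by (rule bounded_linear_Blinfun_apply)
qed

lemma norm_positive_functional:
  assumes "pos_functional (blinfun_apply \<phi>)" shows "norm \<phi> = Re (\<phi> 1)"
proof (rule antisym)
  show "norm \<phi> \<le> Re (\<phi> 1)"
    by (rule norm_blinfun_bound) (use pos_functional_bound[OF assms] pos_functional_one(2)[OF assms] in auto)
  show "Re (\<phi> 1) \<le> norm \<phi>"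
    using norm_blinfun[of \<phi> 1] complex_Re_le_cmod[of "\<phi> 1"] by simp
qed

lemma tracial_states_iff: "\<phi> \<in> tracial_states \<longleftrightarrow> pos_trace (blinfun_apply \<phi>) \<and> blinfun_apply \<phi> 1 = 1"
proof -
  have "norm \<phi> = 1 \<longleftrightarrow> blinfun_apply \<phi> 1 = 1" if "pos_functional (blinfun_apply \<phi>)"
    using norm_positive_functional[OF that] pos_functional_one(3)[OF that] by (simp add: complex_eq_iff)
  then show ?thesis
    unfolding tracial_states_def using pos_trace_blinfun_apply pos_trace_functional by blast
qed

lemma normalized_tracial_state:
  assumes "pos_trace f" "f 1 \<noteq> 0"
  obtains \<phi> where "\<phi> \<in> tracial_states" "\<And>a. f a = f 1 * blinfun_apply \<phi> a"
proof -
  define r where "r = Re (f 1)"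
  have r: "f 1 = of_real r" "r > 0"
    using pos_functional_one[OF pos_trace_functional[OF assms(1)]] assms(2)
    unfolding r_def by (metis of_real_0 order_le_less)+
  define g where "g a = of_real (1/r) * f a" for a
  have g: "pos_trace g" unfolding g_def using assms r by (intro pos_trace_scale) auto
  note B = pos_functional_Blinfun[OF pos_trace_functional[OF g]]
  show thesis
  proof (rule that[of "Blinfun g"])
    show "Blinfun g \<in> tracial_states" unfolding tracial_states_iff B using g r by (simp add: g_def)
    show "f a = f 1 * blinfun_apply (Blinfun g) a" for a unfolding B using r by (simp add: g_def)
  qed
qed

lemma extreme_traces_states: "\<phi> \<in> extreme_traces \<Longrightarrow> \<phi> \<in> tracial_states"
  by (simp add: extreme_traces_def extreme_point_of_def)

text \<open>Normalizing \<open>f\<close> and its complement \<open>g'\<close> at \<open>1\<close>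
  displays \<phi> as a convex combination of two tracial states, which extremality makes equal. A
  summand vanishing at \<open>1\<close> vanishes altogether.\<close>

lemma extreme_trace_ray:
  assumes \<phi>: "\<phi> \<in> extreme_traces" and f: "pos_trace f"
    and g: "pos_trace (\<lambda>a. of_real r * blinfun_apply \<phi> a - f a)"
  shows "f a = f 1 * blinfun_apply \<phi> a"
proof -
  define g' where "g' = (\<lambda>a. of_real r * blinfun_apply \<phi> a - f a)"
  have g': "pos_trace g'" using g by (simp add: g'_def)
  have \<phi>1: "pos_trace (blinfun_apply \<phi>)" "blinfun_apply \<phi> 1 = 1"
    using extreme_traces_states[OF \<phi>] by (auto simp: tracial_states_iff)
  define s t where "s = Re (f 1)" and "t = Re (g' 1)"
  have s: "f 1 = of_real s" "0 \<le> s" and t: "g' 1 = of_real t" "0 \<le> t"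
    using pos_functional_one(1,2)[OF pos_trace_functional[OF f]]
      pos_functional_one(1,2)[OF pos_trace_functional[OF g']] unfolding s_def t_def by blast+
  have "of_real r = (of_real (s + t) :: complex)" using s(1) t(1) \<phi>1(2) by (simp add: g'_def algebra_simps)
  then have r: "r = s + t" by (simp only: of_real_eq_iff)
  have sum: "of_real r * blinfun_apply \<phi> a = f a + g' a" for a by (simp add: g'_def)
  consider "s = 0" | "t = 0" | "s > 0" "t > 0" using s t by linarith
  then show ?thesis
  proof cases
    case 1
    then show ?thesis using pos_trace_eq_zero[OF f] s by simp
  next
    case 2
    then show ?thesis using pos_trace_eq_zero[OF g'] t sum[of a] s r by simp
  next
    case 3
    then obtain \<psi> \<omega> where \<psi>: "\<psi> \<in> tracial_states" "\<And>a. f a = of_real s * blinfun_apply \<psi> a"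
      and \<omega>: "\<omega> \<in> tracial_states" "\<And>a. g' a = of_real t * blinfun_apply \<omega> a"
      using normalized_tracial_state[OF f] normalized_tracial_state[OF g'] s t
      by (metis less_irrefl of_real_eq_0_iff)
    define u where "u = t / r"
    have u: "0 < u" "u < 1" and u1: "1 - u = s / r" using 3 r by (auto simp: u_def field_simps)
    have "\<phi> = (1 - u) *\<^sub>R \<psi> + u *\<^sub>R \<omega>"
    proof (rule blinfun_eqI)
      fix a
      have "blinfun_apply \<phi> a = (of_real s / of_real r) * blinfun_apply \<psi> a
          + (of_real t / of_real r) * blinfun_apply \<omega> a"
        using sum[of a] 3 r unfolding \<psi>(2) \<omega>(2)
        by (simp add: field_simps del: of_real_add flip: of_real_add)
      then show "blinfun_apply \<phi> a = blinfun_apply ((1 - u) *\<^sub>R \<psi> + u *\<^sub>R \<omega>) a"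
        unfolding u1 unfolding u_def
        by (simp add: blinfun.add_left blinfun.scaleR_left scaleR_conv_of_real)
    qed
    moreover have "\<phi> \<notin> open_segment \<psi> \<omega>"
      using \<phi> \<psi>(1) \<omega>(1) by (simp add: extreme_traces_def extreme_point_of_def)
    ultimately have "\<psi> = \<omega>" using u by (auto simp: in_segment)
    then have "\<phi> = \<psi>" using \<open>\<phi> = (1 - u) *\<^sub>R \<psi> + u *\<^sub>R \<omega>\<close> by (simp flip: scaleR_left_distrib)
    then show ?thesis using \<psi>(2) s by simp
  qed
qed

subsection \<open>Riesz decomposition of traces\<close>

text \<open>A minimizing sequence of this quadratic functional on the self-adjoint elements converges to
  the Radon--Nikodym derivative of \<open>\<theta>\<close> with respect to \<open>\<tau>\<close> in the \<open>2\<close>-norm of \<open>\<tau>\<close>.\<close>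

definition rn_energy :: "('a::unital_cstar_algebra \<Rightarrow> complex) \<Rightarrow> ('a \<Rightarrow> complex) \<Rightarrow> 'a \<Rightarrow> real" where
  "rn_energy \<tau> \<theta> h = Re (\<tau> (h * h)) - 2 * Re (\<theta> h)"

text \<open>Dropping the part \<open>v\<close> of \<open>h = u - v\<close> removes the nonnegative
  terms \<open>\<tau> (v * v)\<close> and \<open>2 * \<theta> v\<close>; only the cross term, of
  size \<open>2 * d * \<tau> 1\<close>, can raise the energy.\<close>

lemma rn_energy_jordan:
  assumes \<theta>: "pos_trace \<theta>" and \<tau>: "pos_trace \<tau>" and h: "star h = h" and e: "0 < e"
  obtains u where "pos u" "rn_energy \<tau> \<theta> u \<le> rn_energy \<tau> \<theta> h + e"
proof -
  note \<theta>f = pos_trace_functional[OF \<theta>] and \<tau>f = pos_trace_functional[OF \<tau>]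
  define t where "t = Re (\<tau> 1)"
  have t: "0 \<le> t" unfolding t_def by (rule pos_functional_one(2)[OF \<tau>f])
  \<comment> \<open>Chosen so that \<open>2 * d * t \<le> e\<close>; the summand \<open>1\<close>
    covers \<open>t = 0\<close>.\<close>
  define d where "d = e / (2 * t + 1)"
  have "0 < d" using e t by (simp add: d_def)
  then obtain u v where uv: "pos u" "pos v" "h = u - v" "u * v = d *\<^sub>R 1" "v * u = d *\<^sub>R 1"
    using approx_jordan_decomposition[OF h] by metis
  have "\<tau> (h * h) = \<tau> (u * u) + \<tau> (v * v) - 2 * d * \<tau> 1"
    unfolding uv(3) by (simp add: algebra_simps uv pos_functional_linear[OF \<tau>f])
  then have "rn_energy \<tau> \<theta> h = rn_energy \<tau> \<theta> u + Re (\<tau> (v * v)) + 2 * Re (\<theta> v) - 2 * d * t"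
    unfolding rn_energy_def t_def uv(3) by (simp add: pos_functional_linear[OF \<theta>f] uv(3))
  moreover have "0 \<le> Re (\<tau> (v * v))" "0 \<le> Re (\<theta> v)"
    using pos_functional_pos[OF \<theta>f uv(2)] pos_functional_pos[OF \<tau>f pos_square] pos_self_adjoint[OF uv(2)]
    by (auto simp: complex_nonneg_Reals_iff)
  moreover have "2 * d * t \<le> e"
  proof -
    have "2 * d * t = e * (2 * t / (2 * t + 1))" by (simp add: d_def)
    also have "\<dots> \<le> e * 1" using e t by (intro mult_left_mono) auto
    finally show ?thesis by simp
  qed
  ultimately show thesis using that[OF uv(1)] by linarith
qed

text \<open>Passing from \<open>g\<close> to \<open>1 - g\<close> exchanges \<theta> with
  \<open>\<tau> - \<theta>\<close> up to a constant. Near-minimizers can thus also be taken as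
  \<open>1 - u\<close> with \<open>u\<close> positive, which expresses that the derivative is at
  most \<open>1\<close>.\<close>

lemma rn_energy_reflect:
  assumes "pos_functional \<theta>" "pos_functional \<tau>"
  shows "rn_energy \<tau> \<theta> (1 - g) = rn_energy \<tau> (\<lambda>a. \<tau> a - \<theta> a) g + Re (\<tau> 1) - 2 * Re (\<theta> 1)"
  by (simp add: rn_energy_def algebra_simps pos_functional_linear[OF assms(1)]
      pos_functional_linear[OF assms(2)])

lemma rn_energy_bounded_below:
  assumes \<theta>: "pos_functional \<theta>" and d: "pos_functional (\<lambda>a. \<tau> a - \<theta> a)" and h: "star h = h"
  shows "- Re (\<theta> 1) \<le> rn_energy \<tau> \<theta> h"
proof -
  have "\<theta> ((h - 1) * (h - 1)) \<in> \<real>\<^sub>\<ge>\<^sub>0" "\<tau> (h * h) - \<theta> (h * h) \<in> \<real>\<^sub>\<ge>\<^sub>0"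
    using pos_functional_pos[OF \<theta> pos_square] pos_functional_pos[OF d pos_square] h
    by (auto simp: star_diff)
  then show ?thesis
    by (simp add: rn_energy_def algebra_simps pos_functional_linear[OF \<theta>] complex_nonneg_Reals_iff)
qed

text \<open>The linear terms cancel. Since the midpoint cannot have energy below the infimum, two
  near-minimizers are close in the 2-norm of \<tau>.\<close>

lemma rn_energy_parallelogram:
  assumes "pos_functional \<theta>" "pos_functional \<tau>"
  shows "Re (\<tau> ((g - h) * (g - h))) =
    2 * rn_energy \<tau> \<theta> g + 2 * rn_energy \<tau> \<theta> h - 4 * rn_energy \<tau> \<theta> ((1/2) *\<^sub>R (g + h))"
  by (simp add: rn_energy_def algebra_simps pos_functional_linear[OF assms(1)]
      pos_functional_linear[OF assms(2)])

text \<open>The coefficient of \<open>2 * t\<close> is the first variation; its smallness at a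
  near-minimizer says that \<open>\<tau> (h * b)\<close> approximates
  \<open>\<theta> b\<close>.\<close>

lemma rn_energy_variation:
  assumes "pos_functional \<theta>" "pos_functional \<tau>" "star h = h" "star b = b"
  shows "rn_energy \<tau> \<theta> (h + t *\<^sub>R b) =
    rn_energy \<tau> \<theta> h + 2 * t * (Re (\<tau> (h * b)) - Re (\<theta> b)) + t\<^sup>2 * Re (\<tau> (b * b))"
proof -
  have "\<tau> (b * h) = cnj (\<tau> (h * b))"
    using pos_functional_star[OF assms(2), of "h * b"] assms(3,4) by (simp add: star_mult)
  then show ?thesis
    by (simp add: rn_energy_def algebra_simps pos_functional_linear[OF assms(1)]
        pos_functional_linear[OF assms(2)] power2_eq_square)
qed

text \<open>Every element is a combination of unitaries. For the limit functional below, commutation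
  with unitaries is what the invariance of the energy yields directly.\<close>

lemma pos_trace_if_unitary_invariant:
  fixes f :: "'a::unital_cstar_algebra \<Rightarrow> complex"
  assumes f: "pos_functional f" and u: "\<And>u a. unitary u \<Longrightarrow> f (u * a) = f (a * u)"
  shows "pos_trace f"
proof -
  have sa: "f (h * a) = f (a * h)" if h: "star h = h" "norm h \<le> 1" for h a
  proof -
    obtain v where v: "unitary v" "h = (1/2) *\<^sub>R (v + star v)"
      using self_adjoint_unitary[OF h] by metis
    then have "unitary (star v)" by (simp add: unitary_def star_star)
    then show ?thesis using u v(1)
      by (simp add: v(2) distrib_left distrib_right pos_functional_linear[OF f])
  qed
  have sa': "f (h * a) = f (a * h)" if h: "star h = h" for h a
  proof (cases "h = 0")
    case False
    have "f (((1 / norm h) *\<^sub>R h) * a) = f (a * ((1 / norm h) *\<^sub>R h))"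
      by (rule sa) (use h False in \<open>auto simp: star_scaleR\<close>)
    then show ?thesis using False by (simp add: pos_functional_linear[OF f])
  qed (simp add: pos_functional_linear[OF f])
  have "f (a * b) = f (b * a)" for a b
  proof -
    obtain x y where x: "star x = x" "star y = y" and a: "a = x + \<i> *\<^sub>C y"
      using cartesian_parts(1-3) by blast
    show ?thesis unfolding a
      by (simp add: distrib_left distrib_right mult_scaleC_left mult_scaleC_right
          pos_functional_linear[OF f] sa'[OF x(1)] sa'[OF x(2)])
  qed
  then show ?thesis using f by (simp add: pos_trace_def)
qed

text \<open>The positive \<open>h k\<close> will make the limit functional positive, and
  \<open>1 - u k\<close> will keep it below \<psi>. The excess is a square because the energy is
  quadratic: 2-norm distances then decay like \<open>1 / Suc k\<close>.\<close>

lemma rn_minimizing_sequence: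
  fixes \<theta> \<tau> :: "'a::unital_cstar_algebra \<Rightarrow> complex"
  assumes \<theta>: "pos_trace \<theta>" and d: "pos_trace (\<lambda>a. \<tau> a - \<theta> a)"
  obtains m :: real and h u :: "nat \<Rightarrow> 'a" where
    "\<And>g. star g = g \<Longrightarrow> m \<le> rn_energy \<tau> \<theta> g"
    "\<And>k. pos (h k)" "\<And>k. rn_energy \<tau> \<theta> (h k) \<le> m + (1 / Suc k)\<^sup>2"
    "\<And>k. pos (u k)" "\<And>k. rn_energy \<tau> \<theta> (1 - u k) \<le> m + (1 / Suc k)\<^sup>2"
proof -
  note \<theta>f = pos_trace_functional[OF \<theta>] and df = pos_trace_functional[OF d]
  have \<tau>: "pos_trace \<tau>" using pos_trace_add[OF \<theta> d] by simp
  note \<tau>f = pos_trace_functional[OF \<tau>]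
  define E where "E = rn_energy \<tau> \<theta> ` {g. star g = g}"
  define m where "m = Inf E"
  have bdd: "bdd_below E" unfolding E_def
    using rn_energy_bounded_below[OF \<theta>f df] by (intro bdd_belowI2[of _ "- Re (\<theta> 1)"]) auto
  have ne: "E \<noteq> {}" unfolding E_def using star_one by blast
  have m: "m \<le> rn_energy \<tau> \<theta> g" if "star g = g" for g
    unfolding m_def using that by (intro cInf_lower bdd) (auto simp: E_def)
  have ex: "\<exists>g. star g = g \<and> rn_energy \<tau> \<theta> g < m + e" if "0 < e" for e
    using cInf_lessD[OF ne, of "m + e"] that by (auto simp: m_def E_def)
  have 1: "\<exists>h. pos h \<and> rn_energy \<tau> \<theta> h \<le> m + e" if e: "0 < e" for e
  proof -
    obtain g where g: "star g = g" "rn_energy \<tau> \<theta> g < m + e/2" using ex[of "e/2"] e by auto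
    obtain u where "pos u" "rn_energy \<tau> \<theta> u \<le> rn_energy \<tau> \<theta> g + e/2"
      using rn_energy_jordan[OF \<theta> \<tau> g(1), of "e/2"] e by auto
    then show ?thesis using g(2) by (intro exI[of _ u]) linarith
  qed
  have 2: "\<exists>u. pos u \<and> rn_energy \<tau> \<theta> (1 - u) \<le> m + e" if e: "0 < e" for e
  proof -
    obtain g where g: "star g = g" "rn_energy \<tau> \<theta> g < m + e/2" using ex[of "e/2"] e by auto
    have "star (1 - g) = 1 - g" using g by (simp add: star_diff)
    then obtain u where u: "pos u"
      "rn_energy \<tau> (\<lambda>a. \<tau> a - \<theta> a) u \<le> rn_energy \<tau> (\<lambda>a. \<tau> a - \<theta> a) (1 - g) + e/2"
      using rn_energy_jordan[OF d \<tau>, of "1 - g" "e/2"] e by auto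
    then show ?thesis
      using g(2) rn_energy_reflect[OF \<theta>f \<tau>f, of u] rn_energy_reflect[OF \<theta>f \<tau>f, of "1 - g"]
      by (intro exI[of _ u]) simp
  qed
  have "\<exists>h. \<forall>k::nat. pos (h k) \<and> rn_energy \<tau> \<theta> (h k) \<le> m + (1 / Suc k)\<^sup>2"
    by (intro choice allI 1) simp
  moreover have "\<exists>u. \<forall>k::nat. pos (u k) \<and> rn_energy \<tau> \<theta> (1 - u k) \<le> m + (1 / Suc k)\<^sup>2"
    by (intro choice allI 2) simp
  ultimately show thesis using m that by blast
qed

text \<open>Since \<open>h\<close> does not depend on \<open>\<psi>\<close>, the limit \<open>\<rho>\<close> is additive in \<open>\<psi>\<close>; this is the Riesz
  decomposition property.\<close>

theorem trace_radon_nikodym: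
  fixes \<theta> \<tau> :: "'a::unital_cstar_algebra \<Rightarrow> complex"
  assumes \<theta>: "pos_trace \<theta>" and d: "pos_trace (\<lambda>a. \<tau> a - \<theta> a)"
  obtains h :: "nat \<Rightarrow> 'a" where "\<And>a. (\<lambda>k. \<tau> (h k * a)) \<longlonglongrightarrow> \<theta> a"
    "\<And>\<psi>. pos_trace \<psi> \<Longrightarrow> pos_trace (\<lambda>a. \<tau> a - \<psi> a) \<Longrightarrow>
      \<exists>\<rho>. pos_trace \<rho> \<and> pos_trace (\<lambda>a. \<psi> a - \<rho> a) \<and> (\<forall>a. (\<lambda>k. \<psi> (h k * a)) \<longlonglongrightarrow> \<rho> a)"
proof -
  note \<theta>f = pos_trace_functional[OF \<theta>]
  have \<tau>: "pos_trace \<tau>" using pos_trace_add[OF \<theta> d] by simp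
  note \<tau>f = pos_trace_functional[OF \<tau>]
  obtain m h u where m: "\<And>g. star g = g \<Longrightarrow> m \<le> rn_energy \<tau> \<theta> g"
    and h: "\<And>k. pos (h k)" and hm: "\<And>k. rn_energy \<tau> \<theta> (h k) \<le> m + (1 / Suc k)\<^sup>2"
    and u: "\<And>k. pos (u k)" and um: "\<And>k. rn_energy \<tau> \<theta> (1 - u k) \<le> m + (1 / Suc k)\<^sup>2"
    using rn_minimizing_sequence[OF \<theta> d] by metis
  have sh: "star (h k) = h k" and su: "star (1 - u k) = 1 - u k" for k
    using pos_self_adjoint[OF h[of k]] pos_self_adjoint[OF u[of k]] by (simp_all add: star_diff)
  have lim0: "(\<lambda>k. c * (1 / real (Suc k))) \<longlonglongrightarrow> 0" for c
    using tendsto_mult_right_zero[OF LIMSEQ_Suc[OF lim_1_over_n]] by simp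
  \<comment> \<open>The bound is \<open>4 * (m + r\<^sup>2) - 4 * m\<close>, the infimum
    \<open>m\<close> being used at the midpoint.\<close>
  have near: "Re (\<tau> ((g - g') * (g - g'))) \<le> (2 * r)\<^sup>2"
    if "star g = g" "star g' = g'" "rn_energy \<tau> \<theta> g \<le> m + r\<^sup>2" "rn_energy \<tau> \<theta> g' \<le> m + r\<^sup>2" for g g' r
    using rn_energy_parallelogram[OF \<theta>f \<tau>f, of g g'] m[of "(1/2) *\<^sub>R (g + g')"] that
    by (simp add: star_scaleR star_add power_mult_distrib)
  have weak: "(\<lambda>k. \<tau> (h k * b)) \<longlonglongrightarrow> \<theta> b" if b: "star b = b" for b
  proof -
    define B where "B = Re (\<tau> (b * b))"
    have real: "\<tau> (h k * b) = of_real (Re (\<tau> (h k * b)))" for k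
      using pos_functional_star[OF \<tau>f, of "h k * b"] pos_trace_commute[OF \<tau>, of b "h k"] b sh[of k]
      by (simp add: star_mult complex_eq_iff)
    have "norm (\<tau> (h k * b) - \<theta> b) \<le> (1 + B) / 2 * (1 / Suc k)" for k
    proof -
      define t where "t = 1 / real (Suc k)"
      define x where "x = Re (\<tau> (h k * b)) - Re (\<theta> b)"
      have t: "t > 0" by (simp add: t_def)
      \<comment> \<open>The excess energy of \<open>h k\<close> is at most \<open>t\<^sup>2\<close>.
        Steps \<open>s\<close> of the same size \<open>t\<close>, in both directions, make every
        term divisible by \<open>t\<close> and leave a bound on \<open>x\<close> linear in
        \<open>t\<close>.\<close>
      have "0 \<le> t\<^sup>2 + 2 * s * x + s\<^sup>2 * B" for s
        using rn_energy_variation[OF \<theta>f \<tau>f sh[of k] b, of s] m[of "h k + s *\<^sub>R b"] hm[of k] b sh[of k]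
        unfolding x_def B_def t_def[symmetric] by (simp add: star_add star_scaleR)
      from this[of t] this[of "- t"] have "0 \<le> t * (t + 2 * x + t * B)" "0 \<le> t * (t - 2 * x + t * B)"
        by (simp_all add: algebra_simps power2_eq_square)
      then have "0 \<le> t + 2 * x + t * B" "0 \<le> t - 2 * x + t * B"
        using t by (simp_all add: zero_le_mult_iff)
      then have "\<bar>x\<bar> \<le> (1 + B) / 2 * t" by (simp add: algebra_simps)
      moreover have "\<tau> (h k * b) - \<theta> b = of_real x"
        using real[of k] pos_functional_self_adjoint[OF \<theta>f b] by (simp add: x_def)
      ultimately show ?thesis by (simp add: t_def)
    qed
    then have "(\<lambda>k. \<tau> (h k * b) - \<theta> b) \<longlonglongrightarrow> 0"
      by (intro Lim_null_comparison[OF _ lim0] always_eventually allI)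
    then show ?thesis by (rule LIM_zero_cancel)
  qed
  show thesis
  proof (rule that[of h])
    fix a :: 'a
    obtain x y where x: "star x = x" "star y = y" and a: "a = x + \<i> *\<^sub>C y"
      using cartesian_parts(1-3) by blast
    show "(\<lambda>k. \<tau> (h k * a)) \<longlonglongrightarrow> \<theta> a" unfolding a
      by (simp add: distrib_left mult_scaleC_right pos_functional_linear[OF \<tau>f]
          pos_functional_linear[OF \<theta>f]) (intro tendsto_intros weak x)
  next
    fix \<psi> :: "'a \<Rightarrow> complex"
    assume \<psi>: "pos_trace \<psi>" and \<psi>d: "pos_trace (\<lambda>a. \<tau> a - \<psi> a)"
    note \<psi>f = pos_trace_functional[OF \<psi>]
    \<comment> \<open>Cauchy-Schwarz for \<psi>, followed by \<psi> \<le> \<tau> on squares, carries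
      2-norm closeness over to every dominated trace.\<close>
    have close: "norm (\<psi> (g * a) - \<psi> (g' * a)) \<le> 2 * r * sqrt (Re (\<psi> (star a * a)))"
      if g: "star g = g" "star g' = g'" "rn_energy \<tau> \<theta> g \<le> m + r\<^sup>2" "rn_energy \<tau> \<theta> g' \<le> m + r\<^sup>2"
        and r: "0 \<le> r" for g g' r a
    proof -
      have a: "0 \<le> Re (\<psi> (star a * a))"
        using pos_functional_nonneg[OF \<psi>f] by (simp add: complex_nonneg_Reals_iff)
      have sg: "star (g - g') = g - g'" using g by (simp add: star_diff)
      have "(cmod (\<psi> ((g - g') * a)))\<^sup>2 \<le> Re (\<psi> ((g - g') * (g - g'))) * Re (\<psi> (star a * a))"
        using pos_functional_cauchy_schwarz[OF \<psi>f, of "g - g'" a] sg by simp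
      also have "\<dots> \<le> (2 * r)\<^sup>2 * Re (\<psi> (star a * a))"
        using pos_functional_pos[OF pos_trace_functional[OF \<psi>d] pos_square[OF sg]] near[OF g] a
        by (intro mult_right_mono) (auto simp: complex_nonneg_Reals_iff)
      also have "\<dots> = (2 * r * sqrt (Re (\<psi> (star a * a))))\<^sup>2"
        using a by (simp add: power_mult_distrib)
      finally have "cmod (\<psi> ((g - g') * a)) \<le> 2 * r * sqrt (Re (\<psi> (star a * a)))"
        by (rule power2_le_imp_le) (use r a in simp)
      then show ?thesis by (simp add: left_diff_distrib pos_functional_linear[OF \<psi>f])
    qed
    have "convergent (\<lambda>k. \<psi> (h k * a))" for a
    proof -
      define K where "K = sqrt (Re (\<psi> (star a * a)))"
      have K: "0 \<le> K" using pos_functional_nonneg[OF \<psi>f] by (simp add: K_def complex_nonneg_Reals_iff)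
      have "Cauchy (\<lambda>k. \<psi> (h k * a))"
      proof (rule CauchyI)
        fix e :: real assume "0 < e"
        then have "\<forall>\<^sub>F k in sequentially. 2 * K * (1 / real (Suc k)) < e"
          using lim0[of "2 * K"] by (auto dest: order_tendstoD(2))
        then obtain N where N: "2 * K * (1 / real (Suc N)) < e" by (auto simp: eventually_sequentially)
        have hN: "rn_energy \<tau> \<theta> (h k) \<le> m + (1 / real (Suc N))\<^sup>2" if "k \<ge> N" for k
        proof -
          have "(1 / real (Suc k))\<^sup>2 \<le> (1 / real (Suc N))\<^sup>2"
            using that by (intro power_mono frac_le) auto
          then show ?thesis using hm[of k] by (meson add_left_mono order_trans)
        qed
        show "\<exists>M. \<forall>k\<ge>M. \<forall>l\<ge>M. norm (\<psi> (h k * a) - \<psi> (h l * a)) < e"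
        proof (intro exI allI impI)
          fix k l assume "k \<ge> N" "l \<ge> N"
          then have "norm (\<psi> (h k * a) - \<psi> (h l * a)) \<le> 2 * (1 / real (Suc N)) * K"
            unfolding K_def by (intro close sh hN) auto
          then show "norm (\<psi> (h k * a) - \<psi> (h l * a)) < e" using N by (simp add: algebra_simps)
        qed
      qed
      then show ?thesis by (rule Cauchy_convergent)
    qed
    then obtain \<rho> where \<rho>: "\<And>a. (\<lambda>k. \<psi> (h k * a)) \<longlonglongrightarrow> \<rho> a" unfolding convergent_def by metis
    \<comment> \<open>Both sequences consist of near-minimizers, hence have the same limit.\<close>
    have \<rho>u: "(\<lambda>k. \<psi> ((1 - u k) * a)) \<longlonglongrightarrow> \<rho> a" for a
    proof -
      have "norm (\<psi> ((1 - u k) * a) - \<psi> (h k * a)) \<le> 2 * sqrt (Re (\<psi> (star a * a))) * (1 / Suc k)" for k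
        using close[OF su sh um hm, of k a] by simp
      then have "(\<lambda>k. \<psi> ((1 - u k) * a) - \<psi> (h k * a)) \<longlonglongrightarrow> 0"
        by (intro Lim_null_comparison[OF _ lim0] always_eventually allI)
      from tendsto_add[OF this \<rho>[of a]] show ?thesis by simp
    qed
    \<comment> \<open>The product of two positive elements need not be positive, but traciality
      turns it into \<open>a * g * star a\<close>, which has the form
      \<open>star z * z\<close>.\<close>
    have posl: "\<psi> (g * (star a * a)) \<in> \<real>\<^sub>\<ge>\<^sub>0" if g: "pos g" for g a
    proof -
      obtain s where s: "star s = s" "g = s * s" using g by (auto simp: pos_def)
      have "\<psi> (g * (star a * a)) = \<psi> (a * (g * star a))"
        using pos_trace_commute[OF \<psi>, of a "g * star a"] by (simp add: mult.assoc)
      also have "a * (g * star a) = star (s * star a) * (s * star a)"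
        by (simp add: s star_mult star_star mult.assoc)
      finally show ?thesis using pos_functional_nonneg[OF \<psi>f] by simp
    qed
    have \<rho>f: "pos_functional \<rho>"
    proof -
      have "\<rho> (a + b) = \<rho> a + \<rho> b" for a b
      proof (rule LIMSEQ_unique[OF \<rho>])
        show "(\<lambda>k. \<psi> (h k * (a + b))) \<longlonglongrightarrow> \<rho> a + \<rho> b"
          by (simp add: distrib_left pos_functional_linear[OF \<psi>f]) (intro tendsto_intros \<rho>)
      qed
      moreover have "\<rho> (c *\<^sub>C a) = c * \<rho> a" for c a
      proof (rule LIMSEQ_unique[OF \<rho>])
        show "(\<lambda>k. \<psi> (h k * (c *\<^sub>C a))) \<longlonglongrightarrow> c * \<rho> a"
          by (simp add: mult_scaleC_right pos_functional_linear[OF \<psi>f]) (intro tendsto_intros \<rho>)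
      qed
      moreover have "\<rho> (star a * a) \<in> \<real>\<^sub>\<ge>\<^sub>0" for a
        by (rule closed_sequentially[OF closed_nonneg_Reals_complex _ \<rho>]) (rule posl[OF h])
      ultimately show ?thesis by (simp add: pos_functional_def)
    qed
    have \<rho>t: "pos_trace \<rho>"
    proof (rule pos_trace_if_unitary_invariant[OF \<rho>f])
      fix w a :: 'a assume w: "unitary w"
      then have ww: "star w * w = 1" "w * star w = 1" by (auto simp: unitary_def)
      define K where "K = sqrt (Re (\<psi> (star (w * a) * (w * a))))"
      have "norm (\<psi> (h k * (w * a)) - \<psi> (h k * (a * w))) \<le> 2 * K * (1 / Suc k)" for k
      proof -
        have ww': "star w * (w * b) = b" "w * (star w * b) = b" for b
          using ww by (simp_all flip: mult.assoc)
        \<comment> \<open>Both \<tau> and \<theta> are traces, so conjugation by a unitary preserves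
          the energy, and \<open>g\<close> is as good a near-minimizer as
          \<open>h k\<close>.\<close>
        define g where "g = w * h k * star w"
        have sg: "star g = g" by (simp add: g_def star_mult star_star sh mult.assoc)
        have "g * g = w * (h k * h k * star w)" by (simp add: g_def mult.assoc ww')
        then have "\<tau> (g * g) = \<tau> (h k * h k)"
          using pos_trace_commute[OF \<tau>, of w "h k * h k * star w"] ww by (simp add: mult.assoc)
        moreover have "\<theta> g = \<theta> (h k)"
          using pos_trace_commute[OF \<theta>, of w "h k * star w"] ww by (simp add: g_def mult.assoc)
        ultimately have "rn_energy \<tau> \<theta> g \<le> m + (1 / Suc k)\<^sup>2" using hm[of k] by (simp add: rn_energy_def)
        from close[OF sh sg hm this, of "w * a"]
        have "norm (\<psi> (h k * (w * a)) - \<psi> (g * (w * a))) \<le> 2 * K * (1 / Suc k)" by (simp add: K_def)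
        moreover have "\<psi> (g * (w * a)) = \<psi> (h k * (a * w))"
          using pos_trace_commute[OF \<psi>, of w "h k * a"] by (simp add: g_def mult.assoc ww')
        ultimately show ?thesis by simp
      qed
      then have "(\<lambda>k. \<psi> (h k * (w * a)) - \<psi> (h k * (a * w))) \<longlonglongrightarrow> 0"
        by (intro Lim_null_comparison[OF _ lim0] always_eventually allI)
      moreover have "(\<lambda>k. \<psi> (h k * (w * a)) - \<psi> (h k * (a * w))) \<longlonglongrightarrow> \<rho> (w * a) - \<rho> (a * w)"
        by (intro tendsto_intros \<rho>)
      ultimately show "\<rho> (w * a) = \<rho> (a * w)" using LIMSEQ_unique by fastforce
    qed
    have "\<psi> (star a * a) - \<rho> (star a * a) \<in> \<real>\<^sub>\<ge>\<^sub>0" for a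
    proof (rule closed_sequentially[OF closed_nonneg_Reals_complex])
      show "\<psi> (u k * (star a * a)) \<in> \<real>\<^sub>\<ge>\<^sub>0" for k by (rule posl[OF u])
      have "(\<lambda>k. \<psi> (star a * a) - \<psi> ((1 - u k) * (star a * a))) \<longlonglongrightarrow> \<psi> (star a * a) - \<rho> (star a * a)"
        by (intro tendsto_intros \<rho>u)
      then show "(\<lambda>k. \<psi> (u k * (star a * a))) \<longlonglongrightarrow> \<psi> (star a * a) - \<rho> (star a * a)"
        by (simp add: left_diff_distrib pos_functional_linear[OF \<psi>f])
    qed
    then have "pos_trace (\<lambda>a. \<psi> a - \<rho> a)"
      using pos_trace_commute[OF \<psi>] pos_trace_commute[OF \<rho>t] unfolding pos_trace_def pos_functional_def
      by (simp add: pos_functional_linear[OF \<psi>f] pos_functional_linear[OF \<rho>f] right_diff_distrib)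
    then show "\<exists>\<rho>. pos_trace \<rho> \<and> pos_trace (\<lambda>a. \<psi> a - \<rho> a) \<and> (\<forall>a. (\<lambda>k. \<psi> (h k * a)) \<longlonglongrightarrow> \<rho> a)"
      using \<rho> \<rho>t by blast
  qed
qed

subsection \<open>Independence of extreme traces\<close>

text \<open>If \<open>c j < 0\<close>, moving the nonpositive terms across puts \<theta>, a positive
  multiple of \<open>\<phi> j\<close>, below the combination \<tau> over \<open>P\<close>. Riesz
  decomposition splits \<theta> into pieces \<open>\<rho> i\<close>, each below multiples of both
  \<open>\<phi> i\<close> and \<open>\<phi> j\<close>. Lying on two distinct extreme rays, every
  piece vanishes, and so does \<theta>.\<close>

lemma extreme_traces_coeff_nonneg:
  fixes \<phi> :: "'i \<Rightarrow> 'a::unital_cstar_algebra \<Rightarrow>\<^sub>L complex" and c :: "'i \<Rightarrow> real"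
  assumes I: "finite I" "inj_on \<phi> I" "\<And>i. i \<in> I \<Longrightarrow> \<phi> i \<in> extreme_traces"
    and sum: "\<And>a. (\<Sum>i\<in>I. of_real (c i) * blinfun_apply (\<phi> i) a) = 0" and j: "j \<in> I"
  shows "0 \<le> c j"
proof (rule ccontr)
  assume "\<not> 0 \<le> c j"
  then have cj: "c j < 0" by simp
  have tr: "pos_trace (blinfun_apply (\<phi> i))" "blinfun_apply (\<phi> i) 1 = 1" if "i \<in> I" for i
    using extreme_traces_states[OF I(3)[OF that]] by (auto simp: tracial_states_iff)
  define P N where "P = {i \<in> I. c i > 0}" and "N = {i \<in> I. c i \<le> 0} - {j}"
  have fin: "finite P" "finite N" using I(1) by (auto simp: P_def N_def)
  have IPN: "I = insert j (P \<union> N)" "P \<inter> N = {}" "j \<notin> P \<union> N"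
    using j cj by (auto simp: P_def N_def)
  define \<theta> where "\<theta> a = of_real (- c j) * blinfun_apply (\<phi> j) a" for a
  define \<tau> where "\<tau> a = (\<Sum>i\<in>P. of_real (c i) * blinfun_apply (\<phi> i) a)" for a
  have \<theta>: "pos_trace \<theta>" unfolding \<theta>_def using tr(1)[OF j] cj by (intro pos_trace_scale) auto
  have "\<tau> a - \<theta> a = (\<Sum>i\<in>N. of_real (- c i) * blinfun_apply (\<phi> i) a)" for a
    using sum[of a] IPN fin unfolding \<tau>_def \<theta>_def
    by (simp add: sum.union_disjoint sum_negf eq_neg_iff_add_eq_0 algebra_simps)
  moreover have "pos_trace (\<lambda>a. \<Sum>i\<in>N. of_real (- c i) * blinfun_apply (\<phi> i) a)"
    by (intro pos_trace_sum pos_trace_scale tr(1)) (auto simp: N_def)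
  ultimately have d: "pos_trace (\<lambda>a. \<tau> a - \<theta> a)" by simp
  obtain h where h: "\<And>a. (\<lambda>k. \<tau> (h k * a)) \<longlonglongrightarrow> \<theta> a"
    "\<And>\<psi>. pos_trace \<psi> \<Longrightarrow> pos_trace (\<lambda>a. \<tau> a - \<psi> a) \<Longrightarrow>
      \<exists>\<rho>. pos_trace \<rho> \<and> pos_trace (\<lambda>a. \<psi> a - \<rho> a) \<and> (\<forall>a. (\<lambda>k. \<psi> (h k * a)) \<longlonglongrightarrow> \<rho> a)"
    using trace_radon_nikodym[OF \<theta> d] by blast
  have "\<exists>\<rho>. pos_trace \<rho> \<and> pos_trace (\<lambda>a. of_real (c i) * blinfun_apply (\<phi> i) a - \<rho> a) \<and>
      (\<forall>a. (\<lambda>k. of_real (c i) * blinfun_apply (\<phi> i) (h k * a)) \<longlonglongrightarrow> \<rho> a)" if i: "i \<in> P" for i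
  proof (rule h(2))
    show "pos_trace (\<lambda>a. of_real (c i) * blinfun_apply (\<phi> i) a)"
      using i tr(1) by (intro pos_trace_scale) (auto simp: P_def)
    have "pos_trace (\<lambda>a. \<Sum>i\<in>P - {i}. of_real (c i) * blinfun_apply (\<phi> i) a)"
      by (intro pos_trace_sum pos_trace_scale tr(1)) (auto simp: P_def)
    moreover have "(\<Sum>i\<in>P - {i}. of_real (c i) * blinfun_apply (\<phi> i) a)
        = \<tau> a - of_real (c i) * blinfun_apply (\<phi> i) a" for a
      unfolding \<tau>_def using i fin by (simp add: sum_diff1)
    ultimately show "pos_trace (\<lambda>a. \<tau> a - of_real (c i) * blinfun_apply (\<phi> i) a)" by simp
  qed
  then obtain \<rho> where \<rho>: "\<And>i. i \<in> P \<Longrightarrow> pos_trace (\<rho> i)"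
    "\<And>i. i \<in> P \<Longrightarrow> pos_trace (\<lambda>a. of_real (c i) * blinfun_apply (\<phi> i) a - \<rho> i a)"
    "\<And>i a. i \<in> P \<Longrightarrow> (\<lambda>k. of_real (c i) * blinfun_apply (\<phi> i) (h k * a)) \<longlonglongrightarrow> \<rho> i a"
    by metis
  have \<theta>\<rho>: "\<theta> a = (\<Sum>i\<in>P. \<rho> i a)" for a
  proof (rule LIMSEQ_unique[OF h(1)])
    show "(\<lambda>k. \<tau> (h k * a)) \<longlonglongrightarrow> (\<Sum>i\<in>P. \<rho> i a)" unfolding \<tau>_def by (intro tendsto_sum \<rho>)
  qed
  have "\<rho> i 1 = 0" if i: "i \<in> P" for i
  proof (rule ccontr)
    assume nz: "\<rho> i 1 \<noteq> 0"
    have iI: "i \<in> I" and ij: "i \<noteq> j" using i cj by (auto simp: P_def)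
    have 1: "\<rho> i a = \<rho> i 1 * blinfun_apply (\<phi> i) a" for a
      by (rule extreme_trace_ray[OF I(3)[OF iI] \<rho>(1,2)[OF i]])
    have "pos_trace (\<lambda>a. \<Sum>i\<in>P - {i}. \<rho> i a)" by (intro pos_trace_sum \<rho>(1)) auto
    moreover have "(\<Sum>i\<in>P - {i}. \<rho> i a) = of_real (- c j) * blinfun_apply (\<phi> j) a - \<rho> i a" for a
      using \<theta>\<rho>[of a] i fin unfolding \<theta>_def by (simp add: sum_diff1)
    ultimately have "pos_trace (\<lambda>a. of_real (- c j) * blinfun_apply (\<phi> j) a - \<rho> i a)" by simp
    then have 2: "\<rho> i a = \<rho> i 1 * blinfun_apply (\<phi> j) a" for a
      by (rule extreme_trace_ray[OF I(3)[OF j] \<rho>(1)[OF i]])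
    have "\<phi> i = \<phi> j" by (rule blinfun_eqI) (use 1 2 nz in \<open>metis mult_left_cancel\<close>)
    then show False using I(2) iI j ij by (auto dest: inj_onD)
  qed
  then have "\<theta> 1 = 0" unfolding \<theta>\<rho> by simp
  then show False using cj tr(2)[OF j] by (simp add: \<theta>_def)
qed

text \<open>For real coefficients, apply the sign lemma to \<open>c\<close> and to its negative.
  Positive functionals commute with conjugation, so a complex relation can be conjugated and
  separated into real and imaginary parts.\<close>

theorem extreme_traces_independent:
  fixes \<phi> :: "'i \<Rightarrow> 'a::unital_cstar_algebra \<Rightarrow>\<^sub>L complex" and c :: "'i \<Rightarrow> complex"
  assumes I: "finite I" "inj_on \<phi> I" "\<And>i. i \<in> I \<Longrightarrow> \<phi> i \<in> extreme_traces"
    and sum: "\<And>a. (\<Sum>i\<in>I. c i * blinfun_apply (\<phi> i) a) = 0" and j: "j \<in> I"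
  shows "c j = 0"
proof -
  have real: "r j = 0" if r: "\<And>a. (\<Sum>i\<in>I. of_real (r i) * blinfun_apply (\<phi> i) a) = 0" for r :: "'i \<Rightarrow> real"
  proof -
    have "(\<Sum>i\<in>I. of_real (- r i) * blinfun_apply (\<phi> i) a) = 0" for a
      using r[of a] by (simp add: sum_negf)
    with extreme_traces_coeff_nonneg[OF I r j] extreme_traces_coeff_nonneg[OF I this j]
    show ?thesis by linarith
  qed
  have star: "blinfun_apply (\<phi> i) (star a) = cnj (blinfun_apply (\<phi> i) a)" if "i \<in> I" for i a
    using extreme_traces_states[OF I(3)[OF that]]
    by (intro pos_functional_star pos_trace_functional) (simp add: tracial_states_iff)
  have conj: "(\<Sum>i\<in>I. cnj (c i) * blinfun_apply (\<phi> i) a) = 0" for a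
  proof -
    have "(\<Sum>i\<in>I. cnj (c i) * blinfun_apply (\<phi> i) a) = cnj (\<Sum>i\<in>I. c i * blinfun_apply (\<phi> i) (star a))"
      unfolding cnj_sum by (intro sum.cong) (auto simp: star)
    then show ?thesis by (simp add: sum)
  qed
  have "(\<Sum>i\<in>I. of_real (Re (c i)) * blinfun_apply (\<phi> i) a) = 0" for a
  proof -
    have "(\<Sum>i\<in>I. of_real (Re (c i)) * blinfun_apply (\<phi> i) a) =
      (\<Sum>i\<in>I. (1/2) * (c i * blinfun_apply (\<phi> i) a + cnj (c i) * blinfun_apply (\<phi> i) a))"
      by (intro sum.cong refl) (simp add: complex_eq_iff field_simps)
    also have "\<dots> = 0" by (simp only: sum_distrib_left[symmetric] sum.distrib sum conj) simp
    finally show ?thesis .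
  qed
  then have "Re (c j) = 0" by (rule real)
  have "(\<Sum>i\<in>I. of_real (Im (c i)) * blinfun_apply (\<phi> i) a) = 0" for a
  proof -
    have "(\<Sum>i\<in>I. of_real (Im (c i)) * blinfun_apply (\<phi> i) a) =
      (\<Sum>i\<in>I. (- \<i> / 2) * (c i * blinfun_apply (\<phi> i) a - cnj (c i) * blinfun_apply (\<phi> i) a))"
      by (intro sum.cong refl) (simp add: complex_eq_iff field_simps)
    also have "\<dots> = 0" by (simp only: sum_distrib_left[symmetric] sum_subtractf sum conj) simp
    finally show ?thesis .
  qed
  then have "Im (c j) = 0" by (rule real)
  with \<open>Re (c j) = 0\<close> show ?thesis by (simp add: complex_eq_iff)
qed

subsection \<open>Homomorphisms into matrices\<close>

text \<open>The properties shared by \<Phi>, which maps onto a corner, and by its counterpart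
  \<Psi>, so that both act on traces and on projections by the same lemmas.\<close>

definition mat_star_hom :: "nat \<Rightarrow> ('a::unital_cstar_algebra \<Rightarrow> 'a mat) \<Rightarrow> bool" where
  "mat_star_hom k F \<longleftrightarrow> (\<forall>a. F a \<in> carrier_mat k k) \<and> (\<forall>a b. F (a + b) = F a + F b) \<and>
     (\<forall>c a. F (c *\<^sub>C a) = map_mat (scaleC c) (F a)) \<and> (\<forall>a b. F (a * b) = F a * F b) \<and>
     (\<forall>a. F (star a) = mat_star (F a))"

lemma
  assumes "mat_star_hom k F"
  shows mat_star_hom_carrier: "F a \<in> carrier_mat k k"
    and mat_star_hom_add: "F (a + b) = F a + F b"
    and mat_star_hom_scaleC: "F (c *\<^sub>C a) = map_mat (scaleC c) (F a)"
    and mat_star_hom_mult: "F (a * b) = F a * F b"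
    and mat_star_hom_star: "F (star a) = mat_star (F a)"
  using assms by (auto simp: mat_star_hom_def)

lemma mat_star_hom_dim:
  assumes "mat_star_hom k F" shows "dim_row (F a) = k" "dim_col (F a) = k"
  using mat_star_hom_carrier[OF assms, of a] by auto

lemma mat_star_hom_sum:
  assumes F: "mat_star_hom k F" and ij: "i < k" "j < k"
  shows "F (\<Sum>x\<in>X. g x) $$ (i, j) = (\<Sum>x\<in>X. F (g x) $$ (i, j))"
proof -
  have add: "F (a + b) $$ (i, j) = F a $$ (i, j) + F b $$ (i, j)" for a b
    using ij mat_star_hom_dim[OF F] by (simp add: mat_star_hom_add[OF F])
  have "F 0 $$ (i, j) = 0" using add[of 0 0] by simp
  then show ?thesis by (induction X rule: infinite_finite_induct) (auto simp: add)
qed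

lemma pos_trace_trace_ext:
  fixes \<phi> :: "'a::unital_cstar_algebra \<Rightarrow>\<^sub>L complex"
  assumes \<phi>: "pos_trace (blinfun_apply \<phi>)" and F: "mat_star_hom k F"
  shows "pos_trace (\<lambda>a. trace_ext \<phi> (F a))"
proof -
  note f = pos_trace_functional[OF \<phi>] and dim = mat_star_hom_dim[OF F]
  have bt: "\<phi> \<in> bounded_traces" using \<phi> by (simp add: pos_trace_blinfun_apply)
  have "trace_ext \<phi> (F (a + b)) = trace_ext \<phi> (F a) + trace_ext \<phi> (F b)" for a b
    by (simp add: trace_ext_def mat_star_hom_add[OF F] dim blinfun.add_right sum.distrib)
  moreover have "trace_ext \<phi> (F (c *\<^sub>C a)) = c * trace_ext \<phi> (F a)" for c a
    by (simp add: trace_ext_def mat_star_hom_scaleC[OF F] dim pos_functional_scaleC[OF f] sum_distrib_left)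
  moreover have "trace_ext \<phi> (F (star a * a)) \<in> \<real>\<^sub>\<ge>\<^sub>0" for a
  proof -
    have "trace_ext \<phi> (F (star a * a)) =
        (\<Sum>i<k. \<Sum>j<k. \<phi> (star (F a $$ (j, i)) * F a $$ (j, i)))"
      by (simp add: trace_ext_def mat_star_hom_mult[OF F] mat_star_hom_star[OF F] dim scalar_prod_def
          pos_functional_sum[OF f] atLeast0LessThan)
    also have "\<dots> \<in> \<real>\<^sub>\<ge>\<^sub>0"
      using pos_functional_nonneg[OF f] by (auto simp: complex_nonneg_Reals_iff intro!: sum_nonneg)
    finally show ?thesis .
  qed
  moreover have "trace_ext \<phi> (F (a * b)) = trace_ext \<phi> (F (b * a))" for a b
    unfolding mat_star_hom_mult[OF F]
    by (rule trace_ext_mult_commute[OF bt mat_star_hom_carrier[OF F] mat_star_hom_carrier[OF F]])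
  ultimately show ?thesis by (simp add: pos_trace_def pos_functional_def)
qed

section \<open>Amplification to matrices and the images of \<open>K0\<close>\<close>

lemma sum_div_mod:
  fixes g :: "nat \<Rightarrow> nat \<Rightarrow> 'b::comm_monoid_add"
  shows "(\<Sum>t<m * k. g (t div k) (t mod k)) = (\<Sum>i<m. \<Sum>j<k. g i j)"
proof -
  have split: "(\<Sum>i<m + n. f i) = (\<Sum>i<m. f i) + (\<Sum>i<n. f (m + i))"
    for m n :: nat and f :: "nat \<Rightarrow> 'b"
    by (induction n) (auto simp: add.assoc)
  show ?thesis
  proof (induction m)
    case (Suc m)
    have "Suc m * k = m * k + k" by simp
    then show ?case by (simp only: split Suc) simp
  qed simp
qed

text \<open>The amplification of \<open>F\<close> to matrices: the index \<open>r\<close> encodes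
  the block \<open>r div k\<close> and the position \<open>r mod k\<close> inside it.\<close>

definition block_map :: "nat \<Rightarrow> ('a::unital_cstar_algebra \<Rightarrow> 'a mat) \<Rightarrow> 'a mat \<Rightarrow> 'a mat" where
  "block_map k F q = mat (dim_row q * k) (dim_col q * k)
     (\<lambda>(r, s). F (q $$ (r div k, s div k)) $$ (r mod k, s mod k))"

lemma block_map_projection:
  assumes F: "mat_star_hom k F" and q: "q \<in> projections"
  shows "block_map k F q \<in> projections"
proof -
  note dim = mat_star_hom_dim[OF F]
  define m where "m = dim_row q"
  note Q = projectionsD[OF q, folded m_def]
  have qd: "dim_row q = m" "dim_col q = m" using Q(1) by auto
  have dm: "r div k < m" "r mod k < k" if "r < m * k" for r
    using that by (auto simp: less_mult_imp_div_less) (metis mod_less_divisor mult_0_right neq0_conv not_less0)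
  have "block_map k F q * block_map k F q = block_map k F q"
  proof (rule eq_matI)
    fix r s assume "r < dim_row (block_map k F q)" "s < dim_col (block_map k F q)"
    then have rs: "r < m * k" "s < m * k" by (simp_all add: block_map_def qd)
    note d = dm[OF rs(1)] dm[OF rs(2)]
    have "(block_map k F q * block_map k F q) $$ (r, s) =
      (\<Sum>t<m * k. F (q $$ (r div k, t div k)) $$ (r mod k, t mod k) * F (q $$ (t div k, s div k)) $$ (t mod k, s mod k))"
      using rs by (simp add: block_map_def qd scalar_prod_def atLeast0LessThan)
    also have "\<dots> = (\<Sum>i<m. \<Sum>j<k. F (q $$ (r div k, i)) $$ (r mod k, j) * F (q $$ (i, s div k)) $$ (j, s mod k))"
      by (rule sum_div_mod)
    also have "\<dots> = (\<Sum>i<m. F (q $$ (r div k, i) * q $$ (i, s div k)) $$ (r mod k, s mod k))"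
      using d by (simp add: mat_star_hom_mult[OF F] dim scalar_prod_def atLeast0LessThan)
    also have "\<dots> = F ((q * q) $$ (r div k, s div k)) $$ (r mod k, s mod k)"
      using d by (simp add: mat_star_hom_sum[OF F] qd scalar_prod_def atLeast0LessThan)
    also have "\<dots> = block_map k F q $$ (r, s)" using rs by (simp add: Q(2) block_map_def qd)
    finally show "(block_map k F q * block_map k F q) $$ (r, s) = block_map k F q $$ (r, s)" .
  qed (simp_all add: block_map_def qd)
  moreover have "mat_star (block_map k F q) = block_map k F q"
  proof (rule eq_matI)
    fix r s assume "r < dim_row (block_map k F q)" "s < dim_col (block_map k F q)"
    then have rs: "r < m * k" "s < m * k" by (simp_all add: block_map_def qd)
    note d = dm[OF rs(1)] dm[OF rs(2)]
    have "mat_star (block_map k F q) $$ (r, s) = star (F (q $$ (s div k, r div k)) $$ (s mod k, r mod k))"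
      using rs by (simp add: block_map_def qd)
    also have "\<dots> = F (star (q $$ (s div k, r div k))) $$ (r mod k, s mod k)"
      using d by (simp add: mat_star_hom_star[OF F] dim)
    also have "star (q $$ (s div k, r div k)) = mat_star q $$ (r div k, s div k)" using d by (simp add: qd)
    finally show "mat_star (block_map k F q) $$ (r, s) = block_map k F q $$ (r, s)"
      using rs by (simp add: Q(3) block_map_def qd)
  qed (simp_all add: block_map_def qd)
  ultimately show ?thesis by (simp add: projections_def block_map_def qd)
qed

lemma trace_ext_block_map:
  assumes F: "mat_star_hom k F" and q: "square_mat q"
  shows "trace_ext \<phi> (block_map k F q) = (\<Sum>i<dim_row q. trace_ext \<phi> (F (q $$ (i, i))))"
proof -
  have "trace_ext \<phi> (block_map k F q) =
      (\<Sum>t<dim_row q * k. blinfun_apply \<phi> (F (q $$ (t div k, t div k)) $$ (t mod k, t mod k)))"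
    using q by (simp add: trace_ext_def block_map_def)
  also have "\<dots> = (\<Sum>i<dim_row q. \<Sum>j<k. blinfun_apply \<phi> (F (q $$ (i, i)) $$ (j, j)))"
    by (rule sum_div_mod)
  finally show ?thesis by (simp add: trace_ext_def mat_star_hom_dim[OF F])
qed

lemma K0_hom_diff:
  assumes "pos_trace (blinfun_apply \<phi>)"
  shows "K0_hom \<phi> (x - y) = K0_hom \<phi> x - K0_hom \<phi> y"
  using K0_hom_add[of \<phi> "x - y" y] assms by (simp add: pos_trace_blinfun_apply)

text \<open>Every element of \<open>K0\<close> is a difference of classes of projections, and
  amplifying both by \<open>F\<close> exhibits a preimage. Only membership in the range is at stake,
  so no map on \<open>K0\<close> induced by \<open>F\<close> has to be constructed.\<close>

lemma K0_hom_range_subset: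
  fixes \<phi> \<psi> :: "'a::unital_cstar_algebra \<Rightarrow>\<^sub>L complex"
  assumes \<phi>: "pos_trace (blinfun_apply \<phi>)" and \<psi>: "pos_trace (blinfun_apply \<psi>)"
    and F: "mat_star_hom k F" and eq: "\<And>a. trace_ext \<phi> (F a) = of_real d * blinfun_apply \<psi> a"
  shows "(\<lambda>x. d * x) ` range (K0_hom \<psi>) \<subseteq> range (K0_hom \<phi>)"
proof -
  have cls: "d * K0_hom \<psi> (K0_class p) = K0_hom \<phi> (K0_class (block_map k F p))" if p: "p \<in> projections" for p
  proof -
    have "of_real (K0_hom \<phi> (K0_class (block_map k F p))) = trace_ext \<phi> (block_map k F p)"
      using \<phi> by (intro K0_hom_class block_map_projection[OF F p]) (simp_all add: pos_trace_blinfun_apply)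
    also have "\<dots> = of_real d * trace_ext \<psi> p"
      using p by (simp add: trace_ext_block_map[OF F] projections_def eq sum_distrib_left trace_ext_def[of \<psi>])
    also have "trace_ext \<psi> p = of_real (K0_hom \<psi> (K0_class p))"
      using \<psi> by (intro K0_hom_class[symmetric] p) (simp_all add: pos_trace_blinfun_apply)
    finally show ?thesis by (metis of_real_eq_iff of_real_mult)
  qed
  have "d * K0_hom \<psi> x \<in> range (K0_hom \<phi>)" for x
  proof -
    obtain p q where pq: "p \<in> projections" "q \<in> projections" "x = K0_class p - K0_class q"
      by (rule K0_cases)
    have "d * K0_hom \<psi> x = K0_hom \<phi> (K0_class (block_map k F p) - K0_class (block_map k F q))"
      unfolding pq(3) K0_hom_diff[OF \<phi>] K0_hom_diff[OF \<psi>]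
      by (simp add: right_diff_distrib cls[OF pq(1)] cls[OF pq(2)])
    then show ?thesis by blast
  qed
  then show ?thesis by blast
qed

subsection \<open>Inverse of a self-similar pair\<close>

lemma star_mult_add_le_squares:
  fixes a b :: "nat \<Rightarrow> 'a::unital_cstar_algebra"
  shows "pos ((\<Sum>i<k. star (a i) * a i) + (\<Sum>i<k. star (b i) * b i)
    - ((\<Sum>i<k. star (a i) * b i) + star (\<Sum>i<k. star (a i) * b i)))"
proof -
  have "(\<Sum>i<k. star (a i - b i) * (a i - b i)) = (\<Sum>i<k. star (a i) * a i) + (\<Sum>i<k. star (b i) * b i)
    - ((\<Sum>i<k. star (a i) * b i) + star (\<Sum>i<k. star (a i) * b i))"
    by (simp add: star_sum star_mult star_star star_diff algebra_simps sum.distrib sum_subtractf)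
  moreover have "pos (\<Sum>i<k. star (a i - b i) * (a i - b i))" by (intro pos_sum pos_star_mult_self)
  ultimately show ?thesis by simp
qed

text \<open>A generator is the product of the adjoint of the column \<open>p * a\<close> with
  \<open>p * b\<close>, and the squares of these two columns dominate it plus its adjoint. An
  element of the span need not be self-adjoint, whence \<open>y + star y\<close>; the list grows by
  two columns per term.\<close>

lemma full_projection_span_bound:
  fixes p :: "'a::unital_cstar_algebra mat"
  assumes p: "p \<in> carrier_mat k k" "p \<in> projections"
    and y: "y \<in> complex_vector.span
       {(mat_star a * p * b) $$ (0, 0) | a b. a \<in> carrier_mat k 1 \<and> b \<in> carrier_mat k 1}"
  shows "\<exists>ws :: (nat \<Rightarrow> 'a) list. (\<forall>w\<in>set ws. \<forall>i<k. (\<Sum>j<k. p $$ (i, j) * w j) = w i) \<and>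
    pos ((\<Sum>w\<leftarrow>ws. \<Sum>i<k. star (w i) * w i) - (y + star y))"
  using y
proof (induction rule: complex_vector.span_induct_alt)
  case base
  show ?case by (rule exI[of _ "[]"]) simp
next
  case (step c x y)
  obtain a b where ab: "a \<in> carrier_mat k 1" "b \<in> carrier_mat k 1" and x: "x = (mat_star a * p * b) $$ (0, 0)"
    using step(1) by blast
  obtain ws where ws: "\<forall>w\<in>set ws. \<forall>i<k. (\<Sum>j<k. p $$ (i, j) * w j) = w i"
    "pos ((\<Sum>w\<leftarrow>ws. \<Sum>i<k. star (w i) * w i) - (y + star y))"
    using step(2) by blast
  define v where "v d i = (p * d) $$ (i, 0)" for d :: "'a mat" and i
  have pd: "p * d \<in> carrier_mat k 1" if "d \<in> carrier_mat k 1" for d using p(1) that by simp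
  have vp: "(\<Sum>j<k. p $$ (i, j) * v d j) = v d i" if d: "d \<in> carrier_mat k 1" and i: "i < k" for d i
  proof -
    have "v d i = (p * (p * d)) $$ (i, 0)"
      unfolding v_def using assoc_mult_mat[OF p(1) p(1) d] projectionsD(2)[OF p(2)] by simp
    also have "\<dots> = (\<Sum>j<k. p $$ (i, j) * v d j)"
      using p(1) pd[OF d] i by (auto simp: scalar_prod_def v_def atLeast0LessThan)
    finally show ?thesis by simp
  qed
  have "mat_star a * p * b = mat_star (p * a) * (p * b)"
  proof -
    have "mat_star (p * a) * (p * b) = mat_star a * p * (p * b)"
      using mat_star_mult[OF p(1) ab(1)] projectionsD(3)[OF p(2)] by simp
    also have "\<dots> = mat_star a * (p * p) * b"
      using p(1) ab by (simp add: assoc_mult_mat[of _ 1 k _ k _ 1] assoc_mult_mat[of _ k k _ k _ 1]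
        assoc_mult_mat[of _ 1 k _ k _ k])
    finally show ?thesis using projectionsD(2)[OF p(2)] by simp
  qed
  then have xv: "x = (\<Sum>i<k. star (v a i) * v b i)"
  proof -
    have "(mat_star d * e) $$ (0, 0) = (\<Sum>i<k. star (d $$ (i, 0)) * e $$ (i, 0))"
      if "d \<in> carrier_mat k 1" "e \<in> carrier_mat k 1" for d e :: "'a mat"
      using that by (auto simp: scalar_prod_def atLeast0LessThan)
    from this[OF pd[OF ab(1)] pd[OF ab(2)]] show ?thesis
      by (simp add: x v_def \<open>mat_star a * p * b = mat_star (p * a) * (p * b)\<close>)
  qed
  \<comment> \<open>The scalar goes into the left column, conjugated because \<open>star\<close>
    conjugates it back.\<close>
  define a' where "a' i = cnj c *\<^sub>C v a i" for i
  have ap: "(\<Sum>j<k. p $$ (i, j) * a' j) = a' i" if "i < k" for i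
    using vp[OF ab(1) that] by (simp add: a'_def mult_scaleC_right flip: complex_vector.scale_sum_right)
  have cx: "c *\<^sub>C x = (\<Sum>i<k. star (a' i) * v b i)"
    by (simp add: xv a'_def star_scaleC mult_scaleC_left complex_vector.scale_sum_right)
  let ?ws = "a' # v b # ws"
  have eq: "(\<Sum>w\<leftarrow>?ws. \<Sum>i<k. star (w i) * w i) - ((c *\<^sub>C x + y) + star (c *\<^sub>C x + y)) =
    ((\<Sum>i<k. star (a' i) * a' i) + (\<Sum>i<k. star (v b i) * v b i) - (c *\<^sub>C x + star (c *\<^sub>C x)))
      + ((\<Sum>w\<leftarrow>ws. \<Sum>i<k. star (w i) * w i) - (y + star y))"
    by (simp add: star_add algebra_simps)
  have "pos ((\<Sum>i<k. star (a' i) * a' i) + (\<Sum>i<k. star (v b i) * v b i) - (c *\<^sub>C x + star (c *\<^sub>C x)))"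
    unfolding cx by (rule star_mult_add_le_squares)
  then have "pos ((\<Sum>w\<leftarrow>?ws. \<Sum>i<k. star (w i) * w i) - ((c *\<^sub>C x + y) + star (c *\<^sub>C x + y)))"
    unfolding eq using ws(2) by (rule pos_add)
  moreover have "\<forall>w\<in>set ?ws. \<forall>i<k. (\<Sum>j<k. p $$ (i, j) * w j) = w i"
    using ws(1) ap vp[OF ab(2)] by simp
  ultimately show ?case by blast
qed

lemma full_projection_frame:
  fixes p :: "'a::unital_cstar_algebra mat"
  assumes "full_projection k p"
  shows "\<exists>l (V :: nat \<Rightarrow> nat \<Rightarrow> 'a). (\<forall>b<l. \<forall>i<k. (\<Sum>j<k. p $$ (i, j) * V b j) = V b i) \<and>
    (\<Sum>b<l. \<Sum>i<k. star (V b i) * V b i) = 1"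
proof -
  let ?S = "complex_vector.span
       {(mat_star a * p * b) $$ (0, 0) | a b. a \<in> carrier_mat k 1 \<and> b \<in> carrier_mat k 1}"
  have p: "p \<in> carrier_mat k k" "p \<in> projections" "1 \<in> closure ?S"
    using assms by (auto simp: full_projection_def)
  \<comment> \<open>Distance below \<open>1/2\<close> gives \<open>norm e \<le> 1\<close>; as
    \<open>y + star y\<close> is \<open>2\<close> minus \<open>e\<close>, it is at least
    \<open>1\<close>, and so is \<open>s\<close>.\<close>
  obtain y where y: "y \<in> ?S" "dist y 1 < 1/2"
    using p(3)[unfolded closure_approachable, rule_format, of "1/2"] by auto
  obtain ws :: "(nat \<Rightarrow> 'a) list" where ws: "\<forall>w\<in>set ws. \<forall>i<k. (\<Sum>j<k. p $$ (i, j) * w j) = w i"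
    "pos ((\<Sum>w\<leftarrow>ws. \<Sum>i<k. star (w i) * w i) - (y + star y))"
    using full_projection_span_bound[OF p(1,2) y(1)] by blast
  define s where "s = (\<Sum>w\<leftarrow>ws. \<Sum>i<k. star (w i) * w i)"
  define e where "e = (1 - y) + star (1 - y)"
  have "norm e \<le> 1"
    using norm_triangle_ineq[of "1 - y" "star (1 - y)"] y(2)
    unfolding e_def norm_star by (simp add: dist_norm norm_minus_commute)
  moreover have "star e = e" by (simp add: e_def star_add star_star add.commute)
  ultimately have "pos (1 - e)" using pos_bound_minus[of e 1] by simp
  moreover have "pos (s - (y + star y))" using ws(2) by (simp add: s_def)
  ultimately have "pos ((1 - e) + (s - (y + star y)))" by (intro pos_add)
  moreover have "(1 - e) + (s - (y + star y)) = s - 1" by (simp add: e_def star_diff)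
  ultimately have "pos (s - 1)" by simp
  obtain g where g: "star g = g" "g * (1 *\<^sub>R 1 + (s - 1)) * g = 1"
    using inverse_sqrt[OF \<open>pos (s - 1)\<close>, of 1] by (metis less_numeral_extra(1))
  define V where "V b i = (ws ! b) i * g" for b i
  show ?thesis
  proof (intro exI[of _ "length ws"] exI[of _ V] conjI allI impI)
    fix b i assume "b < length ws" "i < k"
    then show "(\<Sum>j<k. p $$ (i, j) * V b j) = V b i"
      using ws(1) by (simp add: V_def flip: mult.assoc sum_distrib_right)
  next
    have "(\<Sum>b<length ws. \<Sum>i<k. star (V b i) * V b i)
        = (\<Sum>b<length ws. \<Sum>i<k. g * (star ((ws ! b) i) * (ws ! b) i) * g)"
      by (simp add: V_def star_mult g(1) mult.assoc)
    also have "\<dots> = g * s * g"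
      by (simp add: s_def sum_list_sum_nth atLeast0LessThan sum_distrib_left sum_distrib_right)
    finally show "(\<Sum>b<length ws. \<Sum>i<k. star (V b i) * V b i) = 1" using g(2) by simp
  qed
qed

section \<open>The corner algebra and the inverse homomorphism\<close>

lemma cornerI: "x \<in> carrier_mat k k \<Longrightarrow> p * x * p = x \<Longrightarrow> x \<in> corner k p"
  unfolding corner_def by (rule image_eqI[of _ _ x]) auto

lemma
  assumes p: "p \<in> carrier_mat k k" "p * p = p" and x: "x \<in> corner k p"
  shows corner_carrier: "x \<in> carrier_mat k k"
    and corner_absorb: "p * x = x" "x * p = x"
proof -
  obtain z where z: "z \<in> carrier_mat k k" "x = p * z * p" using x by (auto simp: corner_def)
  show "x \<in> carrier_mat k k" using p z by simp
  have "p * x = (p * p) * z * p"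
    using z p(1) by (simp add: assoc_mult_mat[of _ k k _ k _ k])
  then show "p * x = x" using z p by simp
  have "x * p = p * z * (p * p)"
    using z p(1) by (simp add: assoc_mult_mat[of _ k k _ k _ k])
  then show "x * p = x" using z p by simp
qed

lemma corner_rank_one:
  fixes p :: "'a::unital_cstar_algebra mat"
  assumes p: "p \<in> carrier_mat k k"
    and v: "\<And>i. i < k \<Longrightarrow> (\<Sum>j<k. p $$ (i, j) * v j) = v i"
    and w: "\<And>i. i < k \<Longrightarrow> (\<Sum>j<k. w j * p $$ (j, i)) = w i"
  shows "mat k k (\<lambda>(i, j). v i * a * w j) \<in> corner k p"
proof (rule cornerI)
  let ?x = "mat k k (\<lambda>(i, j). v i * a * w j)"
  have "p * ?x = ?x"
  proof (rule eq_matI)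
    fix i j assume ij: "i < dim_row ?x" "j < dim_col ?x"
    then have "(p * ?x) $$ (i, j) = (\<Sum>t<k. p $$ (i, t) * v t) * (a * w j)"
      using p by (auto simp: scalar_prod_def atLeast0LessThan sum_distrib_right mult.assoc)
    then show "(p * ?x) $$ (i, j) = ?x $$ (i, j)" using ij v by (simp add: mult.assoc)
  qed (use p in auto)
  moreover have "?x * p = ?x"
  proof (rule eq_matI)
    fix i j assume ij: "i < dim_row ?x" "j < dim_col ?x"
    then have "(?x * p) $$ (i, j) = v i * a * (\<Sum>t<k. w t * p $$ (t, j))"
      using p by (auto simp: scalar_prod_def atLeast0LessThan sum_distrib_left mult.assoc)
    then show "(?x * p) $$ (i, j) = ?x $$ (i, j)" using ij w by simp
  qed (use p in auto)
  ultimately show "p * ?x * p = ?x" by simp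
qed simp

text \<open>Recovering \<phi> through \<Psi> after \<Phi> takes only traciality and the frame
  identity \<open>V1\<close>. The opposite order needs elements of the algebra that carry a diagonal
  entry of \<open>\<Phi> x\<close> back to \<open>x\<close>; they are the
  \<open>G (S b i)\<close>.\<close>

theorem self_similar_pair_inverse:
  fixes p :: "'a::unital_cstar_algebra mat"
  assumes "self_similar_pair k p \<Phi>"
  obtains l \<Psi> where "mat_star_hom k \<Phi>" "mat_star_hom l \<Psi>"
    "\<And>\<phi> \<psi> a. pos_trace (blinfun_apply \<phi>) \<Longrightarrow> (\<And>a. blinfun_apply \<psi> a = trace_ext \<phi> (\<Phi> a)) \<Longrightarrow>
      trace_ext \<psi> (\<Psi> a) = blinfun_apply \<phi> a"
    "\<And>\<phi> \<psi> a. pos_trace (blinfun_apply \<phi>) \<Longrightarrow> (\<And>a. blinfun_apply \<psi> a = trace_ext \<phi> (\<Psi> a)) \<Longrightarrow>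
      trace_ext \<psi> (\<Phi> a) = blinfun_apply \<phi> a"
proof -
  have full: "full_projection k p" and iso: "star_isomorphism_onto_corner k p \<Phi>"
    using assms by (auto simp: self_similar_pair_def)
  have pc: "p \<in> carrier_mat k k" "p \<in> projections" using full by (auto simp: full_projection_def)
  note P = projectionsD(2,3)[OF pc(2)]
  have bij: "bij_betw \<Phi> UNIV (corner k p)" using iso by (simp add: star_isomorphism_onto_corner_def)
  then have inj: "inj \<Phi>" and range: "range \<Phi> = corner k p" by (auto simp: bij_betw_def)
  have \<Phi>c: "\<Phi> a \<in> corner k p" for a using range by blast
  have \<Phi>: "mat_star_hom k \<Phi>"
    using iso corner_carrier[OF pc(1) P(1) \<Phi>c]
    by (auto simp: mat_star_hom_def star_isomorphism_onto_corner_def)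
  note dim = mat_star_hom_dim[OF \<Phi>]
  have pstar: "star (p $$ (i, j)) = p $$ (j, i)" if "i < k" "j < k" for i j
    using arg_cong[OF P(2), of "\<lambda>x. x $$ (j, i)"] pc(1) that by simp
  have psum: "(\<Sum>t<k. p $$ (i, t) * p $$ (t, j)) = p $$ (i, j)" if "i < k" "j < k" for i j
    using arg_cong[OF P(1), of "\<lambda>x. x $$ (i, j)"] pc(1) that
    by (auto simp: scalar_prod_def atLeast0LessThan)
  have \<Phi>1: "\<Phi> 1 = p"
  proof -
    have "p * p * p = p" using P by simp
    then obtain e where e: "\<Phi> e = p" using cornerI[OF pc(1), of p] range by (metis imageE)
    have "\<Phi> 1 = \<Phi> 1 * p" using corner_absorb(2)[OF pc(1) P(1) \<Phi>c] by simp
    also have "\<dots> = \<Phi> (1 * e)" by (simp only: mat_star_hom_mult[OF \<Phi>] e)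
    finally show ?thesis by (simp add: e)
  qed
  define G where "G = inv_into UNIV \<Phi>"
  have \<Phi>G: "\<Phi> (G x) = x" if "x \<in> corner k p" for x
    unfolding G_def using that range by (metis f_inv_into_f)
  have eqI: "a = b" if "\<And>i j. i < k \<Longrightarrow> j < k \<Longrightarrow> \<Phi> a $$ (i, j) = \<Phi> b $$ (i, j)" for a b
    by (rule injD[OF inj], rule eq_matI) (use that dim in auto)
  obtain l and V :: "nat \<Rightarrow> nat \<Rightarrow> 'a" where
    V: "\<And>b i. b < l \<Longrightarrow> i < k \<Longrightarrow> (\<Sum>j<k. p $$ (i, j) * V b j) = V b i"
    and V1: "(\<Sum>b<l. \<Sum>i<k. star (V b i) * V b i) = 1"
    using full_projection_frame[OF full] by blast
  have Vs: "(\<Sum>j<k. star (V b j) * p $$ (j, i)) = star (V b i)" if "b < l" "i < k" for b i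
    using arg_cong[OF V[OF that], of star] that pstar by (simp add: star_sum star_mult)
  define R where "R b a c = mat k k (\<lambda>(i, j). V b i * a * star (V c j))" for b c and a :: 'a
  have Rc: "R b a c \<in> corner k p" if "b < l" "c < l" for a b c
    unfolding R_def by (rule corner_rank_one[OF pc(1) V Vs]) (use that in auto)
  have \<Phi>GR: "\<Phi> (G (R b a c)) $$ (i, j) = V b i * a * star (V c j)"
    if "b < l" "c < l" "i < k" "j < k" for a b c i j
    using \<Phi>G[OF Rc[OF that(1,2)]] that by (simp add: R_def)
  define \<Psi> where "\<Psi> a = mat l l (\<lambda>(b, c). G (R b a c))" for a
  have \<Psi>: "mat_star_hom l \<Psi>"
    unfolding mat_star_hom_def
  proof (intro conjI allI)
    show "\<Psi> a \<in> carrier_mat l l" for a by (simp add: \<Psi>_def)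
    show "\<Psi> (a + a') = \<Psi> a + \<Psi> a'" for a a'
    proof (rule eq_matI)
      fix b c assume "b < dim_row (\<Psi> a + \<Psi> a')" "c < dim_col (\<Psi> a + \<Psi> a')"
      then have bc: "b < l" "c < l" by (simp_all add: \<Psi>_def)
      have "G (R b (a + a') c) = G (R b a c) + G (R b a' c)"
        by (rule eqI) (simp add: mat_star_hom_add[OF \<Phi>] dim \<Phi>GR bc distrib_left distrib_right)
      then show "\<Psi> (a + a') $$ (b, c) = (\<Psi> a + \<Psi> a') $$ (b, c)" using bc by (simp add: \<Psi>_def)
    qed (simp_all add: \<Psi>_def)
    show "\<Psi> (z *\<^sub>C a) = map_mat (scaleC z) (\<Psi> a)" for z a
    proof (rule eq_matI)
      fix b c assume "b < dim_row (map_mat (scaleC z) (\<Psi> a))" "c < dim_col (map_mat (scaleC z) (\<Psi> a))"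
      then have bc: "b < l" "c < l" by (simp_all add: \<Psi>_def)
      have "G (R b (z *\<^sub>C a) c) = z *\<^sub>C G (R b a c)"
        by (rule eqI) (simp add: mat_star_hom_scaleC[OF \<Phi>] dim \<Phi>GR bc mult_scaleC_left mult_scaleC_right)
      then show "\<Psi> (z *\<^sub>C a) $$ (b, c) = map_mat (scaleC z) (\<Psi> a) $$ (b, c)" using bc by (simp add: \<Psi>_def)
    qed (simp_all add: \<Psi>_def)
    show "\<Psi> (a * a') = \<Psi> a * \<Psi> a'" for a a'
    proof (rule eq_matI)
      fix b c assume "b < dim_row (\<Psi> a * \<Psi> a')" "c < dim_col (\<Psi> a * \<Psi> a')"
      then have bc: "b < l" "c < l" by (simp_all add: \<Psi>_def)
      \<comment> \<open>Compared through the injective \<Phi>, where the frame identity collapses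
        the inner double sum to \<open>1\<close>.\<close>
      have "G (R b (a * a') c) = (\<Sum>e<l. G (R b a e) * G (R e a' c))"
      proof (rule eqI)
        fix i j assume ij: "i < k" "j < k"
        have "\<Phi> (\<Sum>e<l. G (R b a e) * G (R e a' c)) $$ (i, j) =
          (\<Sum>e<l. \<Sum>t<k. V b i * a * star (V e t) * (V e t * a' * star (V c j)))"
          using ij bc by (simp add: mat_star_hom_sum[OF \<Phi>] mat_star_hom_mult[OF \<Phi>] dim scalar_prod_def
              atLeast0LessThan \<Phi>GR)
        also have "\<dots> = V b i * a * (\<Sum>e<l. \<Sum>t<k. star (V e t) * V e t) * (a' * star (V c j))"
          by (simp add: sum_distrib_left sum_distrib_right mult.assoc)
        finally show "\<Phi> (G (R b (a * a') c)) $$ (i, j) = \<Phi> (\<Sum>e<l. G (R b a e) * G (R e a' c)) $$ (i, j)"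
          using ij bc by (simp add: V1 \<Phi>GR mult.assoc)
      qed
      then show "\<Psi> (a * a') $$ (b, c) = (\<Psi> a * \<Psi> a') $$ (b, c)"
        using bc by (simp add: \<Psi>_def scalar_prod_def atLeast0LessThan)
    qed (simp_all add: \<Psi>_def)
    show "\<Psi> (star a) = mat_star (\<Psi> a)" for a
    proof (rule eq_matI)
      fix b c assume "b < dim_row (mat_star (\<Psi> a))" "c < dim_col (mat_star (\<Psi> a))"
      then have bc: "b < l" "c < l" by (simp_all add: \<Psi>_def)
      have "G (R b (star a) c) = star (G (R c a b))"
        by (rule eqI) (simp add: mat_star_hom_star[OF \<Phi>] dim \<Phi>GR bc star_mult star_star mult.assoc)
      then show "\<Psi> (star a) $$ (b, c) = mat_star (\<Psi> a) $$ (b, c)" using bc by (simp add: \<Psi>_def)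
    qed (simp_all add: \<Psi>_def)
  qed
  show thesis
  proof (rule that[OF \<Phi> \<Psi>])
    fix \<phi> \<psi> :: "'a \<Rightarrow>\<^sub>L complex" and a
    assume \<phi>: "pos_trace (blinfun_apply \<phi>)" and \<psi>: "\<And>a. blinfun_apply \<psi> a = trace_ext \<phi> (\<Phi> a)"
    note \<phi>f = pos_trace_functional[OF \<phi>]
    have "trace_ext \<psi> (\<Psi> a) = (\<Sum>b<l. \<Sum>i<k. \<phi> (V b i * (a * star (V b i))))"
      by (simp add: trace_ext_def[of \<psi>] \<psi> \<Psi>_def trace_ext_def[of \<phi>] dim \<Phi>GR mult.assoc)
    also have "\<dots> = (\<Sum>b<l. \<Sum>i<k. \<phi> (a * (star (V b i) * V b i)))"
      by (simp add: pos_trace_commute[OF \<phi>, of "V _ _"] mult.assoc)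
    also have "\<dots> = \<phi> (a * (\<Sum>b<l. \<Sum>i<k. star (V b i) * V b i))"
      by (simp add: sum_distrib_left pos_functional_sum[OF \<phi>f])
    finally show "trace_ext \<psi> (\<Psi> a) = blinfun_apply \<phi> a" by (simp add: V1)
  next
    fix \<phi> \<psi> :: "'a \<Rightarrow>\<^sub>L complex" and x
    assume \<phi>: "pos_trace (blinfun_apply \<phi>)" and \<psi>: "\<And>a. blinfun_apply \<psi> a = trace_ext \<phi> (\<Psi> a)"
    note \<phi>f = pos_trace_functional[OF \<phi>]
    \<comment> \<open>The column \<open>V b\<close> times row \<open>i\<close> of \<open>p\<close>.
      Since \<open>\<Phi> x\<close> is unchanged by \<open>p\<close> on both sides, sandwiching it
      between \<open>S b i\<close> and its adjoint gives the rank-one matrix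
      \<open>R b (\<Phi> x $$ (i, i)) b\<close>.\<close>
    define S where "S b i = mat k k (\<lambda>(r, s). V b r * 1 * p $$ (i, s))" for b i
    have Sc: "S b i \<in> corner k p" if "b < l" "i < k" for b i
      unfolding S_def by (rule corner_rank_one[OF pc(1) V]) (use that psum in auto)
    have \<Phi>GS: "\<Phi> (G (S b i)) $$ (r, s) = V b r * p $$ (i, s)"
      if "b < l" "i < k" "r < k" "s < k" for b i r s
      using \<Phi>G[OF Sc[OF that(1,2)]] that by (simp add: S_def)
    have conj: "G (R b (\<Phi> x $$ (i, i)) b) = G (S b i) * (x * star (G (S b i)))" if bi: "b < l" "i < k" for b i
    proof (rule eqI)
      fix r s assume rs: "r < k" "s < k"
      have "\<Phi> x $$ (i, i) = (p * (\<Phi> x * p)) $$ (i, i)"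
        using corner_absorb[OF pc(1) P(1) \<Phi>c] by simp
      also have "\<dots> = (\<Sum>u<k. p $$ (i, u) * (\<Sum>v<k. \<Phi> x $$ (u, v) * p $$ (v, i)))"
        using pc(1) mat_star_hom_carrier[OF \<Phi>] dim bi by (auto simp: scalar_prod_def atLeast0LessThan)
      finally have xi: "\<Phi> x $$ (i, i) = (\<Sum>u<k. p $$ (i, u) * (\<Sum>v<k. \<Phi> x $$ (u, v) * p $$ (v, i)))" .
      have "\<Phi> (G (S b i) * (x * star (G (S b i)))) $$ (r, s) =
        (\<Sum>u<k. V b r * p $$ (i, u) * (\<Sum>v<k. \<Phi> x $$ (u, v) * star (V b s * p $$ (i, v))))"
        using bi rs by (simp add: mat_star_hom_mult[OF \<Phi>] mat_star_hom_star[OF \<Phi>] dim \<Phi>GS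
            scalar_prod_def atLeast0LessThan)
      also have "\<dots> = V b r * (\<Sum>u<k. p $$ (i, u) * (\<Sum>v<k. \<Phi> x $$ (u, v) * p $$ (v, i))) * star (V b s)"
        using bi by (simp add: star_mult pstar sum_distrib_left sum_distrib_right mult.assoc)
      finally show "\<Phi> (G (R b (\<Phi> x $$ (i, i)) b)) $$ (r, s) = \<Phi> (G (S b i) * (x * star (G (S b i)))) $$ (r, s)"
        using bi rs by (simp add: \<Phi>GR flip: xi)
    qed
    \<comment> \<open>Under \<Phi> the frame identity removes the columns and leaves
      \<open>p * p = p\<close>, which is \<open>\<Phi> 1\<close>.\<close>
    have one: "(\<Sum>i<k. \<Sum>b<l. star (G (S b i)) * G (S b i)) = 1"
    proof (rule eqI)
      fix r s assume rs: "r < k" "s < k"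
      have "\<Phi> (\<Sum>i<k. \<Sum>b<l. star (G (S b i)) * G (S b i)) $$ (r, s) =
        (\<Sum>i<k. \<Sum>b<l. \<Sum>t<k. star (V b t * p $$ (i, r)) * (V b t * p $$ (i, s)))"
        using rs by (simp add: mat_star_hom_sum[OF \<Phi>] mat_star_hom_mult[OF \<Phi>] mat_star_hom_star[OF \<Phi>] dim
            scalar_prod_def atLeast0LessThan \<Phi>GS)
      also have "\<dots> = (\<Sum>i<k. p $$ (r, i) * (\<Sum>b<l. \<Sum>t<k. star (V b t) * V b t) * p $$ (i, s))"
        using rs by (simp add: star_mult pstar sum_distrib_left sum_distrib_right mult.assoc)
      also have "\<dots> = p $$ (r, s)" using rs psum by (simp add: V1)
      finally show "\<Phi> (\<Sum>i<k. \<Sum>b<l. star (G (S b i)) * G (S b i)) $$ (r, s) = \<Phi> 1 $$ (r, s)"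
        by (simp add: \<Phi>1)
    qed
    have "trace_ext \<psi> (\<Phi> x) = (\<Sum>i<k. \<Sum>b<l. \<phi> (G (S b i) * (x * star (G (S b i)))))"
      by (simp add: trace_ext_def[of \<psi>] \<psi> trace_ext_def[of \<phi>] \<Psi>_def dim conj)
    also have "\<dots> = (\<Sum>i<k. \<Sum>b<l. \<phi> (x * (star (G (S b i)) * G (S b i))))"
      by (simp add: pos_trace_commute[OF \<phi>, of "G _"] mult.assoc)
    also have "\<dots> = \<phi> (x * (\<Sum>i<k. \<Sum>b<l. star (G (S b i)) * G (S b i)))"
      by (simp add: sum_distrib_left pos_functional_sum[OF \<phi>f])
    finally show "trace_ext \<psi> (\<Phi> x) = blinfun_apply \<phi> x" by (simp add: one)
  qed
qed

section \<open>Images of extreme rays and the shape of the matrix\<close>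

lemma trace_ext_blinfun:
  fixes \<phi> :: "'a::unital_cstar_algebra \<Rightarrow>\<^sub>L complex"
  assumes "pos_trace (blinfun_apply \<phi>)" "mat_star_hom k F"
  shows "\<exists>\<psi>. pos_trace (blinfun_apply \<psi>) \<and> (\<forall>a. blinfun_apply \<psi> a = trace_ext \<phi> (F a))"
proof -
  note pt = pos_trace_trace_ext[OF assms]
  have "blinfun_apply (Blinfun (\<lambda>a. trace_ext \<phi> (F a))) = (\<lambda>a. trace_ext \<phi> (F a))"
    by (rule pos_functional_Blinfun[OF pos_trace_functional[OF pt]])
  then show ?thesis using pt by (metis (no_types, lifting))
qed

text \<open>If \<xi> is a proper convex combination involving \<alpha>, then \<Psi> sends \<alpha>
  below a multiple of \<phi>, hence onto its ray. Returning by \<Phi> makes \<alpha> a multiple of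
  \<xi>, and the value at \<open>1\<close> makes them equal.\<close>

lemma extreme_trace_ray_image:
  fixes \<phi> :: "'a::unital_cstar_algebra \<Rightarrow>\<^sub>L complex"
  assumes \<Phi>: "mat_star_hom k \<Phi>" and \<Psi>: "mat_star_hom l \<Psi>"
    and \<Psi>\<Phi>: "\<And>\<phi> \<psi> a. pos_trace (blinfun_apply \<phi>) \<Longrightarrow> (\<And>a. blinfun_apply \<psi> a = trace_ext \<phi> (\<Phi> a)) \<Longrightarrow>
      trace_ext \<psi> (\<Psi> a) = blinfun_apply \<phi> a"
    and \<Phi>\<Psi>: "\<And>\<phi> \<psi> a. pos_trace (blinfun_apply \<phi>) \<Longrightarrow> (\<And>a. blinfun_apply \<psi> a = trace_ext \<phi> (\<Psi> a)) \<Longrightarrow>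
      trace_ext \<psi> (\<Phi> a) = blinfun_apply \<phi> a"
    and \<phi>: "\<phi> \<in> extreme_traces"
  obtains \<xi> d where "\<xi> \<in> extreme_traces" "0 < d"
    "\<And>a. trace_ext \<phi> (\<Phi> a) = of_real d * blinfun_apply \<xi> a"
proof -
  have tr: "pos_trace (blinfun_apply \<phi>)" "blinfun_apply \<phi> 1 = 1"
    using extreme_traces_states[OF \<phi>] by (auto simp: tracial_states_iff)
  obtain T where T: "pos_trace (blinfun_apply T)" "\<And>a. blinfun_apply T a = trace_ext \<phi> (\<Phi> a)"
    using trace_ext_blinfun[OF tr(1) \<Phi>] by blast
  have T\<Psi>: "trace_ext T (\<Psi> a) = blinfun_apply \<phi> a" for a
    by (rule \<Psi>\<Phi>[OF tr(1) T(2)])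
  define d where "d = Re (T 1)"
  have d: "T 1 = of_real d" "0 \<le> d"
    unfolding d_def using pos_functional_one(1,2)[OF pos_trace_functional[OF T(1)]] by blast+
  have "d \<noteq> 0"
  proof
    assume "d = 0"
    then have "blinfun_apply T a = 0" for a using pos_trace_eq_zero[OF T(1)] d by simp
    then have "trace_ext T (\<Psi> 1) = 0" by (simp add: trace_ext_def)
    then show False using T\<Psi>[of 1] tr(2) by simp
  qed
  then obtain \<xi> where \<xi>: "\<xi> \<in> tracial_states" "\<And>a. T a = of_real d * blinfun_apply \<xi> a"
    using normalized_tracial_state[OF T(1)] d by (metis of_real_eq_0_iff)
  have sum_ray: "\<alpha> = \<xi>"
    if \<alpha>: "\<alpha> \<in> tracial_states" and \<beta>: "\<beta> \<in> tracial_states" and u: "0 < u" "u < 1"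
      and eq: "\<xi> = (1 - u) *\<^sub>R \<alpha> + u *\<^sub>R \<beta>" for \<alpha> \<beta> u
  proof -
    have pos\<alpha>: "pos_trace (blinfun_apply \<alpha>)" and pos\<beta>: "pos_trace (blinfun_apply \<beta>)"
      using \<alpha> \<beta> by (auto simp: tracial_states_iff)
    note A = pos_trace_trace_ext[OF pos\<alpha> \<Psi>] and A' = pos_trace_trace_ext[OF pos\<beta> \<Psi>]
    have "of_real (1 / d) * blinfun_apply \<phi> a = trace_ext \<xi> (\<Psi> a)" for a
      unfolding T\<Psi>[symmetric] using \<open>d \<noteq> 0\<close> by (simp add: trace_ext_def \<xi>(2) sum_distrib_left)
    also have "trace_ext \<xi> (\<Psi> a) =
        of_real (1 - u) * trace_ext \<alpha> (\<Psi> a) + of_real u * trace_ext \<beta> (\<Psi> a)" for a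
      by (simp add: trace_ext_def eq blinfun.add_left blinfun.scaleR_left scaleR_conv_of_real
          sum.distrib sum_distrib_left)
    finally have split: "of_real (1 / d) * blinfun_apply \<phi> a =
        of_real (1 - u) * trace_ext \<alpha> (\<Psi> a) + of_real u * trace_ext \<beta> (\<Psi> a)" for a .
    \<comment> \<open>The image of \<xi> under \<Psi> is \<phi> scaled by \<open>1 / d\<close>, so
      dividing the convex combination by the weight \<open>1 - u\<close> of \<alpha> gives this
      factor.\<close>
    define r where "r = 1 / (d * (1 - u))"
    have "of_real r * blinfun_apply \<phi> a - trace_ext \<alpha> (\<Psi> a) = of_real (u / (1 - u)) * trace_ext \<beta> (\<Psi> a)" for a
    proof -
      have "of_real r * blinfun_apply \<phi> a = of_real (1 / (1 - u)) * (of_real (1 / d) * blinfun_apply \<phi> a)"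
        by (simp add: r_def)
      also have "\<dots> = (of_real (1 / (1 - u)) * of_real (1 - u)) * trace_ext \<alpha> (\<Psi> a)
          + (of_real (1 / (1 - u)) * of_real u) * trace_ext \<beta> (\<Psi> a)"
        unfolding split by (simp only: distrib_left mult.assoc)
      also have "\<dots> = trace_ext \<alpha> (\<Psi> a) + of_real (u / (1 - u)) * trace_ext \<beta> (\<Psi> a)"
        using u unfolding of_real_mult[symmetric] by simp
      finally show ?thesis by simp
    qed
    moreover have "pos_trace (\<lambda>a. of_real (u / (1 - u)) * trace_ext \<beta> (\<Psi> a))"
      using u by (intro pos_trace_scale A') auto
    ultimately have "pos_trace (\<lambda>a. of_real r * blinfun_apply \<phi> a - trace_ext \<alpha> (\<Psi> a))" by simp
    then have "trace_ext \<alpha> (\<Psi> a) = trace_ext \<alpha> (\<Psi> 1) * blinfun_apply \<phi> a" for a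
      by (rule extreme_trace_ray[OF \<phi> A])
    then obtain c where \<alpha>\<Psi>: "\<And>a. trace_ext \<alpha> (\<Psi> a) = c * blinfun_apply \<phi> a" by blast
    obtain \<eta> where \<eta>: "\<And>a. blinfun_apply \<eta> a = trace_ext \<alpha> (\<Psi> a)" using trace_ext_blinfun[OF pos\<alpha> \<Psi>] by blast
    have "blinfun_apply \<alpha> a = c * blinfun_apply T a" for a
      using \<Phi>\<Psi>[OF pos\<alpha> \<eta>, of a]
      by (simp add: T(2) trace_ext_def[of \<eta>] trace_ext_def[of \<phi>] \<eta> \<alpha>\<Psi> sum_distrib_left)
    then have *: "blinfun_apply \<alpha> a = c * of_real d * blinfun_apply \<xi> a" for a
      by (simp add: \<xi>(2))
    from *[of 1] have "c * of_real d = 1"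
      using \<alpha> \<xi>(1) by (simp add: tracial_states_iff)
    then show ?thesis using * by (intro blinfun_eqI) simp
  qed
  have "\<xi> \<in> extreme_traces"
    unfolding extreme_traces_def extreme_point_of_def
  proof (intro CollectI conjI ballI notI \<xi>(1))
    fix \<alpha> \<beta> assume ab: "\<alpha> \<in> tracial_states" "\<beta> \<in> tracial_states" "\<xi> \<in> open_segment \<alpha> \<beta>"
    then obtain u where u: "\<alpha> \<noteq> \<beta>" "0 < u" "u < 1" "\<xi> = (1 - u) *\<^sub>R \<alpha> + u *\<^sub>R \<beta>"
      by (auto simp: in_segment)
    have "\<alpha> = \<xi>" by (rule sum_ray[OF ab(1,2) u(2-4)])
    moreover have "\<beta> = \<xi>"
      by (rule sum_ray[OF ab(2,1), of "1 - u"]) (use u in \<open>auto simp: add.commute\<close>)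
    ultimately show False using u(1) by simp
  qed
  then show thesis using that[of \<xi> d] \<xi>(2) T(2) d \<open>d \<noteq> 0\<close> by simp
qed

theorem proposition4p6:
  fixes n :: nat
    and \<phi> :: "nat \<Rightarrow> 'a::unital_cstar_algebra \<Rightarrow>\<^sub>L complex"
    and B :: "complex mat"
  assumes "finite_dim_functionals (bounded_traces :: ('a \<Rightarrow>\<^sub>L complex) set)"
    and "bij_betw \<phi> {..<n} extreme_traces"
    and "B \<in> fundamental_group n \<phi>"
  shows "\<exists>(D :: real mat) \<sigma>.
     D \<in> carrier_mat n n \<and> (\<forall>i<n. \<forall>j<n. 0 \<le> D $$ (i, j)) \<and>
     diagonal_mat D \<and> invertible_mat D \<and> \<sigma> permutes {..<n} \<and>
     B = map_mat complex_of_real D * perm_matrix n \<sigma> \<and>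
     (\<forall>i<n. (\<lambda>x. D $$ (i, i) * x) ` range (K0_hom (\<phi> i)) = range (K0_hom (\<phi> (\<sigma> i))))"
proof -
  have ext: "\<phi> i \<in> extreme_traces" if "i < n" for i
    using assms(2) that by (auto simp: bij_betw_def)
  have inj: "inj_on \<phi> {..<n}" and surj: "\<phi> ` {..<n} = extreme_traces"
    using assms(2) by (auto simp: bij_betw_def)
  have tr: "pos_trace (blinfun_apply (\<phi> i))" "blinfun_apply (\<phi> i) 1 = 1" if "i < n" for i
    using extreme_traces_states[OF ext[OF that]] by (auto simp: tracial_states_iff)
  obtain k p \<Phi> where B: "B \<in> carrier_mat n n" and pair: "self_similar_pair k p \<Phi>"
    and TB: "\<And>j a. j < n \<Longrightarrow> trace_ext (\<phi> j) (\<Phi> a) = (\<Sum>i<n. B $$ (i, j) * blinfun_apply (\<phi> i) a)"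
    using assms(3) unfolding fundamental_group_def self_similar_map_def by auto
  obtain l \<Psi> where \<Phi>: "mat_star_hom k \<Phi>" and \<Psi>: "mat_star_hom l \<Psi>"
    and \<Psi>\<Phi>: "\<And>\<phi> \<psi> a. pos_trace (blinfun_apply \<phi>) \<Longrightarrow> (\<And>a. blinfun_apply \<psi> a = trace_ext \<phi> (\<Phi> a)) \<Longrightarrow>
      trace_ext \<psi> (\<Psi> a) = blinfun_apply \<phi> a"
    and \<Phi>\<Psi>: "\<And>\<phi> \<psi> a. pos_trace (blinfun_apply \<phi>) \<Longrightarrow> (\<And>a. blinfun_apply \<psi> a = trace_ext \<phi> (\<Psi> a)) \<Longrightarrow>
      trace_ext \<psi> (\<Phi> a) = blinfun_apply \<phi> a"
    using self_similar_pair_inverse[OF pair] by metis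
  have ray: "\<exists>i<n. \<exists>d>0. \<forall>a. trace_ext (\<phi> j) (\<Phi> a) = of_real d * blinfun_apply (\<phi> i) a" if j: "j < n" for j
  proof -
    obtain \<xi> d where "\<xi> \<in> extreme_traces" "0 < d"
      "\<And>a. trace_ext (\<phi> j) (\<Phi> a) = of_real d * blinfun_apply \<xi> a"
      using extreme_trace_ray_image[OF \<Phi> \<Psi> \<Psi>\<Phi> \<Phi>\<Psi> ext[OF j]] by metis
    then show ?thesis using surj by (metis imageE lessThan_iff)
  qed
  obtain \<pi> d where \<pi>: "\<And>j. j < n \<Longrightarrow> \<pi> j < n" and d: "\<And>j. j < n \<Longrightarrow> 0 < (d j :: real)"
    and T: "\<And>j a. j < n \<Longrightarrow> trace_ext (\<phi> j) (\<Phi> a) = of_real (d j) * blinfun_apply (\<phi> (\<pi> j)) a"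
    using ray by metis
  have T': "trace_ext (\<phi> (\<pi> j)) (\<Psi> a) = of_real (1 / d j) * blinfun_apply (\<phi> j) a" if j: "j < n" for j a
  proof -
    obtain S where S: "\<And>a. blinfun_apply S a = trace_ext (\<phi> j) (\<Phi> a)" using trace_ext_blinfun[OF tr(1)[OF j] \<Phi>] by blast
    have "of_real (d j) * trace_ext (\<phi> (\<pi> j)) (\<Psi> a) = trace_ext S (\<Psi> a)"
      by (simp add: trace_ext_def[of S] S T[OF j] trace_ext_def[of "\<phi> (\<pi> j)"] sum_distrib_left)
    also have "\<dots> = blinfun_apply (\<phi> j) a" by (rule \<Psi>\<Phi>[OF tr(1)[OF j] S])
    finally show ?thesis using d[OF j] by (simp add: field_simps)
  qed
  \<comment> \<open>By \<open>T'\<close>, the index \<open>\<pi> j\<close> determines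
    \<open>\<phi> j\<close> up to a scalar, which the value at \<open>1\<close> fixes.\<close>
  have inj_\<pi>: "inj_on \<pi> {..<n}"
  proof (rule inj_onI)
    fix j j' assume j: "j \<in> {..<n}" "j' \<in> {..<n}" and eq: "\<pi> j = \<pi> j'"
    then have *: "of_real (1 / d j) * blinfun_apply (\<phi> j) a = of_real (1 / d j') * blinfun_apply (\<phi> j') a" for a
      using T'[of j a] T'[of j' a] by simp
    have "1 / d j = 1 / d j'" using *[of 1] j tr(2)
      by (simp only: lessThan_iff mult_1_right of_real_eq_iff)
    with * d[of j] d[of j'] j have "blinfun_apply (\<phi> j) a = blinfun_apply (\<phi> j') a" for a by simp
    then have "\<phi> j = \<phi> j'" by (rule blinfun_eqI)
    then show "j = j'" using inj j by (auto dest: inj_onD)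
  qed
  \<comment> \<open>Extended by the identity, as \<open>permutes\<close> requires.\<close>
  define \<pi>' where "\<pi>' j = (if j < n then \<pi> j else j)" for j
  have "bij_betw \<pi>' {..<n} {..<n}"
  proof -
    have "\<pi>' ` {..<n} \<subseteq> {..<n}" "inj_on \<pi>' {..<n}"
      using \<pi> inj_\<pi> by (auto simp: \<pi>'_def inj_on_def)
    then show ?thesis by (simp add: bij_betw_def endo_inj_surj)
  qed
  then have perm: "\<pi>' permutes {..<n}" by (rule bij_imp_permutes) (simp add: \<pi>'_def)
  \<comment> \<open>Column \<open>j\<close> of \<open>B\<close> has its nonzero entry in row
    \<open>\<pi> j\<close>, whereas row \<open>i\<close> of \<open>perm_matrix n \<sigma>\<close>
    has its \<open>1\<close> in column \<open>\<sigma> i\<close>; hence the inverse.\<close>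
  define \<sigma> where "\<sigma> = inv_into UNIV \<pi>'"
  have \<sigma>: "\<sigma> permutes {..<n}" unfolding \<sigma>_def by (rule permutes_inv[OF perm])
  have \<sigma>n: "\<sigma> i < n" if "i < n" for i using permutes_in_image[OF \<sigma>] that by simp
  have \<pi>\<sigma>: "\<pi> (\<sigma> i) = i" if "i < n" for i
  proof -
    have "\<pi>' (\<sigma> i) = i" unfolding \<sigma>_def by (rule permutes_inverses(1)[OF perm])
    then show ?thesis using \<sigma>n[OF that] by (simp add: \<pi>'_def)
  qed
  have \<sigma>\<pi>: "\<sigma> i = j \<longleftrightarrow> i = \<pi> j" if "i < n" "j < n" for i j
    using \<pi>\<sigma>[OF that(1)] permutes_inverses(2)[OF perm, of j] that by (auto simp: \<sigma>_def \<pi>'_def)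
  have Bij: "B $$ (i, j) = (if i = \<pi> j then of_real (d j) else 0)" if ij: "i < n" "j < n" for i j
  proof -
    \<comment> \<open>Both expressions expand the same trace in the extreme traces, so the
      differences of coefficients form a linear relation.\<close>
    define c where "c i = B $$ (i, j) - (if i = \<pi> j then of_real (d j) else 0)" for i
    have "(\<Sum>i<n. c i * blinfun_apply (\<phi> i) a) = 0" for a
    proof -
      have "(\<Sum>i<n. (if i = \<pi> j then of_real (d j) else 0) * blinfun_apply (\<phi> i) a)
          = (\<Sum>i<n. if i = \<pi> j then of_real (d j) * blinfun_apply (\<phi> i) a else 0)"
        by (intro sum.cong) auto
      also have "\<dots> = of_real (d j) * blinfun_apply (\<phi> (\<pi> j)) a" using \<pi>[OF ij(2)] by simp
      finally show ?thesis
        using TB[OF ij(2), of a] T[OF ij(2), of a] by (simp add: c_def left_diff_distrib sum_subtractf)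
    qed
    then have "c i = 0"
      using extreme_traces_independent[of "{..<n}" \<phi> c i] inj ext ij by simp
    then show ?thesis by (simp add: c_def)
  qed
  \<comment> \<open>Row \<open>i\<close> of \<open>B\<close> meets its nonzero entry in column
    \<open>\<sigma> i\<close>, whose scale is \<open>d (\<sigma> i)\<close>.\<close>
  define D where "D = mat n n (\<lambda>(i, j). if i = j then d (\<sigma> i) else 0)"
  define D' where "D' = mat n n (\<lambda>(i, j). if i = j then 1 / d (\<sigma> i) else 0)"
  have D: "D \<in> carrier_mat n n" "D' \<in> carrier_mat n n" by (simp_all add: D_def D'_def)
  have diag: "(\<Sum>t<n. (if i = t then x else 0) * y t) = x * y i" if "i < n" for i and x :: "'c::semiring_0" and y
    using that by (simp add: if_distrib[of "\<lambda>z. z * _"] cong: if_cong)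
  show ?thesis
  proof (intro exI[of _ D] exI[of _ \<sigma>] conjI D(1) \<sigma> allI impI)
    show "0 \<le> D $$ (i, j)" if "i < n" "j < n" for i j
      using that d[OF \<sigma>n[OF that(1)]] by (auto simp: D_def)
    show "diagonal_mat D" by (auto simp: diagonal_mat_def D_def)
    have diag_inv: "mat n n (\<lambda>(i, j). if i = j then x i else 0) * mat n n (\<lambda>(i, j). if i = j then y i else 0) = 1\<^sub>m n"
      if xy: "\<And>i. i < n \<Longrightarrow> x i * y i = 1" for x y :: "nat \<Rightarrow> real"
    proof (rule eq_matI)
      fix i j assume "i < dim_row (1\<^sub>m n)" "j < dim_col (1\<^sub>m n)"
      then have ij: "i < n" "j < n" by simp_all
      have "(mat n n (\<lambda>(i, j). if i = j then x i else 0) * mat n n (\<lambda>(i, j). if i = j then y i else 0)) $$ (i, j)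
          = (\<Sum>t<n. (if i = t then x i else 0) * (if t = j then y t else 0))"
        using ij by (simp add: scalar_prod_def atLeast0LessThan)
      also have "\<dots> = x i * (if i = j then y i else 0)" by (rule diag[OF ij(1)])
      finally show "(mat n n (\<lambda>(i, j). if i = j then x i else 0) * mat n n (\<lambda>(i, j). if i = j then y i else 0)) $$ (i, j)
          = 1\<^sub>m n $$ (i, j)" using ij xy by simp
    qed simp_all
    have "d (\<sigma> i) \<noteq> 0" if "i < n" for i using d[OF \<sigma>n[OF that]] by simp
    then have "D * D' = 1\<^sub>m n" "D' * D = 1\<^sub>m n" unfolding D_def D'_def by (intro diag_inv; simp)+
    then show "invertible_mat D" using D by (auto simp: invertible_mat_def inverts_mat_def)
    show "B = map_mat complex_of_real D * perm_matrix n \<sigma>"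
    proof (rule eq_matI)
      fix i j assume "i < dim_row (map_mat complex_of_real D * perm_matrix n \<sigma>)"
        "j < dim_col (map_mat complex_of_real D * perm_matrix n \<sigma>)"
      then have ij: "i < n" "j < n" by (simp_all add: D_def perm_matrix_def)
      have "(map_mat complex_of_real D * perm_matrix n \<sigma>) $$ (i, j)
          = (\<Sum>t<n. (if i = t then of_real (d (\<sigma> i)) else 0) * (if j = \<sigma> t then 1 else 0))"
        using ij by (auto simp: D_def perm_matrix_def scalar_prod_def atLeast0LessThan intro!: sum.cong)
      also have "\<dots> = of_real (d (\<sigma> i)) * (if j = \<sigma> i then 1 else 0)" by (rule diag[OF ij(1)])
      also have "\<dots> = B $$ (i, j)" using Bij[OF ij] \<sigma>\<pi>[OF ij] by auto
      finally show "B $$ (i, j) = (map_mat complex_of_real D * perm_matrix n \<sigma>) $$ (i, j)" by simp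
    qed (use B in \<open>auto simp: D_def perm_matrix_def\<close>)
    show "(\<lambda>x. D $$ (i, i) * x) ` range (K0_hom (\<phi> i)) = range (K0_hom (\<phi> (\<sigma> i)))" if i: "i < n" for i
    proof (rule antisym)
      let ?d = "d (\<sigma> i)"
      have Dii: "D $$ (i, i) = ?d" using i by (simp add: D_def)
      note tr' = tr(1)[OF i] tr(1)[OF \<sigma>n[OF i]]
      show "(\<lambda>x. D $$ (i, i) * x) ` range (K0_hom (\<phi> i)) \<subseteq> range (K0_hom (\<phi> (\<sigma> i)))"
        unfolding Dii using T[OF \<sigma>n[OF i]] \<pi>\<sigma>[OF i] by (intro K0_hom_range_subset[OF tr'(2,1) \<Phi>]) simp
      have sub: "(\<lambda>x. 1 / ?d * x) ` range (K0_hom (\<phi> (\<sigma> i))) \<subseteq> range (K0_hom (\<phi> i))"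
        using T'[OF \<sigma>n[OF i]] \<pi>\<sigma>[OF i] by (intro K0_hom_range_subset[OF tr' \<Psi>]) simp
      show "range (K0_hom (\<phi> (\<sigma> i))) \<subseteq> (\<lambda>x. D $$ (i, i) * x) ` range (K0_hom (\<phi> i))"
      proof
        fix y assume "y \<in> range (K0_hom (\<phi> (\<sigma> i)))"
        then have "1 / ?d * y \<in> range (K0_hom (\<phi> i))" using sub by blast
        moreover have "y = ?d * (1 / ?d * y)" using d[OF \<sigma>n[OF i]] by simp
        ultimately show "y \<in> (\<lambda>x. D $$ (i, i) * x) ` range (K0_hom (\<phi> i))" unfolding Dii by blast
      qed
    qed
  qed
qed

end
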